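(* Let $\theta:(0,\infty)\to(0,\infty)$ be given by $\theta(\alpha)=\frac12+\frac\alpha2$ if $0<\alpha\le\frac12$ and $\theta(\alpha)=\frac14+\alpha$ if $\alpha>\frac12$. For each $\alpha>0$ with $\alpha\neq\frac12$, the bilinear Navier-Stokes operator $B$ maps $D(A^{\theta(\alpha)})\times D(A^{\theta(\alpha)})$ continuously to $D(A^{\alpha-\frac14})$. If $\alpha=\frac12$, $B$ maps $D(A^{\frac34})\times D(A^{\frac34})$ continuously to $D(A^{\frac14-\varepsilon})$ for every $\varepsilon>0$.
   Context: $\mathbb{T}=[0,1]^3$ is the three-dimensional torus; $H$ is the closure in $L^2(\mathbb{T},\mathbb{R}^3)$ of the space of infinitely differentiable divergence-free periodic vector fields on $\mathbb{R}^3$ with zero mean. $A=-\Delta$ with domain $D(A)=\{u\in H:\Delta u\in H\}$ is the Stokes operator, a positive self-adjoint operator on $H$, with powers $A^\beta$, $\beta\in\mathbb{R}$; $D(A^\beta)$ is normed by $|A^\beta u|_H$ (for $\beta<0$ it is the completion of $H$ in this norm, i.e. the dual of $D(A^{-\beta})$). $B(u,v)=\mathbb{P}_{\mathrm{div}}\,(u\cdot\nabla)v$, where $\mathbb{P}_{\mathrm{div}}$ is the projection onto divergence-free vector fields. Continuity of the bilinear map means $|A^{\gamma}B(u,v)|_H\le C|A^{\theta(\alpha)}u|_H|A^{\theta(\alpha)}v|_H$ with $C$ independent of $u,v$, where $\gamma$ is the exponent of the target space. *)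

theory Defs
  imports "HOL-Analysis.Analysis"
begin

text \<open>
  Elements of \<open>L\<^sup>p\<close> spaces are represented by functions modulo equality almost everywhere on
  the unit cube; values outside the cube are irrelevant for them. The descriptions with
  \<open>SOME\<close> below choose a representative of a class that is unique modulo null sets.
\<close>

type_synonym field = "real^3 \<Rightarrow> real^3"

definition torus :: "(real^3) measure" where
  "torus = restrict_space lborel (cbox 0 1)"

definition L2_fields :: "field set" where
  "L2_fields = {u. u \<in> borel_measurable torus \<and> integrable torus (\<lambda>x. (norm (u x))\<^sup>2)}"

definition L2_inner :: "field \<Rightarrow> field \<Rightarrow> real" where
  "L2_inner u v = (LINT x|torus. u x \<bullet> v x)"

definition L2_norm :: "field \<Rightarrow> real" where
  "L2_norm u = sqrt (LINT x|torus. (norm (u x))\<^sup>2)"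

primrec Ck :: "nat \<Rightarrow> ('a::euclidean_space \<Rightarrow> 'b::euclidean_space) \<Rightarrow> bool" where
  "Ck 0 f = continuous_on UNIV f"
| "Ck (Suc n) f = ((\<forall>x. f differentiable (at x)) \<and>
     (\<forall>h. Ck n (\<lambda>x. frechet_derivative f (at x) h)))"

definition smooth :: "('a::euclidean_space \<Rightarrow> 'b::euclidean_space) \<Rightarrow> bool" where
  "smooth f \<longleftrightarrow> (\<forall>n. Ck n f)"

definition partial :: "3 \<Rightarrow> field \<Rightarrow> field" where
  "partial i f x = frechet_derivative f (at x) (axis i 1)"

definition divergence :: "field \<Rightarrow> real^3 \<Rightarrow> real" where
  "divergence f x = (\<Sum>i\<in>UNIV. partial i f x $ i)"

definition laplacian :: "field \<Rightarrow> field" where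
  "laplacian f x = (\<Sum>i\<in>UNIV. partial i (partial i f) x)"

definition test_fields :: "field set" where
  "test_fields = {\<phi>. smooth \<phi> \<and> (\<forall>x i. \<phi> (x + axis i 1) = \<phi> x)}"

definition solenoidal_fields :: "field set" where
  "solenoidal_fields =
     {\<phi> \<in> test_fields. (\<forall>x. divergence \<phi> x = 0) \<and> (LINT x|torus. \<phi> x) = 0}"

text \<open>The space \<open>H\<close>: the closure of the solenoidal fields in \<open>L\<^sup>2\<close>.\<close>

definition H_space :: "field set" where
  "H_space = {u \<in> L2_fields.
     \<forall>\<epsilon>>0. \<exists>\<phi>\<in>solenoidal_fields. L2_norm (\<lambda>x. u x - \<phi> x) < \<epsilon>}"

text \<open>The graph of the Stokes operator: \<open>u\<close> lies in its domain and \<open>A u = w\<close>. The Laplacian is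
  taken in the sense of periodic distributions, so the test fields need not be solenoidal.\<close>

definition stokes_graph :: "field \<Rightarrow> field \<Rightarrow> bool" where
  "stokes_graph u w \<longleftrightarrow> u \<in> H_space \<and> w \<in> H_space \<and>
     (\<forall>\<phi>\<in>test_fields. L2_inner u (laplacian \<phi>) = - L2_inner w \<phi>)"

definition stokes_eigen :: "real \<Rightarrow> field \<Rightarrow> bool" where
  "stokes_eigen l e \<longleftrightarrow> stokes_graph e (\<lambda>x. l *\<^sub>R e x) \<and> L2_norm e \<noteq> 0"

text \<open>
  Spectral calculus. The operator has compact resolvent, so its eigenvectors span a dense subspace
  of \<open>H\<close>, and with \<open>P\<^sub>l\<close> the projection onto the eigenspace of \<open>l\<close> the power is
  \<open>A\<^sup>\<beta> u = \<Sum>\<^sub>l l\<^sup>\<beta> P\<^sub>l u\<close>, with domain those \<open>u\<close> for which the series converges in \<open>H\<close>.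
  That \<open>w\<close> is the sum of this series means \<open>P\<^sub>l w = l\<^sup>\<beta> P\<^sub>l u\<close> for all eigenvalues \<open>l\<close>, which is
  expressed by testing against all eigenvectors. For \<open>\<beta> < 0\<close> the power defined here is the bounded
  operator on \<open>H\<close>; its domain as a completion is treated further below.
\<close>

definition stokes_power_graph :: "real \<Rightarrow> field \<Rightarrow> field \<Rightarrow> bool" where
  "stokes_power_graph \<beta> u w \<longleftrightarrow> u \<in> H_space \<and> w \<in> H_space \<and>
     (\<forall>l e. stokes_eigen l e \<longrightarrow> L2_inner w e = l powr \<beta> * L2_inner u e)"

definition stokes_dom :: "real \<Rightarrow> field set" where
  "stokes_dom \<beta> = {u. \<exists>w. stokes_power_graph \<beta> u w}"

definition stokes_power :: "real \<Rightarrow> field \<Rightarrow> field" where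
  "stokes_power \<beta> u = (SOME w. stokes_power_graph \<beta> u w)"

definition stokes_norm :: "real \<Rightarrow> field \<Rightarrow> real" where
  "stokes_norm \<beta> u = L2_norm (stokes_power \<beta> u)"

definition leray :: "field \<Rightarrow> field" where
  "leray f = (SOME p. p \<in> H_space \<and> (\<forall>h\<in>H_space. L2_inner (\<lambda>x. f x - p x) h = 0))"

text \<open>
  Periodic vector-valued distributions are linear functionals on \<^const>\<open>test_fields\<close>; an integrable
  field \<open>g\<close> is identified with \<open>\<phi> \<mapsto> \<integral> g \<bullet> \<phi>\<close>. The divergence-free projection extends from \<open>L\<^sup>2\<close> to
  integrable fields by duality, as it is symmetric and preserves smoothness. This is needed because
  \<open>(u \<cdot> \<nabla>) v\<close> need not be square integrable.
\<close>

type_synonym distribution = "field \<Rightarrow> real"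

definition leray_dist :: "field \<Rightarrow> distribution" where
  "leray_dist g = (\<lambda>\<phi>. L2_inner g (leray \<phi>))"

definition weak_partial_graph :: "3 \<Rightarrow> field \<Rightarrow> field \<Rightarrow> bool" where
  "weak_partial_graph i v w \<longleftrightarrow> integrable torus v \<and> integrable torus w \<and>
     (\<forall>\<phi>\<in>test_fields. L2_inner v (partial i \<phi>) = - L2_inner w \<phi>)"

definition weak_partial :: "3 \<Rightarrow> field \<Rightarrow> field" where
  "weak_partial i v = (SOME w. weak_partial_graph i v w)"

definition convective :: "field \<Rightarrow> field \<Rightarrow> field" where
  "convective u v x = (\<Sum>i\<in>UNIV. (u x $ i) *\<^sub>R weak_partial i v x)"

definition B_defined :: "field \<Rightarrow> field \<Rightarrow> bool" where
  "B_defined u v \<longleftrightarrow> (\<forall>i. \<exists>w. weak_partial_graph i v w) \<and> integrable torus (convective u v)"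

definition B_op :: "field \<Rightarrow> field \<Rightarrow> distribution" where
  "B_op u v = leray_dist (convective u v)"

text \<open>
  The space \<open>D(A\<^sup>\<gamma>)\<close> inside the distributions, for all real \<open>\<gamma>\<close>. For \<open>\<gamma> \<ge> 0\<close> these are the elements
  of \<^term>\<open>stokes_dom \<gamma>\<close>. For \<open>\<gamma> < 0\<close> it is the dual of \<open>D(A\<^sup>-\<^sup>\<gamma>)\<close>: a functional on \<open>D(A\<^sup>-\<^sup>\<gamma>)\<close> is
  turned into a distribution by composing it with the projection, and since the projections of test
  fields are dense in \<open>D(A\<^sup>-\<^sup>\<gamma>)\<close>, the distributions obtained in this way are those bounded by
  \<open>|A\<^sup>-\<^sup>\<gamma> P \<phi>|\<close>.
\<close>

definition represents :: "field \<Rightarrow> distribution \<Rightarrow> bool" where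
  "represents u f \<longleftrightarrow> (\<forall>\<phi>\<in>test_fields. f \<phi> = L2_inner u \<phi>)"

definition linear_on_tests :: "distribution \<Rightarrow> bool" where
  "linear_on_tests f \<longleftrightarrow> (\<forall>\<phi>\<in>test_fields. \<forall>\<psi>\<in>test_fields. \<forall>a b.
     f (\<lambda>x. a *\<^sub>R \<phi> x + b *\<^sub>R \<psi> x) = a * f \<phi> + b * f \<psi>)"

definition scale_space :: "real \<Rightarrow> distribution set" where
  "scale_space \<gamma> =
     (if \<gamma> \<ge> 0 then {f. \<exists>u\<in>stokes_dom \<gamma>. represents u f}
      else {f. linear_on_tests f \<and>
               (\<exists>M. \<forall>\<phi>\<in>test_fields. \<bar>f \<phi>\<bar> \<le> M * stokes_norm (- \<gamma>) (leray \<phi>))})"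

definition scale_norm :: "real \<Rightarrow> distribution \<Rightarrow> real" where
  "scale_norm \<gamma> f =
     (if \<gamma> \<ge> 0 then stokes_norm \<gamma> (SOME u. u \<in> stokes_dom \<gamma> \<and> represents u f)
      else Sup {\<bar>f \<phi>\<bar> | \<phi>. \<phi> \<in> test_fields \<and> stokes_norm (- \<gamma>) (leray \<phi>) \<le> 1})"

text \<open>The first conjunct makes explicit that \<open>B(u,v)\<close> has a meaning: the weak gradient of \<open>v\<close> exists
  and \<open>(u \<cdot> \<nabla>) v\<close> is integrable, so that no unspecified choice enters.\<close>

definition B_maps_continuously :: "real \<Rightarrow> real \<Rightarrow> bool" where
  "B_maps_continuously s \<gamma> \<longleftrightarrow>
     (\<exists>C. \<forall>u\<in>stokes_dom s. \<forall>v\<in>stokes_dom s.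
        B_defined u v \<and> B_op u v \<in> scale_space \<gamma> \<and>
        scale_norm \<gamma> (B_op u v) \<le> C * stokes_norm s u * stokes_norm s v)"

definition theta :: "real \<Rightarrow> real" where
  "theta \<alpha> = (if \<alpha> \<le> 1/2 then 1/2 + \<alpha>/2 else 1/4 + \<alpha>)"

end

theory Submission
  imports Defs
begin

text \<open>
  On the Fourier side \<open>u \<in> D(A\<^sup>s)\<close> means that \<open>a\<^sub>p = |p|\<^bsup>2s\<^esup> |u\<^sub>p|\<close> is square summable over the nonzero
  integer points, and, because \<open>p \<cdot> u\<^sub>p = 0\<close>, the \<open>k\<close>-th coefficient of \<open>A\<^sup>\<gamma> B(u,v)\<close> is at most a
  constant times \<open>\<Sum> a\<^sub>p b\<^sub>q m(p,q)\<close> over \<open>p + q = k\<close>, where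
  \<open>m(p,q) = |p|\<^bsup>-2s\<^esup> |q|\<^bsup>-2s\<^esup> |k|\<^bsup>2\<gamma>\<^esup> min |q| |k|\<close>. By Cauchy--Schwarz such a sum is bounded in
  \<open>\<ell>\<^sup>2\<close> as soon as \<open>\<Sum>\<^sub>p m(p,q)\<^sup>2\<close> is bounded uniformly in \<open>q\<close>, or the same with \<open>p\<close> and \<open>q\<close>
  exchanged. The first holds for the part \<open>|p| \<le> |q|\<close> and the second for the part \<open>|q| \<le> |p|\<close>;
  both follow from \<open>\<Sum> |k|\<^bsup>-t\<^esup> \<le> C R\<^bsup>3-t\<^esup>\<close> over \<open>0 < |k| \<le> R\<close> for \<open>t < 3\<close> and from the
  convergence of the full sum for \<open>t > 3\<close>, even at the scaling-critical exponents \<open>\<alpha> < 1/2\<close>.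
\<close>

section \<open>Fourier coefficients on the torus\<close>

text \<open>The two formulas for \<theta> and the loss of \<epsilon> come from one sum. For |p|
  \<le> |q| with |k| comparable to |q|, the square sum of the kernel over p contains the sum of
  |p|^(-4s), where s = \<theta>(\<alpha>). If \<alpha> < 1/2 then 4s = 2 + 2\<alpha> < 3, and the
  growth R^(3-4s) at R = |q| exactly cancels the remaining power of |q|. If \<alpha> > 1/2 then 4s =
  1 + 4\<alpha> > 3: the sum converges and no power of |q| is left over. At \<alpha> = 1/2 the
  exponent is 3, the sum grows logarithmically, and lowering \<gamma> supplies a power of |q| that
  absorbs it.

  Descriptions fix a field only up to null sets, so every notion is translated into a condition on
  Fourier coefficients. A weak derivative is at first known only to be integrable, whence uniqueness
  of coefficients for integrable functions. The field (u \<cdot> \<nabla>) v is only integrable too,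
  so its pairing with a projected test field rests on the absolute summability of the coefficients
  of the latter.\<close>

definition freq :: "(real^3) set" where
  "freq = {k. \<forall>i. k $ i \<in> \<int>}"

definition wave :: "real^3 \<Rightarrow> real^3 \<Rightarrow> complex" where
  "wave k x = cis (2 * pi * (k \<bullet> x))"

definition fourier :: "(real^3 \<Rightarrow> complex) \<Rightarrow> real^3 \<Rightarrow> complex" where
  "fourier f k = (LINT x|torus. f x * wave (- k) x)"

lemma freq_zero [simp]: "0 \<in> freq"
  by (simp add: freq_def)

lemma freq_add [simp]: "k \<in> freq \<Longrightarrow> m \<in> freq \<Longrightarrow> k + m \<in> freq"
  by (simp add: freq_def)

lemma freq_diff [simp]: "k \<in> freq \<Longrightarrow> m \<in> freq \<Longrightarrow> k - m \<in> freq"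
  by (simp add: freq_def)

lemma freq_uminus_iff [simp]: "- k \<in> freq \<longleftrightarrow> k \<in> freq"
  by (simp add: freq_def)

lemma freq_axis [simp]: "axis i 1 \<in> freq"
  by (simp add: freq_def axis_def)

lemma wave_0 [simp]: "wave 0 x = 1"
  by (simp add: wave_def)

lemma wave_add: "wave (k + m) x = wave k x * wave m x"
  by (simp add: wave_def cis_mult inner_add_left algebra_simps)

lemma wave_add_right: "wave k (x + y) = wave k x * wave k y"
  by (simp add: wave_def cis_mult inner_add_right algebra_simps)

lemma cnj_wave: "cnj (wave k x) = wave (- k) x"
  by (simp add: wave_def cis_cnj)

lemma cmod_wave [simp]: "cmod (wave k x) = 1"
  by (simp add: wave_def)

lemma continuous_on_wave [continuous_intros]:
  "continuous_on S f \<Longrightarrow> continuous_on S (\<lambda>x. wave k (f x))"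
  unfolding wave_def cis_conv_exp by (intro continuous_intros)

lemma wave_measurable [measurable]: "wave k \<in> borel_measurable borel"
  by (intro borel_measurable_continuous_onI continuous_intros)

lemma wave_shift: "wave k (x + axis i t) = cis (2 * pi * t * (k $ i)) * wave k x"
  by (simp add: wave_add_right) (simp add: wave_def inner_axis algebra_simps)

lemma wave_periodic: "k \<in> freq \<Longrightarrow> wave k (x + axis i 1) = wave k x"
  by (auto simp: wave_shift freq_def cis_multiple_2pi)

lemma space_torus [simp]: "space torus = cbox 0 1"
  by (simp add: torus_def space_restrict_space)

lemma measurable_torusI [measurable (raw)]:
  "f \<in> borel_measurable borel \<Longrightarrow> f \<in> borel_measurable torus"
  unfolding torus_def by (intro measurable_restrict_space1) simp

lemma measure_torus: "measure torus (cbox 0 1) = 1"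
proof -
  have "cbox (0::real^3) 1 \<noteq> {}"
    by (simp add: interval_ne_empty_cart)
  then have "measure lborel (cbox (0::real^3) 1) = 1"
    by (simp add: content_cbox_cart)
  then show ?thesis
    by (simp add: torus_def measure_restrict_space)
qed

interpretation torus: finite_measure torus
proof
  show "emeasure torus (space torus) \<noteq> \<infinity>"
    by (simp add: torus_def emeasure_restrict_space emeasure_lborel_cbox_eq)
qed

lemma torus_total [simp]: "(LINT x|torus. c) = (c::'a::{banach,second_countable_topology})"
  by (simp add: measure_torus)

lemma integrable_torus_continuous:
  fixes f :: "real^3 \<Rightarrow> 'b::{banach,second_countable_topology}"
  assumes "continuous_on UNIV f"
  shows "integrable torus f"
  unfolding torus_def
  by (subst integrable_restrict_space)
     (auto intro!: borel_integrable_compact continuous_on_subset[OF assms])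

lemma integral_torus_eq:
  fixes f :: "real^3 \<Rightarrow> 'b::euclidean_space"
  assumes "continuous_on UNIV f"
  shows "(LINT x|torus. f x) = integral (cbox 0 1) f"
proof -
  have "set_integrable lborel (cbox 0 1) f"
    unfolding set_integrable_def
    by (auto intro!: borel_integrable_compact continuous_on_subset[OF assms])
  from set_borel_integral_eq_integral(2)[OF this] show ?thesis
    by (simp add: torus_def integral_restrict_space set_lebesgue_integral_def)
qed

lemma bounded_on_torus:
  fixes f :: "real^3 \<Rightarrow> 'b::real_normed_vector"
  assumes "continuous_on UNIV f"
  obtains B where "B > 0" "\<And>x. x \<in> cbox 0 1 \<Longrightarrow> norm (f x) \<le> B"
proof -
  have "bounded (f ` cbox 0 1)"
    by (intro compact_imp_bounded compact_continuous_image continuous_on_subset[OF assms]) auto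
  then show ?thesis using that by (auto simp: bounded_pos)
qed

text \<open>Only a slab of thickness t leaves the unit cube under the translation. Periodicity moves
  it back onto the slab that the translated cube has vacated.\<close>

lemma integral_torus_shift:
  fixes f :: "real^3 \<Rightarrow> 'b::euclidean_space"
  assumes cont: "continuous_on UNIV f" and per: "\<And>x. f (x + axis i 1) = f x"
    and t: "0 \<le> t" "t \<le> 1"
  shows "(LINT x|torus. f (x + axis i t)) = (LINT x|torus. f x)"
proof -
  let ?e = "axis i 1 :: real^3"
  have B: "?e \<in> Basis" by (simp add: axis_in_Basis_iff)
  have cS: "continuous_on S f" for S using cont continuous_on_subset by blast
  have cs: "continuous_on UNIV (\<lambda>x. f (x + axis i t))"
    by (intro continuous_on_compose2[OF cont] continuous_intros) auto
  have ax: "axis i (a::real) = (\<chi> j. if j = i then a else 0)" for a by (simp add: axis_def vec_eq_iff)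
  \<comment> \<open>The box whose i-th side is [a, b] and whose other sides are [0, 1].\<close>
  define A where "A a b = cbox (\<chi> j. if j = i then a else 0) (\<chi> j. if j = i then b else (1::real))" for a b
  have int: "f integrable_on A a b" for a b
    unfolding A_def by (intro integrable_continuous cS)
  have split: "integral (A a b) f = integral (A a c) f + integral (A c b) f" if "a \<le> c" "c \<le> b" for a b c
  proof -
    have "A a b \<inter> {x. x \<bullet> ?e \<le> c} = A a c" "A a b \<inter> {x. x \<bullet> ?e \<ge> c} = A c b"
      using that unfolding A_def
      by (auto simp: mem_box_cart inner_axis set_eq_iff split: if_splits)
    with integral_split[OF int[unfolded A_def] B, folded A_def, of a b c] show ?thesis by simp
  qed
  have shift: "integral (A a b) (\<lambda>x. f (x + axis i c)) = integral (A (a + c) (b + c)) f" for a b c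
  proof -
    have "A (a + c) (b + c) = cbox ((\<chi> j. if j = i then a else 0) + axis i c) ((\<chi> j. if j = i then b else 1) + axis i c)"
      unfolding A_def ax by (intro arg_cong2[where f = cbox]) (auto simp: vec_eq_iff)
    then show ?thesis
      using integral_shift_cbox_plus[of "(\<chi> j. if j = i then a else 0)" "(\<chi> j. if j = i then b else 1)" f "axis i c"]
      unfolding A_def by (simp add: o_def add.commute)
  qed
  have A01: "cbox 0 1 = A 0 1"
    unfolding A_def by (intro arg_cong2[where f = cbox]) (auto simp: vec_eq_iff)
  have "(LINT x|torus. f (x + axis i t)) = integral (A t (1 + t)) f"
    using shift[of 0 1 t] by (simp add: integral_torus_eq[OF cs] A01)
  also have "\<dots> = integral (A t 1) f + integral (A 1 (1 + t)) f"
    using t by (intro split) auto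
  also have "integral (A 1 (1 + t)) f = integral (A 0 t) f"
    using shift[of 0 t 1] by (simp add: per add.commute)
  also have "integral (A t 1) f + integral (A 0 t) f = integral (A 0 1) f"
    using split[of 0 t 1] t by simp
  finally show ?thesis
    by (simp add: integral_torus_eq[OF cont] A01)
qed

text \<open>If some k_i is nonzero, a shift by half a wavelength in direction i changes the sign of
  the wave but not its integral. The shift has length at most 1 because |k_i| \<ge> 1 for
  integers.\<close>

lemma integral_wave:
  assumes "k \<in> freq"
  shows "(LINT x|torus. wave k x) = (if k = 0 then 1 else 0)"
proof (cases "k = 0")
  case True
  then show ?thesis using torus_total[of "1::complex"] by (simp del: lebesgue_integral_const)
next
  case False
  then obtain i where i: "k $ i \<noteq> 0" by (auto simp: vec_eq_iff)
  then have "\<bar>k $ i\<bar> \<ge> 1"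
    using assms Ints_nonzero_abs_ge1 unfolding freq_def by blast
  then have t: "0 \<le> 1 / (2 * \<bar>k $ i\<bar>)" "1 / (2 * \<bar>k $ i\<bar>) \<le> 1"
    by (auto simp: field_simps)
  let ?t = "1 / (2 * \<bar>k $ i\<bar>)"
  have c: "cis (2 * pi * ?t * (k $ i)) = -1"
    using i by (cases "k $ i > 0") (auto simp: complex_eq_iff)
  have "(LINT x|torus. wave k (x + axis i ?t)) = (LINT x|torus. wave k x)"
    using t by (intro integral_torus_shift continuous_intros) (auto simp: wave_periodic assms)
  then have "- (LINT x|torus. wave k x) = (LINT x|torus. wave k x)"
    unfolding wave_shift c by simp
  then show ?thesis using False by (simp add: complex_eq_iff)
qed

lemma integrable_mult_wave:
  assumes "integrable torus f"
  shows "integrable torus (\<lambda>x. f x * wave k x)"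
proof (rule Bochner_Integration.integrable_bound[OF assms])
  show "(\<lambda>x. f x * wave k x) \<in> borel_measurable torus"
    using borel_measurable_integrable[OF assms] by measurable
qed (auto simp: norm_mult)

lemma fourier_0: "fourier (\<lambda>x. 0) k = 0"
  by (simp add: fourier_def)

lemma fourier_add:
  "integrable torus f \<Longrightarrow> integrable torus g \<Longrightarrow> fourier (\<lambda>x. f x + g x) k = fourier f k + fourier g k"
  by (simp add: fourier_def ring_distribs integrable_mult_wave)

lemma fourier_diff:
  "integrable torus f \<Longrightarrow> integrable torus g \<Longrightarrow> fourier (\<lambda>x. f x - g x) k = fourier f k - fourier g k"
  by (simp add: fourier_def ring_distribs integrable_mult_wave)

lemma fourier_scale: "fourier (\<lambda>x. c * f x) k = c * fourier f k"
  by (simp add: fourier_def mult.assoc)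

lemma fourier_sum:
  "(\<And>i. i \<in> I \<Longrightarrow> integrable torus (f i)) \<Longrightarrow> fourier (\<lambda>x. \<Sum>i\<in>I. f i x) k = (\<Sum>i\<in>I. fourier (f i) k)"
  by (simp add: fourier_def sum_distrib_right integrable_mult_wave)

lemma fourier_cnj: "fourier (\<lambda>x. cnj (f x)) k = cnj (fourier f (- k))"
  by (simp add: fourier_def cnj_wave flip: Bochner_Integration.integral_cnj)

lemma fourier_wave_mult: "fourier (\<lambda>x. wave m x * f x) k = fourier f (k - m)"
proof -
  have "wave m x * f x * wave (- k) x = f x * wave (- (k - m)) x" for x
    using wave_add[of m "- k" x] by (simp add: mult.commute mult.left_commute)
  then show ?thesis unfolding fourier_def by presburger
qed

lemma fourier_wave:
  assumes "k \<in> freq" "m \<in> freq"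
  shows "fourier (wave m) k = (if k = m then 1 else 0)"
  using fourier_wave_mult[of m "\<lambda>_. 1" k] integral_wave[of "m - k"] assms
  by (auto simp: fourier_def)

section \<open>Uniqueness of Fourier coefficients\<close>

text \<open>These functions are stable under multiplication by waves, hence by trigonometric
  polynomials. Everything below enlarges the class of multipliers against which they integrate to
  zero, up to indicators of compact sets.\<close>

definition fourier_null :: "(real^3 \<Rightarrow> complex) \<Rightarrow> bool" where
  "fourier_null f \<longleftrightarrow> integrable torus f \<and> (\<forall>k\<in>freq. fourier f k = 0)"

lemma fourier_null_zero: "fourier_null (\<lambda>x. 0)"
  by (simp add: fourier_null_def fourier_0)

lemma fourier_null_add: "fourier_null f \<Longrightarrow> fourier_null g \<Longrightarrow> fourier_null (\<lambda>x. f x + g x)"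
  by (simp add: fourier_null_def fourier_add)

lemma fourier_null_scale: "fourier_null f \<Longrightarrow> fourier_null (\<lambda>x. c * f x)"
  by (simp add: fourier_null_def fourier_scale)

lemma fourier_null_sum: "(\<And>i. i \<in> I \<Longrightarrow> fourier_null (f i)) \<Longrightarrow> fourier_null (\<lambda>x. \<Sum>i\<in>I. f i x)"
  by (induction I rule: infinite_finite_induct) (auto simp: fourier_null_zero fourier_null_add)

lemma fourier_null_wave: "fourier_null f \<Longrightarrow> m \<in> freq \<Longrightarrow> fourier_null (\<lambda>x. wave m x * f x)"
  using integrable_mult_wave[of f m] by (simp add: fourier_null_def fourier_wave_mult) (simp add: mult.commute)

text \<open>The embedding of the torus into six-dimensional space by cosines and sines. Polynomials
  in the image coordinates are trigonometric polynomials, so the Stone-Weierstrass theorem on the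
  compact image gives the density of the latter.\<close>

definition trig_map :: "real^3 \<Rightarrow> (real^3) \<times> (real^3)" where
  "trig_map x = (\<chi> j. cos (2 * pi * x $ j), \<chi> j. sin (2 * pi * x $ j))"

lemma continuous_on_trig_map [continuous_intros]: "continuous_on S trig_map"
  unfolding trig_map_def by (intro continuous_intros)

lemma fourier_null_mult_cos:
  assumes "fourier_null f"
  shows "fourier_null (\<lambda>x. f x * of_real (cos (2 * pi * x $ j)))"
proof -
  have eq: "f x * of_real (cos (2 * pi * x $ j)) =
     (1/2) * (wave (axis j 1) x * f x + wave (- axis j 1) x * f x)" for x
    by (simp add: wave_def inner_axis complex_eq_iff inner_commute[of "axis j 1"])
  show ?thesis unfolding eq
    by (intro fourier_null_scale fourier_null_add fourier_null_wave assms) simp_all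
qed

lemma fourier_null_mult_sin:
  assumes "fourier_null f"
  shows "fourier_null (\<lambda>x. f x * of_real (sin (2 * pi * x $ j)))"
proof -
  have eq: "f x * of_real (sin (2 * pi * x $ j)) =
     (-\<i>/2) * (wave (axis j 1) x * f x + (-1) * (wave (- axis j 1) x * f x))" for x
    by (simp add: wave_def inner_axis complex_eq_iff inner_commute[of "axis j 1"])
  show ?thesis unfolding eq
    by (intro fourier_null_scale fourier_null_add fourier_null_wave assms) simp_all
qed

text \<open>The induction keeps f arbitrary: a product P Q is handled by multiplying f with P first
  and applying the hypothesis for Q to the result. A linear functional is a combination of the
  cosine and sine coordinates.\<close>

lemma fourier_null_mult_polynomial:
  assumes "real_polynomial_function P"
  shows "fourier_null f \<Longrightarrow> fourier_null (\<lambda>x. f x * of_real (P (trig_map x)))"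
  using assms
proof (induction arbitrary: f)
  case (linear L)
  have b: "fourier_null (\<lambda>x. f x * of_real (trig_map x \<bullet> b))" if "b \<in> Basis" for b
    using that fourier_null_mult_cos[OF linear.prems] fourier_null_mult_sin[OF linear.prems]
    by (auto simp: Basis_prod_def Basis_vec_def trig_map_def inner_axis)
  have L: "L z = (\<Sum>b\<in>Basis. (z \<bullet> b) * L b)" for z
  proof -
    have "L z = L (\<Sum>b\<in>Basis. (z \<bullet> b) *\<^sub>R b)" by (simp only: euclidean_representation)
    also have "\<dots> = (\<Sum>b\<in>Basis. (z \<bullet> b) * L b)"
      using bounded_linear.linear[OF linear.hyps] by (simp only: linear_sum linear_scale real_scaleR_def)
    finally show ?thesis .
  qed
  have "f x * of_real (L (trig_map x)) = (\<Sum>b\<in>Basis. of_real (L b) * (f x * of_real (trig_map x \<bullet> b)))" for x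
    unfolding L[of "trig_map x"] of_real_sum of_real_mult sum_distrib_left by (simp only: mult_ac)
  then show ?case
    by (simp add: fourier_null_sum fourier_null_scale b del: of_real_mult)
next
  case (const c)
  then show ?case using fourier_null_scale[of f c] by (simp add: mult.commute)
next
  case (add P Q)
  then show ?case by (simp add: ring_distribs fourier_null_add)
next
  case (mult P Q)
  have "fourier_null (\<lambda>x. f x * of_real (P (trig_map x)) * of_real (Q (trig_map x)))"
    by (intro mult.IH mult.prems)
  then show ?case by (simp add: mult.assoc)
qed

lemma fourier_null_integral: "fourier_null f \<Longrightarrow> (LINT x|torus. f x) = 0"
  using freq_zero unfolding fourier_null_def fourier_def by (fastforce simp del: freq_zero)

lemma integrable_mult_bounded:
  fixes f :: "'a \<Rightarrow> 'b::{real_normed_algebra,banach,second_countable_topology}"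
  assumes "integrable M f" "g \<in> borel_measurable M" "\<And>x. x \<in> space M \<Longrightarrow> norm (g x) \<le> B"
  shows "integrable M (\<lambda>x. f x * g x)"
proof (rule Bochner_Integration.integrable_bound)
  show "integrable M (\<lambda>x. B * norm (f x))" using assms by simp
  show "(\<lambda>x. f x * g x) \<in> borel_measurable M" using assms by measurable
  show "AE x in M. norm (f x * g x) \<le> norm (B * norm (f x))"
  proof (rule AE_I2)
    fix x assume "x \<in> space M"
    then have "norm (f x * g x) \<le> norm (f x) * B"
      by (intro order_trans[OF norm_mult_ineq] mult_left_mono assms) auto
    then show "norm (f x * g x) \<le> norm (B * norm (f x))" by (simp add: mult.commute)
  qed
qed

text \<open>Replacing G by a polynomial that is uniformly close on the image of the cube changes the
  integral by at most the uniform error times the L^1 norm of f.\<close>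

lemma fourier_null_mult_continuous:
  assumes f: "fourier_null f" and G: "continuous_on UNIV G"
  shows "(LINT x|torus. f x * of_real (G (trig_map x))) = 0"
proof -
  have fi: "integrable torus f" using f by (simp add: fourier_null_def)
  let ?S = "trig_map ` cbox 0 1"
  have S: "compact ?S" by (intro compact_continuous_image continuous_intros) auto
  have cG: "continuous_on UNIV (\<lambda>x. complex_of_real (G (trig_map x)))"
    by (intro continuous_intros continuous_on_compose2[OF G]) auto
  obtain B where B: "\<And>x. x \<in> cbox 0 1 \<Longrightarrow> norm (complex_of_real (G (trig_map x))) \<le> B"
    using bounded_on_torus[OF cG] by blast
  have iG: "integrable torus (\<lambda>x. f x * of_real (G (trig_map x)))"
    by (rule integrable_mult_bounded[OF fi _ B])
       (auto intro!: measurable_torusI borel_measurable_continuous_onI cG)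
  define I where "I = (LINT x|torus. norm (f x))"
  have I: "I \<ge> 0" by (simp add: I_def)
  have "norm (LINT x|torus. f x * of_real (G (trig_map x))) \<le> e" if "e > 0" for e
  proof -
    \<comment> \<open>The summand 1 keeps the quotient meaningful when f has L^1 norm 0.\<close>
    have "e / (I + 1) > 0" using I that by simp
    then obtain P where P: "real_polynomial_function P" "\<And>y. y \<in> ?S \<Longrightarrow> \<bar>G y - P y\<bar> < e / (I + 1)"
      using Stone_Weierstrass_real_polynomial_function[OF S continuous_on_subset[OF G], of "e / (I + 1)"] by auto
    have nP: "fourier_null (\<lambda>x. f x * of_real (P (trig_map x)))"
      by (rule fourier_null_mult_polynomial[OF P(1) f])
    then have iP: "integrable torus (\<lambda>x. f x * of_real (P (trig_map x)))" by (simp add: fourier_null_def)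
    have "(LINT x|torus. f x * of_real (G (trig_map x))) =
          (LINT x|torus. f x * of_real (G (trig_map x)) - f x * of_real (P (trig_map x)))"
      using fourier_null_integral[OF nP] iG iP by simp
    also have "norm \<dots> \<le> (LINT x|torus. norm (f x * of_real (G (trig_map x)) - f x * of_real (P (trig_map x))))"
      by (rule integral_norm_bound)
    also have "\<dots> \<le> (LINT x|torus. e / (I + 1) * norm (f x))"
    proof (rule integral_mono)
      fix x assume "x \<in> space torus"
      then have "\<bar>G (trig_map x) - P (trig_map x)\<bar> \<le> e / (I + 1)" using P(2)[of "trig_map x"] by auto
      moreover have "norm (f x * of_real (G (trig_map x)) - f x * of_real (P (trig_map x))) =
          \<bar>G (trig_map x) - P (trig_map x)\<bar> * norm (f x)"
        by (simp add: norm_mult flip: right_diff_distrib of_real_diff)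
      ultimately show "norm (f x * of_real (G (trig_map x)) - f x * of_real (P (trig_map x))) \<le> e / (I + 1) * norm (f x)"
        by (metis mult_right_mono norm_ge_zero)
    qed (use iG iP fi in auto)
    also have "\<dots> = e / (I + 1) * I" by (simp add: I_def)
    also have "\<dots> \<le> e" using I that by (simp add: field_simps)
    finally show ?thesis .
  qed
  then have "norm (LINT x|torus. f x * of_real (G (trig_map x))) \<le> 0"
    by (intro field_le_epsilon[of _ 0]) (simp only: add_0)
  then show ?thesis by (simp only: norm_le_zero_iff)
qed

text \<open>Opposite faces of the cube have the same image, so injectivity needs one of the two
  points in the interior.\<close>

lemma trig_map_eqD:
  assumes "trig_map x = trig_map y" "x \<in> cbox 0 1" "y \<in> box 0 1"
  shows "x = y"
proof -
  have "x $ j = y $ j" for j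
  proof -
    have "cos (2 * pi * x $ j) = cos (2 * pi * y $ j)" "sin (2 * pi * x $ j) = sin (2 * pi * y $ j)"
      using assms(1) by (auto simp: trig_map_def vec_eq_iff)
    then obtain n :: int where n: "2 * pi * x $ j = 2 * pi * y $ j + 2 * pi * n"
      using sin_cos_eq_iff by (metis mult.commute mult.assoc)
    then have "2 * pi * (x $ j - y $ j) = 2 * pi * n" by (simp add: algebra_simps)
    then have d: "x $ j - y $ j = n" by simp
    moreover have "0 \<le> x $ j" "x $ j \<le> 1" "0 < y $ j" "y $ j < 1"
      using assms(2,3) by (auto simp: mem_box_cart)
    ultimately have "\<bar>real_of_int n\<bar> < 1" by linarith
    then have "n = 0" by linarith
    then show ?thesis using d by simp
  qed
  then show ?thesis by (simp add: vec_eq_iff)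
qed

text \<open>The indicator of C is the pointwise limit on the cube of continuous functions of
  \<open>trig_map x\<close>, cut off at shrinking distance from the image of C. Since C stays away
  from the faces, no other point of the cube is mapped into that image.\<close>

lemma fourier_null_integral_compact:
  assumes f: "fourier_null f" and C: "compact C" "C \<subseteq> box 0 1"
  shows "(LINT x|torus. f x * indicator C x) = 0"
\<comment> \<open>The distance \<open>infdist\<close> to the empty set is 0, so the cut-off
  functions below would be constantly 1 for empty C.\<close>
proof (cases "C = {}")
  case False
  define h where "h n y = max 0 (1 - real n * infdist y (trig_map ` C))" for n y
  have ch: "continuous_on UNIV (h n)" for n unfolding h_def by (intro continuous_intros)
  have cl: "closed (trig_map ` C)"
    using C by (intro compact_imp_closed compact_continuous_image continuous_intros) auto
  have fm: "f \<in> borel_measurable torus" using f by (auto simp: fourier_null_def)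
  have "(\<lambda>n. LINT x|torus. f x * of_real (h n (trig_map x))) \<longlonglongrightarrow> (LINT x|torus. f x * indicator C x)"
  proof (rule integral_dominated_convergence[where w = "\<lambda>x. norm (f x)"])
    have [measurable]: "C \<in> sets borel" using C(1) by (intro borel_closed compact_imp_closed)
    show "(\<lambda>x. f x * indicator C x) \<in> borel_measurable torus"
      using fm by measurable
    show "(\<lambda>x. f x * of_real (h n (trig_map x))) \<in> borel_measurable torus" for n
      by (intro borel_measurable_times fm measurable_torusI borel_measurable_continuous_onI
            continuous_on_compose2[OF ch] continuous_intros) auto
    show "integrable torus (\<lambda>x. norm (f x))" using f by (auto simp: fourier_null_def)
    show "AE x in torus. norm (f x * of_real (h n (trig_map x))) \<le> norm (f x)" for n
      by (rule AE_I2) (auto simp: norm_mult h_def infdist_nonneg intro!: mult_left_le)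
    show "AE x in torus. (\<lambda>n. f x * of_real (h n (trig_map x))) \<longlonglongrightarrow> f x * indicator C x"
    proof (rule AE_I2, intro tendsto_mult tendsto_const)
      fix x assume x: "x \<in> space torus"
      show "(\<lambda>n. complex_of_real (h n (trig_map x))) \<longlonglongrightarrow> indicator C x"
      proof (cases "x \<in> C")
        case True
        then have "h n (trig_map x) = 1" for n by (simp add: h_def)
        then show ?thesis using True by simp
      next
        case False
        then have "trig_map x \<notin> trig_map ` C"
          using trig_map_eqD[of x] x C by auto
        then have pos: "infdist (trig_map x) (trig_map ` C) > 0"
          using in_closed_iff_infdist_zero[OF cl] \<open>C \<noteq> {}\<close> infdist_nonneg
          by (metis image_is_empty less_eq_real_def)
        then obtain N where N: "real N * infdist (trig_map x) (trig_map ` C) > 1"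
          using reals_Archimedean3 by blast
        have "h n (trig_map x) = 0" if "n \<ge> N" for n
        proof -
          have "real N * infdist (trig_map x) (trig_map ` C) \<le> real n * infdist (trig_map x) (trig_map ` C)"
            using that pos by (intro mult_right_mono) auto
          with N show ?thesis by (simp add: h_def)
        qed
        then have "eventually (\<lambda>n. complex_of_real (h n (trig_map x)) = indicator C x) sequentially"
          using False by (auto simp: eventually_sequentially intro!: exI[of _ N])
        then show ?thesis by (rule tendsto_eventually)
      qed
    qed
  qed
  moreover have "(LINT x|torus. f x * of_real (h n (trig_map x))) = 0" for n
    by (rule fourier_null_mult_continuous[OF f ch])
  ultimately show ?thesis by (simp add: LIMSEQ_const_iff)
qed simp

lemma AE_torus_iff: "(AE x in torus. P x) \<longleftrightarrow> (AE x in lborel. x \<in> cbox 0 1 \<longrightarrow> P x)"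
  unfolding torus_def by (rule AE_restrict_space_iff) simp

lemma AE_torus_interior: "AE x in torus. x \<in> box 0 1"
proof -
  have "emeasure lborel (cbox 0 1 - box (0::real^3) 1) = 0"
    by (subst emeasure_Diff) (auto simp: emeasure_lborel_box_eq emeasure_lborel_cbox_eq box_subset_cbox)
  then have "cbox 0 1 - box (0::real^3) 1 \<in> null_sets lborel"
    by (auto intro!: null_setsI)
  from AE_not_in[OF this] show ?thesis
    unfolding AE_torus_iff by eventually_elim auto
qed

text \<open>By inner regularity the set where Re f > 0 contains a closed set T that misses less than
  e of its measure. The integral of f over T is 0 although Re f is positive there, so T is null.
  Discarding the faces of the cube beforehand makes T a compact subset of the open cube.\<close>

lemma fourier_null_Re_le:
  assumes f: "fourier_null f"
  shows "AE x in torus. Re (f x) \<le> 0"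
proof -
  have [measurable]: "f \<in> borel_measurable torus" using f by (auto simp: fourier_null_def)
  define A where "A = {x \<in> space torus. Re (f x) > 0} \<inter> box 0 1"
  have "{x \<in> space torus. Re (f x) > 0} \<in> sets torus" by measurable
  then have "{x \<in> space torus. Re (f x) > 0} \<in> sets lborel"
    unfolding torus_def by (subst (asm) sets_restrict_space_iff) auto
  then have A: "A \<in> sets lborel" unfolding A_def by auto
  then have AL: "A \<in> sets lebesgue" by auto
  have "emeasure lebesgue A \<le> ennreal e" if e: "e > 0" for e
  proof -
    obtain T where T: "closed T" "T \<subseteq> A" "emeasure lebesgue (A - T) < ennreal e"
      by (rule sets_lebesgue_inner_closed[OF AL e])
    have "T \<subseteq> box 0 1" using T(2) by (auto simp: A_def)
    then have "bounded T" by (rule bounded_subset[OF bounded_box])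
    then have "compact T" using T by (simp add: compact_eq_bounded_closed)
    moreover have "T \<subseteq> box 0 1" using T(2) by (auto simp: A_def)
    ultimately have 0: "(LINT x|torus. f x * indicator T x) = 0"
      by (rule fourier_null_integral_compact[OF f])
    have Tb [measurable]: "T \<in> sets borel" using T by auto
    have int: "integrable torus (\<lambda>x. f x * indicator T x)"
      using f by (intro integrable_mult_bounded[where B = 1]) (auto simp: fourier_null_def indicator_def)
    have "(LINT x|torus. Re (f x * indicator T x)) = 0"
      using int 0 by (subst integral_Re) auto
    moreover have "AE x in torus. 0 \<le> Re (f x * indicator T x)"
      using T(2) by (intro AE_I2) (auto simp: A_def indicator_def)
    ultimately have "AE x in torus. Re (f x * indicator T x) = 0"
      using integral_nonneg_eq_0_iff_AE[OF integrable_Re[OF int]] by blast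
    then have "AE x in lborel. x \<notin> T"
      unfolding AE_torus_iff
      by eventually_elim (use T(2) in \<open>auto simp: A_def indicator_def split: if_splits\<close>)
    then have T0: "emeasure lborel T = 0"
      using AE_iff_measurable[of T lborel "\<lambda>x. x \<notin> T"] by auto
    have "emeasure lebesgue A = emeasure lebesgue (T \<union> (A - T))"
      using T(2) by (simp add: Un_absorb1)
    also have "\<dots> \<le> emeasure lebesgue T + emeasure lebesgue (A - T)"
      using AL T by (intro emeasure_subadditive) auto
    also have "\<dots> \<le> ennreal e" using T0 T(3) by simp
    finally show ?thesis .
  qed
  then have "emeasure lborel A = 0"
    using A ennreal_le_epsilon[of 0 "emeasure lebesgue A"] by auto
  then have "A \<in> null_sets lborel" using A by auto
  from AE_not_in[OF this] have "AE x in torus. x \<notin> A"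
    unfolding AE_torus_iff by eventually_elim auto
  then show ?thesis using AE_torus_interior AE_space
    by eventually_elim (auto simp: A_def not_le[symmetric])
qed

lemma fourier_null_AE:
  assumes f: "fourier_null f"
  shows "AE x in torus. f x = 0"
proof -
  have "AE x in torus. Re (f x) \<le> 0" "AE x in torus. Re (-1 * f x) \<le> 0"
       "AE x in torus. Re (\<i> * f x) \<le> 0" "AE x in torus. Re (-\<i> * f x) \<le> 0"
    by (intro fourier_null_Re_le fourier_null_scale f)+
  then show ?thesis by eventually_elim (auto simp: complex_eq_iff)
qed

lemma fourier_unique:
  assumes "integrable torus f" "integrable torus g" "\<And>k. k \<in> freq \<Longrightarrow> fourier f k = fourier g k"
  shows "AE x in torus. f x = g x"
proof -
  have "fourier_null (\<lambda>x. f x - g x)"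
    using assms by (simp add: fourier_null_def fourier_diff)
  from fourier_null_AE[OF this] show ?thesis by simp
qed

section \<open>Riesz--Fischer and Parseval\<close>

text \<open>Sums over \<open>freq\<close> are unordered; along these cubes they become limits of
  sequences, as Fatou's lemma and dominated convergence require. Cubes are also products of
  intervals, which later splits lattice sums into coordinates.\<close>

definition freq_cube :: "nat \<Rightarrow> (real^3) set" where
  "freq_cube n = {k \<in> freq. \<forall>i. \<bar>k $ i\<bar> \<le> real n}"

lemma freq_cube_subset [simp]: "freq_cube n \<subseteq> freq"
  by (auto simp: freq_cube_def)

lemma freq_cubeD: "k \<in> freq_cube n \<Longrightarrow> k \<in> freq"
  by (simp add: freq_cube_def)

lemma freq_cube_mono: "n \<le> m \<Longrightarrow> freq_cube n \<subseteq> freq_cube m"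
  by (auto simp: freq_cube_def intro: order_trans)

lemma freq_cube_eq:
  "freq_cube n = (\<lambda>h. \<chi> i. real_of_int (h i)) ` (PiE UNIV (\<lambda>_. {- int n..int n}))"
proof (intro equalityI subsetI)
  fix k :: "real^3" assume k: "k \<in> freq_cube n"
  have fl: "real_of_int \<lfloor>k $ i\<rfloor> = k $ i" for i
    using k by (auto simp: freq_cube_def freq_def elim!: Ints_cases)
  have "- int n \<le> \<lfloor>k $ i\<rfloor> \<and> \<lfloor>k $ i\<rfloor> \<le> int n" for i
  proof -
    have "\<bar>k $ i\<bar> \<le> real n" using k by (simp add: freq_cube_def)
    with fl[of i] show ?thesis by linarith
  qed
  then show "k \<in> (\<lambda>h. \<chi> i. real_of_int (h i)) ` (PiE UNIV (\<lambda>_. {- int n..int n}))"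
    by (intro image_eqI[of _ _ "\<lambda>i. \<lfloor>k $ i\<rfloor>"]) (auto simp: fl vec_eq_iff)
next
  fix k :: "real^3" assume "k \<in> (\<lambda>h. \<chi> i. real_of_int (h i)) ` (PiE UNIV (\<lambda>_. {- int n..int n}))"
  then obtain h where h: "k = (\<chi> i. real_of_int (h i))" "\<And>i. - int n \<le> h i \<and> h i \<le> int n" by (auto simp: PiE_iff)
  have "\<bar>real_of_int (h i)\<bar> \<le> real n" for i using h(2)[of i] by linarith
  then show "k \<in> freq_cube n" by (simp add: freq_cube_def freq_def h(1))
qed

lemma finite_freq_cube [simp]: "finite (freq_cube n)"
  unfolding freq_cube_eq by (intro finite_imageI finite_PiE) auto

lemma freq_in_cube: "k \<in> freq \<Longrightarrow> \<exists>n. k \<in> freq_cube n"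
proof -
  assume "k \<in> freq"
  moreover obtain n where "norm k \<le> real n" using real_arch_simple by blast
  ultimately show ?thesis
    using component_le_norm_cart[of k] by (auto simp: freq_cube_def intro!: exI[of _ n] intro: order_trans)
qed

lemma finite_subset_freq_cube:
  assumes "finite F" "F \<subseteq> freq"
  shows "\<exists>N. \<forall>n\<ge>N. F \<subseteq> freq_cube n"
  using assms
proof (induction F)
  case (insert k F)
  then obtain N m where "\<forall>n\<ge>N. F \<subseteq> freq_cube n" "k \<in> freq_cube m"
    using freq_in_cube[of k] by auto
  then show ?case
    using freq_cube_mono[of m] by (intro exI[of _ "max N m"]) fastforce
qed auto

lemma filterlim_freq_cube: "filterlim freq_cube (finite_subsets_at_top freq) sequentially"
  unfolding filterlim_finite_subsets_at_top
  using finite_subset_freq_cube by (auto simp: eventually_sequentially)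

lemma has_sum_freq_cube: "(f has_sum s) freq \<Longrightarrow> (\<lambda>n. \<Sum>k\<in>freq_cube n. f k) \<longlonglongrightarrow> s"
  unfolding has_sum_def by (rule filterlim_compose[OF _ filterlim_freq_cube])

lemma infsum_freq_cube: "f summable_on freq \<Longrightarrow> (\<lambda>n. \<Sum>k\<in>freq_cube n. f k) \<longlonglongrightarrow> infsum f freq"
  by (intro has_sum_freq_cube has_sum_infsum)

lemma summable_on_bounded:
  fixes f :: "'a \<Rightarrow> real"
  assumes "\<And>x. x \<in> A \<Longrightarrow> f x \<ge> 0" "\<And>F. finite F \<Longrightarrow> F \<subseteq> A \<Longrightarrow> sum f F \<le> C"
  shows "f summable_on A" "infsum f A \<le> C"
proof -
  show "f summable_on A"
    using assms by (intro nonneg_bdd_above_summable_on) (auto intro!: bdd_aboveI[of _ C])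
  then show "infsum f A \<le> C"
    using assms(2) by (rule infsum_le_finite_sums)
qed

section \<open>Square-integrable functions and trigonometric sums\<close>

definition sq_integrable :: "(real^3 \<Rightarrow> complex) \<Rightarrow> bool" where
  "sq_integrable f \<longleftrightarrow> f \<in> borel_measurable torus \<and> integrable torus (\<lambda>x. (cmod (f x))\<^sup>2)"

definition mean_square :: "(real^3 \<Rightarrow> complex) \<Rightarrow> real" where
  "mean_square f = (LINT x|torus. (cmod (f x))\<^sup>2)"

lemma sq_integrable_measurable [measurable_dest]: "sq_integrable f \<Longrightarrow> f \<in> borel_measurable torus"
  by (simp add: sq_integrable_def)

lemma mean_square_nonneg [simp]: "mean_square f \<ge> 0"
  by (simp add: mean_square_def)

lemma mult_le_sum_power2: "0 \<le> x \<Longrightarrow> 0 \<le> y \<Longrightarrow> x * y \<le> x\<^sup>2 + y\<^sup>2" for x y :: real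
  using sum_squares_bound[of x y] mult_nonneg_nonneg[of x y] unfolding mult.assoc by linarith

lemma sq_integrable_mult:
  assumes "sq_integrable f" "sq_integrable g"
  shows "integrable torus (\<lambda>x. f x * g x)"
proof (rule Bochner_Integration.integrable_bound)
  show "integrable torus (\<lambda>x. (cmod (f x))\<^sup>2 + (cmod (g x))\<^sup>2)"
    using assms by (auto simp: sq_integrable_def)
  show "(\<lambda>x. f x * g x) \<in> borel_measurable torus"
    using assms by (auto simp: sq_integrable_def)
  show "AE x in torus. cmod (f x * g x) \<le> norm ((cmod (f x))\<^sup>2 + (cmod (g x))\<^sup>2)"
    by (simp add: norm_mult mult_le_sum_power2)
qed

lemma sq_integrable_continuous: "continuous_on UNIV f \<Longrightarrow> sq_integrable f"
  unfolding sq_integrable_def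
  by (auto intro!: measurable_torusI borel_measurable_continuous_onI integrable_torus_continuous continuous_intros)

lemma sq_integrable_integrable: "sq_integrable f \<Longrightarrow> integrable torus f"
  using sq_integrable_mult[of f "\<lambda>_. 1"] sq_integrable_continuous[of "\<lambda>_. 1"] by simp

lemma borel_measurable_cnj:
  assumes "f \<in> borel_measurable M"
  shows "(\<lambda>x. cnj (f x)) \<in> borel_measurable M"
  by (rule measurable_compose[OF assms borel_measurable_continuous_onI]) (intro continuous_intros)

lemma sq_integrable_cnj: "sq_integrable f \<Longrightarrow> sq_integrable (\<lambda>x. cnj (f x))"
  by (simp add: sq_integrable_def borel_measurable_cnj)

lemma sq_integrable_scale: "sq_integrable f \<Longrightarrow> sq_integrable (\<lambda>x. c * f x)"
  by (auto simp: sq_integrable_def norm_mult power_mult_distrib)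

lemma sq_integrable_wave: "sq_integrable f \<Longrightarrow> sq_integrable (\<lambda>x. wave k x * f x)"
  by (auto simp: sq_integrable_def norm_mult)

lemma sq_integrable_add:
  assumes "sq_integrable f" "sq_integrable g"
  shows "sq_integrable (\<lambda>x. f x + g x)"
proof -
  have "integrable torus (\<lambda>x. (cmod (f x + g x))\<^sup>2)"
  proof (rule Bochner_Integration.integrable_bound)
    show "integrable torus (\<lambda>x. 2 * (cmod (f x))\<^sup>2 + 2 * (cmod (g x))\<^sup>2)"
      using assms by (auto simp: sq_integrable_def)
    show "(\<lambda>x. (cmod (f x + g x))\<^sup>2) \<in> borel_measurable torus"
      using assms by (auto simp: sq_integrable_def)
    have "(cmod (f x + g x))\<^sup>2 \<le> 2 * (cmod (f x))\<^sup>2 + 2 * (cmod (g x))\<^sup>2" for x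
    proof -
      have "(cmod (f x + g x))\<^sup>2 \<le> (cmod (f x) + cmod (g x))\<^sup>2"
        by (intro power_mono norm_triangle_ineq norm_ge_zero)
      then show ?thesis
        using sum_squares_bound[of "cmod (f x)" "cmod (g x)"] by (simp add: power2_sum)
    qed
    then show "AE x in torus. norm ((cmod (f x + g x))\<^sup>2) \<le> norm (2 * (cmod (f x))\<^sup>2 + 2 * (cmod (g x))\<^sup>2)"
      by simp
  qed
  then show ?thesis using assms by (auto simp: sq_integrable_def)
qed

lemma sq_integrable_diff:
  "sq_integrable f \<Longrightarrow> sq_integrable g \<Longrightarrow> sq_integrable (\<lambda>x. f x - g x)"
  using sq_integrable_add[of f "\<lambda>x. -1 * g x"] sq_integrable_scale[of g "-1"] by simp

lemma integral_mult_le_mean_square: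
  assumes "sq_integrable f" "sq_integrable g"
  shows "(LINT x|torus. cmod (f x * g x)) \<le> sqrt (mean_square f) * sqrt (mean_square g)"
proof -
  have nn: "(\<integral>\<^sup>+x. ennreal ((cmod (h x))\<^sup>2) \<partial>torus) = ennreal (mean_square h)" if "sq_integrable h" for h
    using that unfolding mean_square_def
    by (subst nn_integral_eq_integral[symmetric]) (auto simp: sq_integrable_def)
  have "(\<integral>\<^sup>+x. ennreal (cmod (f x)) * ennreal (cmod (g x)) \<partial>torus) = ennreal (LINT x|torus. cmod (f x * g x))"
    using integrable_norm[OF sq_integrable_mult[OF assms]]
    by (subst nn_integral_eq_integral[symmetric]) (auto simp: norm_mult ennreal_mult)
  then have "ennreal ((LINT x|torus. cmod (f x * g x))\<^sup>2) \<le> ennreal (mean_square f * mean_square g)"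
    using Cauchy_Schwarz_nn_integral[of "\<lambda>x. ennreal (cmod (f x))" torus "\<lambda>x. ennreal (cmod (g x))"] assms
    by (simp add: nn ennreal_power ennreal_mult)
  then have "(LINT x|torus. cmod (f x * g x))\<^sup>2 \<le> mean_square f * mean_square g"
    by simp
  then have "(LINT x|torus. cmod (f x * g x)) \<le> sqrt (mean_square f * mean_square g)"
    by (rule real_le_rsqrt)
  then show ?thesis by (simp add: real_sqrt_mult)
qed

lemma integral_norm_le_mean_square:
  "sq_integrable f \<Longrightarrow> (LINT x|torus. cmod (f x)) \<le> sqrt (mean_square f)"
  using integral_mult_le_mean_square[of f "\<lambda>_. 1"] sq_integrable_continuous[of "\<lambda>_. 1"]
    torus_total[of "1::real"]
  by (simp add: mean_square_def del: lebesgue_integral_const)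

lemma integral_mult_cnj_self: "(LINT x|torus. f x * cnj (f x)) = of_real (mean_square f)"
  unfolding mean_square_def complex_norm_square[symmetric]
  by (simp add: complex_norm_square[symmetric] flip: integral_complex_of_real)

definition trig_sum :: "(real^3) set \<Rightarrow> (real^3 \<Rightarrow> complex) \<Rightarrow> real^3 \<Rightarrow> complex" where
  "trig_sum F c x = (\<Sum>k\<in>F. c k * wave k x)"

lemma continuous_on_trig_sum: "continuous_on S (trig_sum F c)"
  unfolding trig_sum_def by (intro continuous_intros)

lemma sq_integrable_trig_sum: "sq_integrable (trig_sum F c)"
  by (intro sq_integrable_continuous continuous_on_trig_sum)

lemma fourier_trig_sum:
  assumes "finite F" "F \<subseteq> freq" "k \<in> freq"
  shows "fourier (trig_sum F c) k = (if k \<in> F then c k else 0)"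
proof -
  have "fourier (trig_sum F c) k = (\<Sum>m\<in>F. c m * fourier (wave m) k)"
    unfolding trig_sum_def
    by (subst fourier_sum) (auto simp: fourier_scale intro!: integrable_torus_continuous continuous_intros)
  also have "\<dots> = (\<Sum>m\<in>F. if k = m then c m else 0)"
    using assms by (intro sum.cong) (auto simp: fourier_wave)
  finally show ?thesis using assms by simp
qed

lemma integral_mult_cnj_trig_sum:
  assumes "integrable torus f"
  shows "(LINT x|torus. f x * cnj (trig_sum F c x)) = (\<Sum>k\<in>F. fourier f k * cnj (c k))"
proof -
  have "(LINT x|torus. f x * cnj (trig_sum F c x)) = (LINT x|torus. (\<Sum>k\<in>F. cnj (c k) * (f x * wave (- k) x)))"
    by (simp add: trig_sum_def sum_distrib_left cnj_wave mult_ac)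
  also have "\<dots> = (\<Sum>k\<in>F. (LINT x|torus. cnj (c k) * (f x * wave (- k) x)))"
    using integrable_mult_wave[OF assms] by (intro Bochner_Integration.integral_sum) auto
  also have "\<dots> = (\<Sum>k\<in>F. fourier f k * cnj (c k))"
    by (simp add: fourier_def mult.commute)
  finally show ?thesis .
qed

lemma mean_square_trig_sum:
  assumes "finite F" "F \<subseteq> freq"
  shows "mean_square (trig_sum F c) = (\<Sum>k\<in>F. (cmod (c k))\<^sup>2)"
proof -
  have "complex_of_real (mean_square (trig_sum F c)) = (\<Sum>k\<in>F. c k * cnj (c k))"
    unfolding integral_mult_cnj_self[symmetric]
    using assms by (subst integral_mult_cnj_trig_sum)
      (auto intro!: sum.cong sq_integrable_integrable sq_integrable_trig_sum simp: fourier_trig_sum subset_iff)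
  also have "\<dots> = of_real (\<Sum>k\<in>F. (cmod (c k))\<^sup>2)"
    by (simp add: complex_norm_square del: of_real_power)
  finally show ?thesis by (simp only: of_real_eq_iff)
qed

text \<open>Pythagoras: the partial Fourier sum is the orthogonal projection, so both mixed terms
  and the square of the sum give the same number. Nonnegativity of the left-hand side is Bessel's
  inequality.\<close>

lemma mean_square_diff_trig_sum:
  assumes f: "sq_integrable f" and F: "finite F" "F \<subseteq> freq"
  shows "mean_square (\<lambda>x. f x - trig_sum F (fourier f) x) = mean_square f - (\<Sum>k\<in>F. (cmod (fourier f k))\<^sup>2)"
proof -
  let ?s = "trig_sum F (fourier f)"
  have [simp]: "integrable torus f" "integrable torus ?s"
    by (intro sq_integrable_integrable sq_integrable_trig_sum f)+
  have i: "integrable torus (\<lambda>x. g x * cnj (h x))" if "sq_integrable g" "sq_integrable h" for g h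
    using that by (intro sq_integrable_mult sq_integrable_cnj)
  note [simp] = i[OF f f] i[OF f sq_integrable_trig_sum] i[OF sq_integrable_trig_sum f]
    i[OF sq_integrable_trig_sum sq_integrable_trig_sum]
  let ?S = "complex_of_real (\<Sum>k\<in>F. (cmod (fourier f k))\<^sup>2)"
  have fs: "(LINT x|torus. f x * cnj (?s x)) = ?S"
    by (simp add: integral_mult_cnj_trig_sum complex_norm_square del: of_real_power)
  have "(LINT x|torus. cnj (f x * cnj (?s x))) = cnj ?S"
    unfolding fs[symmetric] by (rule Bochner_Integration.integral_cnj)
  then have sf: "(LINT x|torus. ?s x * cnj (f x)) = ?S"
    by (simp add: mult.commute)
  have ss: "(LINT x|torus. ?s x * cnj (?s x)) = ?S"
    unfolding integral_mult_cnj_self mean_square_trig_sum[OF F] ..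
  have "complex_of_real (mean_square (\<lambda>x. f x - ?s x)) =
     (LINT x|torus. (f x * cnj (f x) - f x * cnj (?s x)) - (?s x * cnj (f x) - ?s x * cnj (?s x)))"
    unfolding integral_mult_cnj_self[symmetric] by (simp add: algebra_simps)
  also have "\<dots> = of_real (mean_square f) - ?S"
    by (simp add: fs sf ss integral_mult_cnj_self)
  finally show ?thesis by (simp only: of_real_eq_iff flip: of_real_diff)
qed

lemma bessel:
  assumes f: "sq_integrable f"
  shows "(\<lambda>k. (cmod (fourier f k))\<^sup>2) summable_on freq"
proof (rule summable_on_bounded)
  fix F assume "finite F" "F \<subseteq> freq"
  then show "(\<Sum>k\<in>F. (cmod (fourier f k))\<^sup>2) \<le> mean_square f"
    using mean_square_diff_trig_sum[OF f, of F] mean_square_nonneg[of "\<lambda>x. f x - trig_sum F (fourier f) x"] by simp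
qed simp

text \<open>The partial sums are Cauchy in mean square, hence in L^1, so a subsequence converges
  almost everywhere; Fatou's lemma then bounds the distance from its limit to each partial sum. The
  third conclusion is recorded because the expansion of a given function is derived from it.\<close>

lemma riesz_fischer:
  assumes c: "(\<lambda>k. (cmod (c k))\<^sup>2) summable_on freq"
  obtains f where "sq_integrable f" "\<And>k. k \<in> freq \<Longrightarrow> fourier f k = c k"
    "(\<lambda>n. mean_square (\<lambda>x. f x - trig_sum (freq_cube n) c x)) \<longlonglongrightarrow> 0"
proof -
  define s where "s n = trig_sum (freq_cube n) c" for n
  define a where "a n = (\<Sum>k\<in>freq_cube n. (cmod (c k))\<^sup>2)" for n
  have si: "sq_integrable (s n)" for n unfolding s_def by (rule sq_integrable_trig_sum)
  note [measurable] = sq_integrable_measurable[OF si]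
  \<comment> \<open>The difference of two partial sums is the trigonometric sum over the frequencies
    between the cubes, so orthogonality turns its mean square into a difference of partial sums of a
    convergent series.\<close>
  have ms: "mean_square (\<lambda>x. s m x - s n x) = a m - a n" if "n \<le> m" for m n
  proof -
    have sub: "freq_cube n \<subseteq> freq_cube m" using that by (rule freq_cube_mono)
    have "s m x - s n x = trig_sum (freq_cube m - freq_cube n) c x" for x
      unfolding s_def trig_sum_def using sub by (subst sum_diff) auto
    moreover have "finite (freq_cube m - freq_cube n)" "freq_cube m - freq_cube n \<subseteq> freq"
      using freq_cube_subset[of m] by (auto dest: freq_cubeD)
    ultimately show ?thesis
      using sub by (simp add: mean_square_trig_sum a_def sum_diff)
  qed
  have sym: "mean_square (\<lambda>x. s m x - s n x) = mean_square (\<lambda>x. s n x - s m x)" for m n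
    by (simp add: mean_square_def norm_minus_commute)
  have "Cauchy a"
    using infsum_freq_cube[OF c] unfolding a_def by (intro LIMSEQ_imp_Cauchy)
  then have small: "\<exists>N. \<forall>m\<ge>N. \<forall>n\<ge>N. mean_square (\<lambda>x. s m x - s n x) < e" if "e > 0" for e
  proof -
    obtain N where N: "\<And>m n. m \<ge> N \<Longrightarrow> n \<ge> N \<Longrightarrow> \<bar>a m - a n\<bar> < e"
      using \<open>Cauchy a\<close> \<open>e > 0\<close> unfolding Cauchy_def dist_real_def by blast
    have "mean_square (\<lambda>x. s m x - s n x) < e" if mn: "m \<ge> N" "n \<ge> N" for m n
      using N[OF mn] ms[of n m] ms[of m n] sym[of m n] by (cases "n \<le> m") auto
    then show ?thesis by blast
  qed
  have L1: "\<exists>N. \<forall>i\<ge>N. \<forall>j\<ge>N. (LINT x|torus. norm (s i x - s j x)) < e" if "e > 0" for e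
  proof -
    obtain N where N: "\<And>m n. m \<ge> N \<Longrightarrow> n \<ge> N \<Longrightarrow> mean_square (\<lambda>x. s m x - s n x) < e\<^sup>2"
      using small[of "e\<^sup>2"] \<open>e > 0\<close> zero_less_power by blast
    have "(LINT x|torus. norm (s i x - s j x)) < e" if "i \<ge> N" "j \<ge> N" for i j
    proof -
      have "(LINT x|torus. norm (s i x - s j x)) \<le> sqrt (mean_square (\<lambda>x. s i x - s j x))"
        by (intro integral_norm_le_mean_square sq_integrable_diff si)
      also have "\<dots> < sqrt (e\<^sup>2)" using N[OF that] by (intro real_sqrt_less_mono)
      finally show ?thesis using \<open>e > 0\<close> by simp
    qed
    then show ?thesis by blast
  qed
  obtain r where r: "strict_mono r" "AE x in torus. Cauchy (\<lambda>i. s (r i) x)"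
    by (rule cauchy_L1_AE_cauchy_subseq[OF sq_integrable_integrable[OF si] L1]) auto
  define f where "f x = lim (\<lambda>i. s (r i) x)" for x
  have lim: "AE x in torus. (\<lambda>i. s (r i) x) \<longlonglongrightarrow> f x"
    using r(2) unfolding f_def by eventually_elim (use Cauchy_convergent_iff convergent_LIMSEQ_iff in blast)
  have [measurable]: "f \<in> borel_measurable torus"
    unfolding f_def by (intro borel_measurable_lim_metric) measurable
  \<comment> \<open>Fatou along the subsequence r: for fixed n all later partial sums are within e
    of \<open>s n\<close> in mean square, and this passes to the limit f.\<close>
  have close: "sq_integrable (\<lambda>x. f x - s n x) \<and> mean_square (\<lambda>x. f x - s n x) \<le> e"
    if e: "e > 0" and N: "\<And>m. m \<ge> n \<Longrightarrow> mean_square (\<lambda>x. s m x - s n x) < e" for n e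
  proof -
    have "(\<integral>\<^sup>+x. ennreal ((cmod (f x - s n x))\<^sup>2) \<partial>torus)
        = (\<integral>\<^sup>+x. liminf (\<lambda>i. ennreal ((cmod (s (r i) x - s n x))\<^sup>2)) \<partial>torus)"
    proof (rule nn_integral_cong_AE)
      show "AE x in torus. ennreal ((cmod (f x - s n x))\<^sup>2) = liminf (\<lambda>i. ennreal ((cmod (s (r i) x - s n x))\<^sup>2))"
        using lim
      proof eventually_elim
        case (elim x)
        have "(\<lambda>i. ennreal ((cmod (s (r i) x - s n x))\<^sup>2)) \<longlonglongrightarrow> ennreal ((cmod (f x - s n x))\<^sup>2)"
          by (intro tendsto_ennrealI tendsto_intros elim)
        then show ?case by (intro lim_imp_Liminf[symmetric]) auto
      qed
    qed
    also have "\<dots> \<le> liminf (\<lambda>i. \<integral>\<^sup>+x. ennreal ((cmod (s (r i) x - s n x))\<^sup>2) \<partial>torus)"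
      by (intro nn_integral_liminf) measurable
    also have "\<dots> \<le> ennreal e"
    proof (rule Liminf_le)
      show "eventually (\<lambda>i. (\<integral>\<^sup>+x. ennreal ((cmod (s (r i) x - s n x))\<^sup>2) \<partial>torus) \<le> ennreal e) sequentially"
        unfolding eventually_sequentially
      proof (intro exI allI impI)
        fix i assume "n \<le> i"
        then have "n \<le> r i" using seq_suble[OF r(1), of i] by simp
        have "(\<integral>\<^sup>+x. ennreal ((cmod (s (r i) x - s n x))\<^sup>2) \<partial>torus) = ennreal (mean_square (\<lambda>x. s (r i) x - s n x))"
          using sq_integrable_diff[OF si si, of "r i" n] unfolding mean_square_def
          by (intro nn_integral_eq_integral) (auto simp: sq_integrable_def)
        also have "\<dots> \<le> ennreal e" using N[OF \<open>n \<le> r i\<close>] by (intro ennreal_leI) simp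
        finally show "(\<integral>\<^sup>+x. ennreal ((cmod (s (r i) x - s n x))\<^sup>2) \<partial>torus) \<le> ennreal e" .
      qed
    qed simp
    finally have *: "(\<integral>\<^sup>+x. ennreal ((cmod (f x - s n x))\<^sup>2) \<partial>torus) \<le> ennreal e" .
    have int: "integrable torus (\<lambda>x. (cmod (f x - s n x))\<^sup>2)"
      using * by (intro integrableI_nonneg) (auto intro: le_less_trans[OF _ ennreal_less_top])
    moreover have "ennreal (mean_square (\<lambda>x. f x - s n x)) \<le> ennreal e"
      using * int unfolding mean_square_def by (subst (asm) nn_integral_eq_integral) auto
    ultimately show ?thesis using e by (simp add: sq_integrable_def)
  qed
  \<comment> \<open>The tolerance 1 serves only to write f as a trigonometric sum plus a
    square-integrable function.\<close>
  have "\<exists>n. \<forall>m\<ge>n. mean_square (\<lambda>x. s m x - s n x) < 1" using small[of 1] by (meson le_refl zero_less_one)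
  then obtain n0 where "\<And>m. m \<ge> n0 \<Longrightarrow> mean_square (\<lambda>x. s m x - s n0 x) < 1" by blast
  then have "sq_integrable (\<lambda>x. f x - s n0 x)" using close[of 1 n0] by auto
  from sq_integrable_add[OF this si[of n0]] have f: "sq_integrable f" by simp
  have conv: "(\<lambda>n. mean_square (\<lambda>x. f x - s n x)) \<longlonglongrightarrow> 0"
  proof (rule LIMSEQ_I)
    fix e :: real assume "e > 0"
    then obtain N where N: "\<And>m n. m \<ge> N \<Longrightarrow> n \<ge> N \<Longrightarrow> mean_square (\<lambda>x. s m x - s n x) < e / 2"
      using small[of "e / 2"] by auto
    have "mean_square (\<lambda>x. f x - s n x) < e" if "n \<ge> N" for n
    proof -
      have "mean_square (\<lambda>x. f x - s n x) \<le> e / 2"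
        using close[of "e / 2" n] N that \<open>e > 0\<close> by auto
      then show ?thesis using \<open>e > 0\<close> by simp
    qed
    then show "\<exists>N. \<forall>n\<ge>N. norm (mean_square (\<lambda>x. f x - s n x) - 0) < e"
      by (intro exI[of _ N]) simp
  qed
  have "fourier f k = c k" if k: "k \<in> freq" for k
  proof -
    have ev: "eventually (\<lambda>n. fourier (s n) k = c k) sequentially"
      using finite_subset_freq_cube[of "{k}"] k
      by (auto simp: s_def eventually_sequentially fourier_trig_sum)
    \<comment> \<open>A single coefficient is continuous with respect to the mean square distance,
      and the coefficient of \<open>s n\<close> at k equals \<open>c k\<close> once the cube
      contains k.\<close>
    have bound: "norm (fourier f k - fourier (s n) k) \<le> sqrt (mean_square (\<lambda>x. f x - s n x))" for n
    proof -
      have "norm (fourier f k - fourier (s n) k) = norm (fourier (\<lambda>x. f x - s n x) k)"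
        by (simp add: fourier_diff sq_integrable_integrable f si)
      also have "\<dots> \<le> (LINT x|torus. norm ((f x - s n x) * wave (- k) x))"
        unfolding fourier_def by (rule integral_norm_bound)
      also have "\<dots> \<le> sqrt (mean_square (\<lambda>x. f x - s n x))"
        using integral_norm_le_mean_square[OF sq_integrable_diff[OF f si]] by (simp add: norm_mult)
      finally show ?thesis .
    qed
    have "(\<lambda>n. sqrt (mean_square (\<lambda>x. f x - s n x))) \<longlonglongrightarrow> 0"
      using tendsto_real_sqrt[OF conv] by simp
    then have "(\<lambda>n. fourier f k - fourier (s n) k) \<longlonglongrightarrow> 0"
      by (rule Lim_null_comparison[OF always_eventually[OF allI], OF bound])
    moreover have "(\<lambda>n. fourier f k - fourier (s n) k) \<longlonglongrightarrow> fourier f k - c k"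
      by (intro tendsto_intros tendsto_eventually ev)
    ultimately show ?thesis using LIMSEQ_unique by fastforce
  qed
  with that[OF f] conv show ?thesis unfolding s_def by blast
qed

text \<open>Riesz-Fischer yields some function with the coefficients of f that is the limit of the
  partial sums. By uniqueness of coefficients it is f almost everywhere.\<close>

lemma fourier_expansion:
  assumes f: "sq_integrable f"
  shows "(\<lambda>n. mean_square (\<lambda>x. f x - trig_sum (freq_cube n) (fourier f) x)) \<longlonglongrightarrow> 0"
proof -
  obtain h where h: "sq_integrable h" "\<And>k. k \<in> freq \<Longrightarrow> fourier h k = fourier f k"
    "(\<lambda>n. mean_square (\<lambda>x. h x - trig_sum (freq_cube n) (fourier f) x)) \<longlonglongrightarrow> 0"
    by (rule riesz_fischer[OF bessel[OF f]]) (rule that; (assumption | blast))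
  have eq: "AE x in torus. h x = f x"
    by (intro fourier_unique sq_integrable_integrable h f)
  note [measurable] = sq_integrable_measurable[OF h(1)] sq_integrable_measurable[OF f]
    sq_integrable_measurable[OF sq_integrable_trig_sum]
  have "mean_square (\<lambda>x. h x - trig_sum (freq_cube n) (fourier f) x) =
      mean_square (\<lambda>x. f x - trig_sum (freq_cube n) (fourier f) x)" for n
    unfolding mean_square_def using eq by (intro integral_cong_AE) (auto elim!: eventually_mono)
  with h(3) show ?thesis by simp
qed

lemma parseval_summable:
  assumes "sq_integrable f" "sq_integrable g"
  shows "(\<lambda>k. norm (fourier f k * cnj (fourier g k))) summable_on freq"
proof (rule Infinite_Sum.abs_summable_on_comparison_test')
  show "(\<lambda>k. (cmod (fourier f k))\<^sup>2 + (cmod (fourier g k))\<^sup>2) summable_on freq"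
    by (intro summable_on_add bessel assms)
  show "norm (fourier f k * cnj (fourier g k)) \<le> (cmod (fourier f k))\<^sup>2 + (cmod (fourier g k))\<^sup>2" for k
    by (simp add: norm_mult mult_le_sum_power2)
qed

text \<open>For a partial sum in place of g the identity is finite, and the error tends to 0 by
  Cauchy-Schwarz. Absolute summability identifies the limit along the cubes with the unordered
  sum.\<close>

lemma parseval:
  assumes f: "sq_integrable f" and g: "sq_integrable g"
  shows "((\<lambda>k. fourier f k * cnj (fourier g k)) has_sum (LINT x|torus. f x * cnj (g x))) freq"
proof -
  let ?s = "\<lambda>n. trig_sum (freq_cube n) (fourier g)"
  have conv: "(\<lambda>n. mean_square (\<lambda>x. g x - ?s n x)) \<longlonglongrightarrow> 0"
    by (rule fourier_expansion[OF g])
  note [simp] = sq_integrable_integrable[OF f]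
  have i: "integrable torus (\<lambda>x. f x * cnj (h x))" if "sq_integrable h" for h
    using that f by (intro sq_integrable_mult sq_integrable_cnj)
  have "norm ((LINT x|torus. f x * cnj (g x)) - (LINT x|torus. f x * cnj (?s n x)))
     \<le> sqrt (mean_square f) * sqrt (mean_square (\<lambda>x. g x - ?s n x))" for n
  proof -
    have "(LINT x|torus. f x * cnj (g x)) - (LINT x|torus. f x * cnj (?s n x))
      = (LINT x|torus. f x * cnj (g x - ?s n x))"
      using i[OF g] i[OF sq_integrable_trig_sum] by (simp add: ring_distribs)
    also have "norm \<dots> \<le> (LINT x|torus. norm (f x * cnj (g x - ?s n x)))"
      by (rule integral_norm_bound)
    also have "\<dots> = (LINT x|torus. norm (f x * (g x - ?s n x)))"
      by (simp add: norm_mult del: complex_cnj_diff)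
    also have "\<dots> \<le> sqrt (mean_square f) * sqrt (mean_square (\<lambda>x. g x - ?s n x))"
      by (intro integral_mult_le_mean_square f g sq_integrable_diff sq_integrable_trig_sum)
    finally show ?thesis .
  qed
  moreover have "(\<lambda>n. sqrt (mean_square f) * sqrt (mean_square (\<lambda>x. g x - ?s n x))) \<longlonglongrightarrow> 0"
    using tendsto_mult_left[OF tendsto_real_sqrt[OF conv], of "sqrt (mean_square f)"] by simp
  ultimately have "(\<lambda>n. (LINT x|torus. f x * cnj (g x)) - (LINT x|torus. f x * cnj (?s n x))) \<longlonglongrightarrow> 0"
    by (rule Lim_null_comparison[OF always_eventually[OF allI]])
  from tendsto_diff[OF tendsto_const[of "LINT x|torus. f x * cnj (g x)"] this]
  have "(\<lambda>n. LINT x|torus. f x * cnj (?s n x)) \<longlonglongrightarrow> (LINT x|torus. f x * cnj (g x))"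
    by simp
  then have "(\<lambda>n. \<Sum>k\<in>freq_cube n. fourier f k * cnj (fourier g k)) \<longlonglongrightarrow> (LINT x|torus. f x * cnj (g x))"
    unfolding integral_mult_cnj_trig_sum[OF sq_integrable_integrable[OF f]] .
  moreover have sm: "(\<lambda>k. fourier f k * cnj (fourier g k)) summable_on freq"
    by (rule abs_summable_summable[OF parseval_summable[OF f g]])
  ultimately have "infsum (\<lambda>k. fourier f k * cnj (fourier g k)) freq = (LINT x|torus. f x * cnj (g x))"
    by (intro LIMSEQ_unique[OF infsum_freq_cube[OF sm]])
  then show ?thesis using has_sum_infsum[OF sm] by simp
qed

text \<open>Parseval's identity for f and the function \<open>wave k x * cnj (g x)\<close>, whose
  p-th coefficient is the conjugate of the coefficient of g at k - p.\<close>

lemma fourier_mult: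
  assumes f: "sq_integrable f" and g: "sq_integrable g"
  shows "((\<lambda>p. fourier f p * fourier g (k - p)) has_sum fourier (\<lambda>x. f x * g x) k) freq"
proof -
  have g': "sq_integrable (\<lambda>x. wave k x * cnj (g x))"
    by (intro sq_integrable_wave sq_integrable_cnj g)
  have "fourier (\<lambda>x. wave k x * cnj (g x)) p = cnj (fourier g (k - p))" for p
    by (simp add: fourier_wave_mult fourier_cnj)
  moreover have "(LINT x|torus. f x * cnj (wave k x * cnj (g x))) = fourier (\<lambda>x. f x * g x) k"
    by (simp add: fourier_def cnj_wave mult_ac)
  ultimately show ?thesis
    using parseval[OF f g'] by simp
qed

section \<open>Vector fields\<close>

definition fcoeff :: "field \<Rightarrow> real^3 \<Rightarrow> complex^3" where
  "fcoeff u k = (\<chi> j. fourier (\<lambda>x. of_real (u x $ j)) k)"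

text \<open>The real part makes this a real field, carrying the frequencies k and -k; hence the
  factor 1/2 in \<open>fcoeff_wave_field\<close>. These fields serve as test fields and, for z
  orthogonal to k, as eigenfields of the Stokes operator.\<close>

definition wave_field :: "real^3 \<Rightarrow> complex^3 \<Rightarrow> field" where
  "wave_field k z x = (\<chi> j. Re (z $ j * wave k x))"

definition field_sum :: "(real^3) set \<Rightarrow> (real^3 \<Rightarrow> complex^3) \<Rightarrow> field" where
  "field_sum F c x = (\<Sum>k\<in>F. wave_field k (c k) x)"

definition vcnj :: "complex^3 \<Rightarrow> complex^3" where
  "vcnj z = (\<chi> j. cnj (z $ j))"

lemma vcnj_nth [simp]: "vcnj z $ j = cnj (z $ j)"
  by (simp add: vcnj_def)

lemma inner_complex_vec: "(a::complex^3) \<bullet> b = (\<Sum>j\<in>UNIV. Re (a $ j * cnj (b $ j)))"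
  by (simp add: inner_vec_def inner_complex_def)

lemma norm_power2_vec: "(norm (v::'a::real_normed_vector^'n))\<^sup>2 = (\<Sum>j\<in>UNIV. (norm (v $ j))\<^sup>2)"
  by (simp add: norm_vec_def L2_set_def sum_nonneg)

lemma measurable_field_iff:
  "(u::'a \<Rightarrow> real^'n) \<in> borel_measurable M \<longleftrightarrow> (\<forall>j. (\<lambda>x. u x $ j) \<in> borel_measurable M)"
  by (subst borel_measurable_euclidean_space) (auto simp: Basis_vec_def inner_axis)

lemma measurable_component [measurable (raw)]:
  "(u::'a \<Rightarrow> real^'n) \<in> borel_measurable M \<Longrightarrow> (\<lambda>x. u x $ j) \<in> borel_measurable M"
  by (simp add: measurable_field_iff)

lemma integrable_component:
  "integrable M (u::'a \<Rightarrow> real^'n) \<Longrightarrow> integrable M (\<lambda>x. u x $ j)"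
  by (rule integrable_bounded_linear[OF bounded_linear_vec_nth])

lemma integrable_complex_component:
  "integrable M (u::'a \<Rightarrow> real^'n) \<Longrightarrow> integrable M (\<lambda>x. complex_of_real (u x $ j))"
  by (intro integrable_of_real integrable_component)

lemma integrable_fieldI:
  assumes "\<And>j. integrable M (\<lambda>x. (u::'a \<Rightarrow> real^'n) x $ j)"
  shows "integrable M u"
proof (rule Bochner_Integration.integrable_bound)
  show "integrable M (\<lambda>x. \<Sum>j\<in>UNIV. norm (u x $ j))" using assms by (intro Bochner_Integration.integrable_sum integrable_norm)
  show "u \<in> borel_measurable M" using assms by (auto simp: measurable_field_iff)
  show "AE x in M. norm (u x) \<le> norm (\<Sum>j\<in>UNIV. norm (u x $ j))"
    by (rule AE_I2) (simp add: sum_nonneg, rule norm_le_l1_cart)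
qed

lemma integral_component:
  "integrable M (u::'a \<Rightarrow> real^'n) \<Longrightarrow> (LINT x|M. u x) $ j = (LINT x|M. u x $ j)"
  by (rule integral_bounded_linear[OF bounded_linear_vec_nth, symmetric])

lemma L2_fields_iff: "u \<in> L2_fields \<longleftrightarrow> (\<forall>j. sq_integrable (\<lambda>x. of_real (u x $ j)))"
proof
  assume u: "u \<in> L2_fields"
  then have [measurable]: "u \<in> borel_measurable torus" by (simp add: L2_fields_def)
  show "\<forall>j. sq_integrable (\<lambda>x. of_real (u x $ j))"
  proof
    fix j
    have "integrable torus (\<lambda>x. (u x $ j)\<^sup>2)"
    proof (rule Bochner_Integration.integrable_bound)
      show "integrable torus (\<lambda>x. (norm (u x))\<^sup>2)" using u by (simp add: L2_fields_def)
      show "(\<lambda>x. (u x $ j)\<^sup>2) \<in> borel_measurable torus" by measurable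
      show "AE x in torus. norm ((u x $ j)\<^sup>2) \<le> norm ((norm (u x))\<^sup>2)"
      proof (rule AE_I2)
        fix x
        have "\<bar>u x $ j\<bar>\<^sup>2 \<le> (norm (u x))\<^sup>2"
          by (intro power_mono component_le_norm_cart) simp
        then show "norm ((u x $ j)\<^sup>2) \<le> norm ((norm (u x))\<^sup>2)" by simp
      qed
    qed
    then show "sq_integrable (\<lambda>x. of_real (u x $ j))"
      unfolding sq_integrable_def by auto
  qed
next
  assume *: "\<forall>j. sq_integrable (\<lambda>x. of_real (u x $ j))"
  have "(\<lambda>x. u x $ j) \<in> borel_measurable torus" for j
  proof -
    have "(\<lambda>x. complex_of_real (u x $ j)) \<in> borel_measurable torus"
      using * by (intro sq_integrable_measurable) blast
    then have "(\<lambda>x. Re (complex_of_real (u x $ j))) \<in> borel_measurable torus"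
      by (rule measurable_compose) (intro borel_measurable_continuous_onI continuous_intros)
    then show ?thesis by simp
  qed
  then have "u \<in> borel_measurable torus" by (simp add: measurable_field_iff)
  moreover have "integrable torus (\<lambda>x. (norm (u x))\<^sup>2)"
    unfolding norm_power2_vec using * by (auto simp: sq_integrable_def)
  ultimately show "u \<in> L2_fields" by (simp add: L2_fields_def)
qed

lemma L2_fields_integrable: "u \<in> L2_fields \<Longrightarrow> integrable torus u"
proof (rule integrable_fieldI)
  fix j assume "u \<in> L2_fields"
  then have "integrable torus (\<lambda>x. complex_of_real (u x $ j))"
    by (intro sq_integrable_integrable) (simp add: L2_fields_iff)
  from integrable_Re[OF this] show "integrable torus (\<lambda>x. u x $ j)" by simp
qed

lemma L2_fields_measurable [measurable_dest]: "u \<in> L2_fields \<Longrightarrow> u \<in> borel_measurable torus"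
  by (simp add: L2_fields_def)

lemma L2_fields_continuous: "continuous_on UNIV u \<Longrightarrow> u \<in> L2_fields"
  unfolding L2_fields_def
  by (auto intro!: measurable_torusI borel_measurable_continuous_onI integrable_torus_continuous continuous_intros)

lemma L2_fields_diff: "u \<in> L2_fields \<Longrightarrow> v \<in> L2_fields \<Longrightarrow> (\<lambda>x. u x - v x) \<in> L2_fields"
  by (simp add: L2_fields_iff sq_integrable_diff)

lemma fcoeff_add:
  "integrable torus u \<Longrightarrow> integrable torus v \<Longrightarrow> fcoeff (\<lambda>x. u x + v x) k = fcoeff u k + fcoeff v k"
  by (simp add: fcoeff_def vec_eq_iff fourier_add integrable_complex_component)

lemma fcoeff_diff:
  "integrable torus u \<Longrightarrow> integrable torus v \<Longrightarrow> fcoeff (\<lambda>x. u x - v x) k = fcoeff u k - fcoeff v k"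
  by (simp add: fcoeff_def vec_eq_iff fourier_diff integrable_complex_component)

lemma fcoeff_scale: "fcoeff (\<lambda>x. a *\<^sub>R u x) k = a *\<^sub>R fcoeff u k"
  by (simp add: fcoeff_def vec_eq_iff fourier_scale) (simp add: scaleR_conv_of_real)

lemma fcoeff_uminus: "fcoeff u (- k) = vcnj (fcoeff u k)"
  using fourier_cnj[of "\<lambda>x. of_real (u x $ _)" "- k"] by (simp add: fcoeff_def vec_eq_iff)

lemma L2_inner_commute: "L2_inner u v = L2_inner v u"
  by (simp add: L2_inner_def inner_commute)

text \<open>The inner product of \<open>complex^3\<close> is the real part of the Hermitian one, so
  letting z range over all vectors recovers the whole coefficient. In this way identities tested
  against all test fields become identities between coefficients.\<close>

lemma L2_inner_wave_field:
  assumes u: "integrable torus u"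
  shows "L2_inner u (wave_field k z) = fcoeff u k \<bullet> z"
proof -
  have i: "integrable torus (\<lambda>x. complex_of_real (u x $ j) * wave k x)" for j
    by (intro integrable_mult_wave integrable_complex_component u)
  have "u x \<bullet> wave_field k z x = (\<Sum>j\<in>UNIV. Re (z $ j * (of_real (u x $ j) * wave k x)))" for x
    by (simp add: inner_vec_def wave_field_def algebra_simps)
  then have "L2_inner u (wave_field k z) = (\<Sum>j\<in>UNIV. LINT x|torus. Re (z $ j * (of_real (u x $ j) * wave k x)))"
    using i by (simp only: L2_inner_def) (intro Bochner_Integration.integral_sum integrable_Re; simp)
  also have "\<dots> = (\<Sum>j\<in>UNIV. Re (z $ j * (LINT x|torus. of_real (u x $ j) * wave k x)))"
    using i by (intro sum.cong refl) (subst integral_Re, auto)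
  also have "\<dots> = (\<Sum>j\<in>UNIV. Re (z $ j * cnj (fcoeff u k $ j)))"
    unfolding fcoeff_uminus[symmetric] vcnj_nth[symmetric] by (simp add: fcoeff_def fourier_def)
  finally show ?thesis by (simp add: inner_complex_vec mult.commute)
qed

lemma fcoeff_eqI:
  assumes "integrable torus u" "integrable torus v" "\<And>z. L2_inner u (wave_field k z) = L2_inner v (wave_field k z)"
  shows "fcoeff u k = fcoeff v k"
  using assms by (simp add: L2_inner_wave_field) (metis vector_eq_rdot inner_commute)

lemma fcoeff_unique:
  assumes "integrable torus u" "integrable torus v" "\<And>k. k \<in> freq \<Longrightarrow> fcoeff u k = fcoeff v k"
  shows "AE x in torus. u x = v x"
proof -
  have "AE x in torus. complex_of_real (u x $ j) = of_real (v x $ j)" for j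
    using assms by (intro fourier_unique integrable_complex_component) (auto simp: fcoeff_def vec_eq_iff)
  then have "AE x in torus. \<forall>j\<in>UNIV. complex_of_real (u x $ j) = of_real (v x $ j)"
    by (intro AE_finite_allI) auto
  then show ?thesis by eventually_elim (simp add: vec_eq_iff)
qed

lemma has_sum_sum:
  fixes f :: "'a \<Rightarrow> 'b \<Rightarrow> 'c::topological_comm_monoid_add"
  shows "(\<And>i. i \<in> I \<Longrightarrow> ((\<lambda>x. f x i) has_sum s i) A) \<Longrightarrow> ((\<lambda>x. \<Sum>i\<in>I. f x i) has_sum (\<Sum>i\<in>I. s i)) A"
  by (induction I rule: infinite_finite_induct) (auto intro: has_sum_add)

lemma parseval_field:
  assumes u: "u \<in> L2_fields" and v: "v \<in> L2_fields"
  shows "((\<lambda>k. fcoeff u k \<bullet> fcoeff v k) has_sum L2_inner u v) freq"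
proof -
  have sq: "sq_integrable (\<lambda>x. of_real (u x $ j))" "sq_integrable (\<lambda>x. of_real (v x $ j))" for j
    using u v by (simp_all add: L2_fields_iff)
  have i: "integrable torus (\<lambda>x. complex_of_real (u x $ j) * cnj (of_real (v x $ j)))" for j
    by (intro sq_integrable_mult sq_integrable_cnj sq)
  have i': "integrable torus (\<lambda>x. u x $ j * v x $ j)" for j
    using integrable_Re[OF i[of j]] by simp
  have "L2_inner u v = (\<Sum>j\<in>UNIV. LINT x|torus. u x $ j * v x $ j)"
    unfolding L2_inner_def inner_vec_def using i' by (simp add: Bochner_Integration.integral_sum)
  also have "\<dots> = (\<Sum>j\<in>UNIV. Re (LINT x|torus. complex_of_real (u x $ j) * cnj (of_real (v x $ j))))"
    using i by (intro sum.cong refl) (subst integral_Re[symmetric], auto)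
  finally have eq: "L2_inner u v = (\<Sum>j\<in>UNIV. Re (LINT x|torus. complex_of_real (u x $ j) * cnj (of_real (v x $ j))))" .
  have "((\<lambda>k. Re (fourier (\<lambda>x. of_real (u x $ j)) k * cnj (fourier (\<lambda>x. of_real (v x $ j)) k))) has_sum
      Re (LINT x|torus. complex_of_real (u x $ j) * cnj (of_real (v x $ j)))) freq" for j
    by (intro has_sum_Re parseval sq)
  then show ?thesis
    unfolding eq inner_complex_vec fcoeff_def vec_lambda_beta by (rule has_sum_sum)
qed

lemma L2_inner_eq_infsum:
  "u \<in> L2_fields \<Longrightarrow> v \<in> L2_fields \<Longrightarrow> L2_inner u v = (\<Sum>\<^sub>\<infinity>k\<in>freq. fcoeff u k \<bullet> fcoeff v k)"
  by (rule infsumI[OF parseval_field, symmetric])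

lemma L2_norm_nonneg [simp]: "L2_norm u \<ge> 0"
  by (simp add: L2_norm_def)

lemma parseval_norm:
  assumes u: "u \<in> L2_fields"
  shows "((\<lambda>k. (norm (fcoeff u k))\<^sup>2) has_sum (L2_norm u)\<^sup>2) freq"
proof -
  have "L2_inner u u = (L2_norm u)\<^sup>2"
    by (simp add: L2_inner_def L2_norm_def power2_norm_eq_inner)
  then show ?thesis using parseval_field[OF u u] by (simp add: power2_norm_eq_inner)
qed

lemma bessel_field: "u \<in> L2_fields \<Longrightarrow> (\<lambda>k. (norm (fcoeff u k))\<^sup>2) summable_on freq"
  by (rule has_sum_imp_summable[OF parseval_norm])

lemma L2_norm_eq_infsum:
  "u \<in> L2_fields \<Longrightarrow> (L2_norm u)\<^sup>2 = (\<Sum>\<^sub>\<infinity>k\<in>freq. (norm (fcoeff u k))\<^sup>2)"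
  by (rule infsumI[OF parseval_norm, symmetric])

lemma norm_fcoeff_le:
  assumes u: "u \<in> L2_fields" and k: "k \<in> freq"
  shows "norm (fcoeff u k) \<le> L2_norm u"
proof -
  have "(norm (fcoeff u k))\<^sup>2 \<le> (L2_norm u)\<^sup>2"
    using finite_sum_le_infsum[OF bessel_field[OF u], of "{k}"] k L2_norm_eq_infsum[OF u] by simp
  then show ?thesis by (rule power2_le_imp_le) simp
qed

lemma summable_norm_component:
  fixes c :: "'a \<Rightarrow> complex^3"
  assumes "(\<lambda>k. (norm (c k))\<^sup>2) summable_on A"
  shows "(\<lambda>k. (cmod (c k $ j))\<^sup>2) summable_on A"
proof (rule summable_on_comparison_test[OF assms])
  show "(cmod (c k $ j))\<^sup>2 \<le> (norm (c k))\<^sup>2" for k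
    by (intro power_mono norm_ge_zero) (rule Finite_Cartesian_Product.norm_nth_le)
qed auto

text \<open>The scalar functions obtained for the components may have a nonzero imaginary part on a
  null set, so their real parts are taken. The symmetry of c says that this leaves the coefficients
  unchanged.\<close>

lemma riesz_fischer_field:
  assumes c: "(\<lambda>k. (norm (c k))\<^sup>2) summable_on freq"
    and sym: "\<And>k. k \<in> freq \<Longrightarrow> c (- k) = vcnj (c k)"
  obtains u where "u \<in> L2_fields" "\<And>k. k \<in> freq \<Longrightarrow> fcoeff u k = c k"
proof -
  have "\<exists>f. sq_integrable f \<and> (\<forall>k\<in>freq. fourier f k = c k $ j)" for j
    using riesz_fischer[OF summable_norm_component[OF c, of j]] by metis
  then obtain f where f: "\<And>j. sq_integrable (f j)" "\<And>j k. k \<in> freq \<Longrightarrow> fourier (f j) k = c k $ j"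
    by metis
  define u where "u x = (\<chi> j. Re (f j x))" for x
  have eq: "complex_of_real (u x $ j) = 1/2 * (f j x + cnj (f j x))" for x j
    by (simp add: u_def complex_eq_iff)
  have "u \<in> L2_fields"
    unfolding L2_fields_iff eq
    by (intro allI sq_integrable_scale sq_integrable_add sq_integrable_cnj f)
  moreover have "fcoeff u k = c k" if "k \<in> freq" for k
  proof -
    have i: "integrable torus (f j)" "integrable torus (\<lambda>x. cnj (f j x))" for j
      by (intro sq_integrable_integrable sq_integrable_cnj f)+
    show ?thesis
      unfolding fcoeff_def eq fourier_scale fourier_add[OF i] fourier_cnj
      using that by (simp add: f(2) sym vec_eq_iff)
  qed
  ultimately show ?thesis using that by blast
qed

lemma field_sum_nth: "field_sum F c x $ j = Re (trig_sum F (\<lambda>k. c k $ j) x)"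
  by (simp add: field_sum_def trig_sum_def wave_field_def)

lemma continuous_on_wave_field: "continuous_on S (wave_field k z)"
  unfolding wave_field_def by (intro continuous_intros)

lemma continuous_on_field_sum: "continuous_on S (field_sum F c)"
  unfolding field_sum_def by (intro continuous_intros continuous_on_wave_field)

lemma field_sum_L2: "field_sum F c \<in> L2_fields"
  by (intro L2_fields_continuous continuous_on_field_sum)

lemma field_expansion:
  assumes u: "u \<in> L2_fields"
  shows "(\<lambda>n. L2_norm (\<lambda>x. u x - field_sum (freq_cube n) (fcoeff u) x)) \<longlonglongrightarrow> 0"
proof -
  let ?f = "\<lambda>j x. complex_of_real (u x $ j)"
  let ?m = "\<lambda>n j. mean_square (\<lambda>x. ?f j x - trig_sum (freq_cube n) (fourier (?f j)) x)"
  have sq: "sq_integrable (?f j)" for j using u by (simp add: L2_fields_iff)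
  have lim: "(\<lambda>n. sqrt (\<Sum>j\<in>UNIV. ?m n j)) \<longlonglongrightarrow> 0"
  proof -
    have "(\<lambda>n. ?m n j) \<longlonglongrightarrow> 0" for j
      by (rule fourier_expansion[OF sq])
    then have "(\<lambda>n. sqrt (\<Sum>j\<in>UNIV. ?m n j)) \<longlonglongrightarrow> sqrt (\<Sum>j\<in>(UNIV::3 set). 0)"
      by (intro tendsto_real_sqrt tendsto_sum)
    then show ?thesis by simp
  qed
  have bound: "norm (L2_norm (\<lambda>x. u x - field_sum (freq_cube n) (fcoeff u) x)) \<le> sqrt (\<Sum>j\<in>UNIV. ?m n j)" for n
  proof -
    have i: "integrable torus (\<lambda>x. (cmod (?f j x - trig_sum (freq_cube n) (fourier (?f j)) x))\<^sup>2)" for j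
      using sq_integrable_diff[OF sq sq_integrable_trig_sum] by (simp add: sq_integrable_def)
    have "(LINT x|torus. (norm (u x - field_sum (freq_cube n) (fcoeff u) x))\<^sup>2)
      \<le> (LINT x|torus. (\<Sum>j\<in>UNIV. (cmod (?f j x - trig_sum (freq_cube n) (fourier (?f j)) x))\<^sup>2))"
    proof (rule integral_mono)
      show "integrable torus (\<lambda>x. (norm (u x - field_sum (freq_cube n) (fcoeff u) x))\<^sup>2)"
        using L2_fields_diff[OF u field_sum_L2] by (simp add: L2_fields_def)
      show "integrable torus (\<lambda>x. (\<Sum>j\<in>UNIV. (cmod (?f j x - trig_sum (freq_cube n) (fourier (?f j)) x))\<^sup>2))"
        by (intro Bochner_Integration.integrable_sum i)
      fix x
      have "\<bar>u x $ j - field_sum (freq_cube n) (fcoeff u) x $ j\<bar> \<le> cmod (?f j x - trig_sum (freq_cube n) (fourier (?f j)) x)" for j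
        using abs_Re_le_cmod[of "?f j x - trig_sum (freq_cube n) (fourier (?f j)) x"]
        by (simp add: field_sum_nth fcoeff_def)
      then have "\<bar>u x $ j - field_sum (freq_cube n) (fcoeff u) x $ j\<bar>\<^sup>2 \<le> (cmod (?f j x - trig_sum (freq_cube n) (fourier (?f j)) x))\<^sup>2" for j
        by (intro power_mono) auto
      then show "(norm (u x - field_sum (freq_cube n) (fcoeff u) x))\<^sup>2 \<le> (\<Sum>j\<in>UNIV. (cmod (?f j x - trig_sum (freq_cube n) (fourier (?f j)) x))\<^sup>2)"
        unfolding norm_power2_vec by (intro sum_mono) simp
    qed
    also have "\<dots> = (\<Sum>j\<in>UNIV. ?m n j)"
      unfolding mean_square_def by (intro Bochner_Integration.integral_sum i)
    finally show ?thesis by (simp add: L2_norm_def)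
  qed
  show ?thesis
    by (rule Lim_null_comparison[OF always_eventually[OF allI], OF bound lim])
qed

lemma L2_norm_bound_L1:
  assumes u: "u \<in> L2_fields"
  shows "(LINT x|torus. norm (u x)) \<le> L2_norm u"
proof -
  have "sq_integrable (\<lambda>x. of_real (norm (u x)))"
    using u by (auto simp: sq_integrable_def L2_fields_def)
  from integral_norm_le_mean_square[OF this] show ?thesis
    by (simp add: mean_square_def L2_norm_def)
qed

text \<open>Mean square convergence implies L^1 convergence and hence almost everywhere convergence
  of a subsequence. The pointwise form is what dominated convergence against a merely integrable
  field requires.\<close>

lemma field_expansion_AE:
  assumes u: "u \<in> L2_fields"
  obtains r where "strict_mono r" "AE x in torus. (\<lambda>n. field_sum (freq_cube (r n)) (fcoeff u) x) \<longlonglongrightarrow> u x"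
proof -
  let ?d = "\<lambda>n x. u x - field_sum (freq_cube n) (fcoeff u) x"
  have d: "?d n \<in> L2_fields" for n by (intro L2_fields_diff u field_sum_L2)
  have "norm (LINT x|torus. norm (?d n x)) \<le> L2_norm (?d n)" for n
    using L2_norm_bound_L1[OF d[of n]] by simp
  then have "(\<lambda>n. LINT x|torus. norm (?d n x)) \<longlonglongrightarrow> 0"
    by (rule Lim_null_comparison[OF always_eventually[OF allI] field_expansion[OF u]])
  then obtain r where r: "strict_mono r" "AE x in torus. (\<lambda>n. ?d (r n) x) \<longlonglongrightarrow> 0"
    using tendsto_L1_AE_subseq[of torus ?d, OF L2_fields_integrable[OF d]] by blast
  from r(2) have "AE x in torus. (\<lambda>n. field_sum (freq_cube (r n)) (fcoeff u) x) \<longlonglongrightarrow> u x"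
  proof eventually_elim
    case (elim x)
    from tendsto_diff[OF tendsto_const[of "u x"] elim] show ?case by simp
  qed
  with r(1) that show ?thesis by blast
qed

section \<open>Smooth periodic fields\<close>

abbreviation deriv_symbol :: "real \<Rightarrow> complex" where
  "deriv_symbol t \<equiv> 2 * pi * \<i> * of_real t"

text \<open>Up to the factor \<open>2 * pi * \<i>\<close> the Fourier symbol of the divergence; it
  is linear in z, without conjugation.\<close>

definition kdot :: "real^3 \<Rightarrow> complex^3 \<Rightarrow> complex" where
  "kdot k z = (\<Sum>i\<in>UNIV. of_real (k $ i) * z $ i)"

lemma kdot_diff: "kdot k (z - w) = kdot k z - kdot k w"
  by (simp add: kdot_def ring_distribs sum_subtractf)

lemma kdot_diff_left: "kdot (k - m) z = kdot k z - kdot m z"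
  by (simp add: kdot_def ring_distribs sum_subtractf)

lemma kdot_scale: "kdot k (a *s z) = a * kdot k z"
  by (simp add: kdot_def sum_distrib_left mult_ac)

lemma kdot_uminus_left: "kdot (- k) z = - kdot k z"
  by (simp add: kdot_def sum_negf)

lemma kdot_vcnj: "kdot k (vcnj z) = cnj (kdot k z)"
  by (simp add: kdot_def)

lemma norm_kdot_le: "cmod (kdot k z) \<le> norm k * norm z"
proof -
  have "cmod (kdot k z) \<le> (\<Sum>i\<in>UNIV. \<bar>k $ i\<bar> * \<bar>norm (z $ i)\<bar>)"
    unfolding kdot_def by (rule order_trans[OF norm_sum]) (simp add: norm_mult)
  also have "\<dots> \<le> L2_set (\<lambda>i. k $ i) UNIV * L2_set (\<lambda>i. norm (z $ i)) UNIV"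
    by (rule L2_set_mult_ineq)
  also have "\<dots> = norm k * norm z" by (simp add: norm_vec_def L2_set_def)
  finally show ?thesis .
qed

lemma has_derivative_field_iff:
  fixes f :: "'a::real_normed_vector \<Rightarrow> real^'n"
  shows "(f has_derivative D) (at x) \<longleftrightarrow> (\<forall>j. ((\<lambda>x. f x $ j) has_derivative (\<lambda>h. D h $ j)) (at x))"
  by (subst has_derivative_componentwise_within) (auto simp: Basis_vec_def inner_axis)

lemma has_derivative_wave:
  "(wave k has_derivative (\<lambda>h. deriv_symbol (k \<bullet> h) * wave k x)) (at x)"
proof -
  have "((\<lambda>x. of_real (cos (2 * pi * (k \<bullet> x))) + \<i> * of_real (sin (2 * pi * (k \<bullet> x))))
      has_derivative (\<lambda>h. of_real (- sin (2 * pi * (k \<bullet> x)) * (2 * pi * (k \<bullet> h)))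
        + \<i> * of_real (cos (2 * pi * (k \<bullet> x)) * (2 * pi * (k \<bullet> h))))) (at x)"
    by (auto intro!: derivative_eq_intros simp: fun_eq_iff algebra_simps)
  moreover have "wave k = (\<lambda>x. of_real (cos (2 * pi * (k \<bullet> x))) + \<i> * of_real (sin (2 * pi * (k \<bullet> x))))"
    by (simp add: wave_def fun_eq_iff complex_eq_iff)
  moreover have "(\<lambda>h. of_real (- sin (2 * pi * (k \<bullet> x)) * (2 * pi * (k \<bullet> h)))
        + \<i> * of_real (cos (2 * pi * (k \<bullet> x)) * (2 * pi * (k \<bullet> h))))
     = (\<lambda>h. deriv_symbol (k \<bullet> h) * wave k x)"
    by (simp add: wave_def fun_eq_iff complex_eq_iff)
  ultimately show ?thesis by simp
qed

lemma has_derivative_field_sum: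
  "(field_sum F c has_derivative (\<lambda>h. field_sum F (\<lambda>k. deriv_symbol (k \<bullet> h) *s c k) x)) (at x)"
  unfolding has_derivative_field_iff
proof
  fix j
  have "((\<lambda>x. Re (\<Sum>k\<in>F. c k $ j * wave k x)) has_derivative
     (\<lambda>h. Re (\<Sum>k\<in>F. c k $ j * (deriv_symbol (k \<bullet> h) * wave k x)))) (at x)"
    by (intro has_derivative_Re has_derivative_sum has_derivative_mult_right has_derivative_wave)
  then show "((\<lambda>x. field_sum F c x $ j) has_derivative
      (\<lambda>h. field_sum F (\<lambda>k. deriv_symbol (k \<bullet> h) *s c k) x $ j)) (at x)"
    unfolding field_sum_nth trig_sum_def by (simp add: mult_ac)
qed

lemma frechet_derivative_field_sum:
  "frechet_derivative (field_sum F c) (at x) h = field_sum F (\<lambda>k. deriv_symbol (k \<bullet> h) *s c k) x"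
  by (simp add: frechet_derivative_at[OF has_derivative_field_sum, symmetric])

lemma partial_field_sum:
  "partial i (field_sum F c) = field_sum F (\<lambda>k. deriv_symbol (k $ i) *s c k)"
  by (simp add: partial_def frechet_derivative_field_sum fun_eq_iff inner_axis)

lemma Ck_field_sum: "Ck n (field_sum F c)"
proof (induction n arbitrary: c)
  case 0
  then show ?case by (simp add: continuous_on_field_sum)
next
  case (Suc n)
  then show ?case
    by (auto simp: frechet_derivative_field_sum intro: differentiableI[OF has_derivative_field_sum])
qed

lemma field_sum_test:
  assumes "F \<subseteq> freq"
  shows "field_sum F c \<in> test_fields"
  using assms by (auto simp: test_fields_def smooth_def Ck_field_sum field_sum_def wave_field_def wave_periodic
    subset_iff intro!: sum.cong)

lemma wave_field_eq_sum: "wave_field k z = field_sum {k} (\<lambda>_. z)"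
  by (simp add: field_sum_def fun_eq_iff)

lemma wave_field_test: "k \<in> freq \<Longrightarrow> wave_field k z \<in> test_fields"
  unfolding wave_field_eq_sum by (rule field_sum_test) simp

section \<open>Test fields and the decay of their Fourier coefficients\<close>

lemma test_differentiable: "\<phi> \<in> test_fields \<Longrightarrow> \<phi> differentiable (at x)"
  unfolding test_fields_def smooth_def by (auto dest!: spec[of _ "Suc 0"])

lemma test_continuous: "\<phi> \<in> test_fields \<Longrightarrow> continuous_on S \<phi>"
  unfolding test_fields_def smooth_def by (auto dest!: spec[of _ 0] intro: continuous_on_subset)

lemma test_L2: "\<phi> \<in> test_fields \<Longrightarrow> \<phi> \<in> L2_fields"
  by (intro L2_fields_continuous test_continuous)

lemma test_integrable: "\<phi> \<in> test_fields \<Longrightarrow> integrable torus \<phi>"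
  by (intro L2_fields_integrable test_L2)

lemma test_has_derivative: "\<phi> \<in> test_fields \<Longrightarrow> (\<phi> has_derivative frechet_derivative \<phi> (at x)) (at x)"
  using test_differentiable frechet_derivative_works by blast

lemma partial_test:
  assumes \<phi>: "\<phi> \<in> test_fields"
  shows "partial i \<phi> \<in> test_fields"
proof -
  have "Ck n (partial i \<phi>)" for n
    using \<phi> unfolding test_fields_def smooth_def partial_def[abs_def] by (auto dest!: spec[of _ "Suc n"])
  moreover have "partial i \<phi> (x + axis j 1) = partial i \<phi> x" for x j
  proof -
    have "((\<lambda>y. \<phi> (y + axis j 1)) has_derivative frechet_derivative \<phi> (at (x + axis j 1))) (at x)"
    proof -
      have s: "((\<lambda>y. y + axis j 1) has_derivative (\<lambda>h. h)) (at x)"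
        by (auto intro!: derivative_eq_intros)
      show ?thesis
        using has_derivative_compose[OF s test_has_derivative[OF \<phi>]] by simp
    qed
    moreover have "(\<lambda>y. \<phi> (y + axis j 1)) = \<phi>" using \<phi> by (auto simp: test_fields_def)
    ultimately have "frechet_derivative \<phi> (at (x + axis j 1)) = frechet_derivative \<phi> (at x)"
      using frechet_derivative_at by metis
    then show ?thesis by (simp add: partial_def)
  qed
  ultimately show ?thesis by (simp add: test_fields_def smooth_def)
qed

lemma Ck_add: "Ck n f \<Longrightarrow> Ck n g \<Longrightarrow> Ck n (\<lambda>x. a *\<^sub>R f x + b *\<^sub>R g x)"
proof (induction n arbitrary: f g)
  case 0
  then show ?case by (auto intro!: continuous_intros)
next
  case (Suc n)
  have D: "((\<lambda>x. a *\<^sub>R f x + b *\<^sub>R g x) has_derivative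
      (\<lambda>h. a *\<^sub>R frechet_derivative f (at x) h + b *\<^sub>R frechet_derivative g (at x) h)) (at x)" for x
    using Suc.prems by (intro has_derivative_add has_derivative_scaleR_right) (auto simp: frechet_derivative_works[symmetric])
  have "frechet_derivative (\<lambda>x. a *\<^sub>R f x + b *\<^sub>R g x) (at x) h =
      a *\<^sub>R frechet_derivative f (at x) h + b *\<^sub>R frechet_derivative g (at x) h" for x h
    using frechet_derivative_at[OF D[of x]] by metis
  then show ?case
    using Suc by (auto intro: differentiableI[OF D])
qed

lemma test_lincomb: "\<phi> \<in> test_fields \<Longrightarrow> \<psi> \<in> test_fields \<Longrightarrow> (\<lambda>x. a *\<^sub>R \<phi> x + b *\<^sub>R \<psi> x) \<in> test_fields"
  by (auto simp: test_fields_def smooth_def Ck_add)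

text \<open>The difference quotients of G have integral 0 by translation invariance. They converge
  to the derivative and are uniformly bounded by the mean value inequality, so dominated convergence
  applies.\<close>

lemma integral_partial_zero:
  fixes G :: "real^3 \<Rightarrow> complex"
  assumes D: "\<And>x. (G has_derivative D x) (at x)"
    and cD: "continuous_on UNIV (\<lambda>x. D x (axis i 1))"
    and per: "\<And>x. G (x + axis i 1) = G x"
  shows "(LINT x|torus. D x (axis i 1)) = 0"
proof -
  let ?e = "axis i 1 :: real^3"
  define t where "t n = inverse (real (Suc n))" for n
  have t: "0 < t n" "t n \<le> 1" for n by (auto simp: t_def divide_simps)
  have ax: "axis i (s::real) = s *\<^sub>R ?e" for s by (auto simp: axis_def vec_eq_iff)
  define q where "q n x = (1 / t n) *\<^sub>R (G (x + axis i (t n)) - G x)" for n x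
  have cG: "continuous_on UNIV G"
    by (intro continuous_at_imp_continuous_on ballI has_derivative_continuous[OF D])
  have cG': "continuous_on UNIV (\<lambda>x. G (x + axis i s))" for s
    by (intro continuous_on_compose2[OF cG] continuous_intros) auto
  have q0: "(LINT x|torus. q n x) = 0" for n
  proof -
    have "(LINT x|torus. G (x + axis i (t n)) - G x) = 0"
      using integral_torus_shift[OF cG per, of "t n"] t[of n]
      by (subst Bochner_Integration.integral_diff)
         (auto intro!: integrable_torus_continuous cG cG' simp: less_imp_le)
    then show ?thesis by (simp add: q_def)
  qed
  \<comment> \<open>The segment from x to x + e_i may leave the unit cube, so the derivative is
    bounded on the cube of side 2.\<close>
  obtain B where B: "\<And>x. x \<in> cbox 0 2 \<Longrightarrow> norm (D x ?e) \<le> B"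
  proof -
    have "bounded ((\<lambda>x. D x ?e) ` cbox 0 2)"
      by (intro compact_imp_bounded compact_continuous_image continuous_on_subset[OF cD]) auto
    then show ?thesis using that by (auto simp: bounded_iff)
  qed
  have qB: "norm (q n x) \<le> B" if x: "x \<in> cbox 0 1" for n x
  proof -
    have "norm (G (x + t n *\<^sub>R ?e) - G (x + 0 *\<^sub>R ?e)) \<le> B * norm (t n - 0)"
    proof (rule differentiable_bound[where S = "{0..1}" and f' = "\<lambda>s h. h *\<^sub>R D (x + s *\<^sub>R ?e) ?e"])
      fix s :: real assume s: "s \<in> {0..1}"
      have l: "((\<lambda>s. x + s *\<^sub>R ?e) has_derivative (\<lambda>h. h *\<^sub>R ?e)) (at s within {0..1})"
        by (auto intro!: derivative_eq_intros)
      interpret bounded_linear "D (x + s *\<^sub>R ?e)" by (rule has_derivative_bounded_linear[OF D])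
      show "((\<lambda>s. G (x + s *\<^sub>R ?e)) has_derivative (\<lambda>h. h *\<^sub>R D (x + s *\<^sub>R ?e) ?e)) (at s within {0..1})"
        using has_derivative_compose[OF l D] by (simp add: scaleR)
      have "x + s *\<^sub>R ?e \<in> cbox 0 2"
        unfolding mem_box_cart
      proof
        fix j
        have "0 \<le> x $ j" "x $ j \<le> 1" using x by (auto simp: mem_box_cart)
        then show "(0::real^3) $ j \<le> (x + s *\<^sub>R ?e) $ j \<and> (x + s *\<^sub>R ?e) $ j \<le> (2::real^3) $ j"
          using s by (auto simp: axis_def)
      qed
      then have DB: "norm (D (x + s *\<^sub>R ?e) ?e) \<le> B" by (rule B)
      show "onorm (\<lambda>h. h *\<^sub>R D (x + s *\<^sub>R ?e) ?e) \<le> B"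
      proof (rule onorm_le)
        show "norm (h *\<^sub>R D (x + s *\<^sub>R ?e) ?e) \<le> B * norm h" for h :: real
          using mult_left_mono[OF DB abs_ge_zero[of h]] by (simp only: norm_scaleR real_norm_def mult.commute)
      qed
    qed (use t[of n] in auto)
    then show ?thesis using t[of n] by (simp add: q_def ax[of "t n"] pos_divide_le_eq)
  qed
  have "(\<lambda>n. LINT x|torus. q n x) \<longlonglongrightarrow> (LINT x|torus. D x ?e)"
  proof (rule integral_dominated_convergence[where w = "\<lambda>_. B"])
    show "(\<lambda>x. D x ?e) \<in> borel_measurable torus"
      by (intro measurable_torusI borel_measurable_continuous_onI cD)
    show "q n \<in> borel_measurable torus" for n
      unfolding q_def[abs_def] by (intro measurable_torusI borel_measurable_continuous_onI continuous_intros cG cG')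
    show "AE x in torus. norm (q n x) \<le> B" for n by (rule AE_I2) (simp add: qB)
    show "AE x in torus. (\<lambda>n. q n x) \<longlonglongrightarrow> D x ?e"
    proof (rule AE_I2)
      fix x
      interpret bounded_linear "D x" by (rule has_derivative_bounded_linear[OF D])
      have "((\<lambda>h. norm (G (x + h) - G x - D x h) / norm h) \<longlongrightarrow> 0) (at 0)"
        using D[of x] by (simp add: has_derivative_at)
      moreover have "filterlim (\<lambda>n. t n *\<^sub>R ?e) (at 0) sequentially"
      proof -
        have "(\<lambda>n. t n *\<^sub>R ?e) \<longlonglongrightarrow> 0 *\<^sub>R ?e"
          unfolding t_def by (intro tendsto_scaleR LIMSEQ_inverse_real_of_nat tendsto_const)
        moreover have "t n *\<^sub>R ?e \<noteq> 0" for n using t(1)[of n] by (simp add: axis_eq_0_iff)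
        ultimately show ?thesis by (simp add: filterlim_at)
      qed
      ultimately have "(\<lambda>n. norm (G (x + t n *\<^sub>R ?e) - G x - D x (t n *\<^sub>R ?e)) / norm (t n *\<^sub>R ?e)) \<longlonglongrightarrow> 0"
        by (rule filterlim_compose)
      moreover have "norm (G (x + t n *\<^sub>R ?e) - G x - D x (t n *\<^sub>R ?e)) / norm (t n *\<^sub>R ?e) = norm (q n x - D x ?e)" for n
      proof -
        have "q n x - D x ?e = (1 / t n) *\<^sub>R (G (x + t n *\<^sub>R ?e) - G x - D x (t n *\<^sub>R ?e))"
          using t(1)[of n] by (simp add: q_def ax[of "t n"] scaleR scaleR_diff_right)
        then show ?thesis using t(1)[of n] by simp
      qed
      ultimately have "(\<lambda>n. norm (q n x - D x ?e)) \<longlonglongrightarrow> 0" by simp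
      then show "(\<lambda>n. q n x) \<longlonglongrightarrow> D x ?e" by (rule LIM_zero_cancel[OF tendsto_norm_zero_cancel])
    qed
  qed auto
  then show ?thesis by (simp add: q0 LIMSEQ_const_iff)
qed

text \<open>Integration by parts: the derivative of the product of a component of \<phi> with the
  conjugate wave integrates to zero.\<close>

lemma fcoeff_partial:
  assumes \<phi>: "\<phi> \<in> test_fields" and k: "k \<in> freq"
  shows "fcoeff (partial i \<phi>) k = deriv_symbol (k $ i) *s fcoeff \<phi> k"
proof -
  have "fourier (\<lambda>x. of_real (partial i \<phi> x $ j)) k = deriv_symbol (k $ i) * fourier (\<lambda>x. of_real (\<phi> x $ j)) k" for j
  proof -
    define G where "G x = complex_of_real (\<phi> x $ j) * wave (- k) x" for x
    define D where "D x h = complex_of_real (\<phi> x $ j) * (deriv_symbol (- k \<bullet> h) * wave (- k) x)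
       + of_real (frechet_derivative \<phi> (at x) h $ j) * wave (- k) x" for x h
    have "(G has_derivative D x) (at x)" for x
      unfolding G_def D_def
      by (intro has_derivative_mult has_derivative_of_real has_derivative_wave
            test_has_derivative[OF \<phi>, unfolded has_derivative_field_iff, rule_format])
    moreover have De: "D x (axis i 1) = of_real (partial i \<phi> x $ j) * wave (- k) x
       - deriv_symbol (k $ i) * (of_real (\<phi> x $ j) * wave (- k) x)" for x
      by (simp add: D_def partial_def inner_axis)
    moreover have "continuous_on UNIV (\<lambda>x. D x (axis i 1))"
      unfolding De by (intro continuous_intros test_continuous partial_test \<phi>)
    moreover have "G (x + axis i 1) = G x" for x
      using \<phi> k by (simp add: G_def wave_periodic test_fields_def)
    ultimately have "(LINT x|torus. D x (axis i 1)) = 0"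
      by (intro integral_partial_zero[of G]) auto
    then show ?thesis
      unfolding De fourier_def
      by (subst (asm) Bochner_Integration.integral_diff)
         (auto intro!: integrable_mult_wave integrable_complex_component test_integrable partial_test \<phi>)
  qed
  then show ?thesis by (simp add: fcoeff_def vec_eq_iff)
qed

lemma fcoeff_bounded:
  assumes "integrable torus u"
  shows "\<exists>C. \<forall>k. norm (fcoeff u k) \<le> C"
proof (intro exI allI)
  fix k
  have "cmod (fourier (\<lambda>x. of_real (u x $ j)) k) \<le> (LINT x|torus. \<bar>u x $ j\<bar>)" for j
    unfolding fourier_def
    using integral_norm_bound[of torus "\<lambda>x. complex_of_real (u x $ j) * wave (- k) x"] by (simp add: norm_mult)
  then have "(\<Sum>j\<in>UNIV. cmod (fcoeff u k $ j)) \<le> (\<Sum>j\<in>UNIV. LINT x|torus. \<bar>u x $ j\<bar>)"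
    by (intro sum_mono) (simp add: fcoeff_def)
  moreover have "norm (fcoeff u k) \<le> (\<Sum>j\<in>UNIV. cmod (fcoeff u k $ j))"
    unfolding norm_vec_def by (rule L2_set_le_sum) simp
  ultimately show "norm (fcoeff u k) \<le> (\<Sum>j\<in>UNIV. LINT x|torus. \<bar>u x $ j\<bar>)" by linarith
qed

lemma iterated_partial_test: "\<phi> \<in> test_fields \<Longrightarrow> (partial i ^^ N) \<phi> \<in> test_fields"
  by (induction N) (auto intro: partial_test)

lemma fcoeff_iterated_partial:
  assumes "\<phi> \<in> test_fields" "k \<in> freq"
  shows "fcoeff ((partial i ^^ N) \<phi>) k = deriv_symbol (k $ i) ^ N *s fcoeff \<phi> k"
  using assms by (induction N) (auto simp: fcoeff_partial iterated_partial_test vector_smult_assoc)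

lemma norm_vector_scalar_mult: "norm ((c::complex) *s (z::complex^'n)) = cmod c * norm z"
  by (simp add: norm_vec_def norm_mult L2_set_right_distrib)

text \<open>Since |k| is at most the sum of its three coordinates in absolute value, some i has |k|
  \<le> 3 |k_i|. The N-fold derivative in that direction has bounded coefficients, and its symbol
  dominates |k_i|^N.\<close>

lemma fcoeff_decay:
  assumes \<phi>: "\<phi> \<in> test_fields"
  shows "\<exists>C. \<forall>k\<in>freq. norm k ^ N * norm (fcoeff \<phi> k) \<le> C"
proof -
  have "\<exists>C. \<forall>k. norm (fcoeff ((partial i ^^ N) \<phi>) k) \<le> C" for i
    by (intro fcoeff_bounded test_integrable iterated_partial_test \<phi>)
  then obtain C where C: "\<And>i k. norm (fcoeff ((partial i ^^ N) \<phi>) k) \<le> C i" by metis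
  have C0: "C i \<ge> 0" for i using C[of i 0] norm_ge_zero order_trans by blast
  have "norm k ^ N * norm (fcoeff \<phi> k) \<le> 3 ^ N * (\<Sum>i\<in>UNIV. C i)" if k: "k \<in> freq" for k
  proof -
    have "\<exists>i. norm k \<le> 3 * \<bar>k $ i\<bar>"
    proof (rule ccontr)
      assume "\<nexists>i. norm k \<le> 3 * \<bar>k $ i\<bar>"
      then have "\<bar>k $ i\<bar> < norm k / 3" for i
        by (auto simp: not_le dest: spec[of _ i])
      then have "(\<Sum>i\<in>UNIV. \<bar>k $ i\<bar>) < (\<Sum>i\<in>(UNIV::3 set). norm k / 3)"
        by (intro sum_strict_mono) auto
      then show False using norm_le_l1_cart[of k] by simp
    qed
    then obtain i where i: "norm k \<le> 3 * \<bar>k $ i\<bar>" by blast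
    have "norm k ^ N \<le> (3 * \<bar>k $ i\<bar>) ^ N" by (intro power_mono i) simp
    also have "\<dots> = 3 ^ N * \<bar>k $ i\<bar> ^ N" by (rule power_mult_distrib)
    also have "\<dots> \<le> 3 ^ N * cmod (deriv_symbol (k $ i) ^ N)"
    proof -
      have "1 * \<bar>k $ i\<bar> \<le> (2 * pi) * \<bar>k $ i\<bar>" using pi_ge_two by (intro mult_right_mono) auto
      then have "\<bar>k $ i\<bar> ^ N \<le> (2 * pi * \<bar>k $ i\<bar>) ^ N" by (intro power_mono) auto
      then show ?thesis by (simp add: norm_power norm_mult)
    qed
    finally have "norm k ^ N * norm (fcoeff \<phi> k) \<le> 3 ^ N * cmod (deriv_symbol (k $ i) ^ N) * norm (fcoeff \<phi> k)"
      by (rule mult_right_mono) simp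
    also have "\<dots> = 3 ^ N * norm (fcoeff ((partial i ^^ N) \<phi>) k)"
      unfolding fcoeff_iterated_partial[OF \<phi> k] norm_vector_scalar_mult by simp
    also have "\<dots> \<le> 3 ^ N * C i" using C by simp
    also have "\<dots> \<le> 3 ^ N * (\<Sum>i\<in>UNIV. C i)"
      using C0 by (intro mult_left_mono member_le_sum) auto
    finally show ?thesis .
  qed
  then show ?thesis by blast
qed

section \<open>The Stokes operator and the Leray projection\<close>

text \<open>\<open>kdot 0 z\<close> vanishes for every z, so the zero mean of the fields in H enters
  as a separate condition at k = 0.\<close>

definition solenoidal_coeff :: "real^3 \<Rightarrow> complex^3 \<Rightarrow> bool" where
  "solenoidal_coeff k z \<longleftrightarrow> kdot k z = 0 \<and> (k = 0 \<longrightarrow> z = 0)"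

text \<open>The orthogonal projection onto the complement of k. The value 0 at k = 0 removes the
  mean.\<close>

definition leray_symbol :: "real^3 \<Rightarrow> complex^3 \<Rightarrow> complex^3" where
  "leray_symbol k z = (if k = 0 then 0
     else z - (kdot k z / of_real ((norm k)\<^sup>2)) *s (\<chi> i. of_real (k $ i)))"

text \<open>The eigenvalue of -\<Delta> on waves of frequency k and period 1, raised to the power
  \<beta>. At k = 0 the value is 0 for every \<beta>, also a negative one, in accordance with the
  missing zero mode.\<close>

definition stokes_symbol :: "real \<Rightarrow> real^3 \<Rightarrow> real" where
  "stokes_symbol \<beta> k = (4 * pi\<^sup>2 * (norm k)\<^sup>2) powr \<beta>"

lemma kdot_self: "kdot k (\<chi> i. of_real (k $ i)) = of_real ((norm k)\<^sup>2)"
  unfolding norm_power2_vec by (simp add: kdot_def power2_eq_square)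

lemma scaleR_vec_conv: "a *\<^sub>R (z::complex^3) = of_real a *s z"
  by (simp add: vec_eq_iff scaleR_conv_of_real[where 'a = complex])

lemma kdot_scaleR: "kdot k (a *\<^sub>R z) = of_real a * kdot k z"
  by (simp add: scaleR_vec_conv kdot_scale)

lemma solenoidal_coeff_diff: "solenoidal_coeff k z \<Longrightarrow> solenoidal_coeff k w \<Longrightarrow> solenoidal_coeff k (z - w)"
  by (simp add: solenoidal_coeff_def kdot_diff)

lemma solenoidal_coeff_scaleR: "solenoidal_coeff k z \<Longrightarrow> solenoidal_coeff k (a *\<^sub>R z)"
  by (auto simp: solenoidal_coeff_def kdot_scaleR)

lemma solenoidal_leray_symbol: "solenoidal_coeff k (leray_symbol k z)"
  by (auto simp: solenoidal_coeff_def leray_symbol_def kdot_diff kdot_scale kdot_self kdot_def[of 0])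

text \<open>The vector subtracted from z is a multiple of k, and pairing k with y gives the
  conjugate of \<open>kdot k y\<close>, which is 0.\<close>

lemma leray_symbol_inner:
  assumes "solenoidal_coeff k y"
  shows "leray_symbol k z \<bullet> y = z \<bullet> y"
proof (cases "k = 0")
  case True
  then show ?thesis using assms by (simp add: solenoidal_coeff_def)
next
  case False
  let ?a = "kdot k z / of_real ((norm k)\<^sup>2)"
  have "(?a *s (\<chi> i. of_real (k $ i))) \<bullet> y = Re (\<Sum>j\<in>UNIV. ?a * cnj (of_real (k $ j) * y $ j))"
    unfolding inner_complex_vec by (simp add: mult_ac)
  also have "\<dots> = Re (?a * cnj (kdot k y))"
    by (simp only: sum_distrib_left[symmetric] kdot_def cnj_sum)
  also have "\<dots> = 0" using assms by (simp add: solenoidal_coeff_def)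
  finally show ?thesis using False by (simp add: leray_symbol_def inner_diff_left)
qed

lemma leray_symbol_adjoint: "leray_symbol k z \<bullet> w = z \<bullet> leray_symbol k w"
  by (metis inner_commute leray_symbol_inner solenoidal_leray_symbol)

lemma norm_leray_symbol_le: "norm (leray_symbol k z) \<le> norm z"
proof -
  have "norm (leray_symbol k z) * norm (leray_symbol k z) = z \<bullet> leray_symbol k z"
    using leray_symbol_inner[OF solenoidal_leray_symbol, of k z z]
    by (simp add: power2_norm_eq_inner flip: power2_eq_square)
  also have "\<dots> \<le> norm z * norm (leray_symbol k z)" by (rule norm_cauchy_schwarz)
  finally show ?thesis
    by (cases "leray_symbol k z = 0") (auto simp: mult_le_cancel_right)
qed

lemma leray_symbol_vcnj: "leray_symbol (- k) (vcnj z) = vcnj (leray_symbol k z)"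
  by (simp add: leray_symbol_def vec_eq_iff kdot_uminus_left kdot_vcnj)

lemma fcoeff_sum:
  "(\<And>i. i \<in> I \<Longrightarrow> integrable torus (f i)) \<Longrightarrow> fcoeff (\<lambda>x. \<Sum>i\<in>I. f i x) k = (\<Sum>i\<in>I. fcoeff (f i) k)"
  by (simp add: fcoeff_def vec_eq_iff fourier_sum integrable_complex_component)

lemma fcoeff_divergence:
  assumes \<phi>: "\<phi> \<in> test_fields" and k: "k \<in> freq"
  shows "2 * pi * \<i> * kdot k (fcoeff \<phi> k) = fourier (\<lambda>x. of_real (divergence \<phi> x)) k"
proof -
  have "fourier (\<lambda>x. of_real (divergence \<phi> x)) k = (\<Sum>i\<in>UNIV. fcoeff (partial i \<phi>) k $ i)"
    unfolding divergence_def of_real_sum fcoeff_def vec_lambda_beta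
    by (intro fourier_sum integrable_complex_component test_integrable partial_test \<phi>)
  then show ?thesis
    by (simp add: fcoeff_partial[OF \<phi> k] kdot_def sum_distrib_left mult_ac)
qed

lemma fcoeff_0_eq_0:
  assumes "integrable torus u" "(LINT x|torus. u x) = 0"
  shows "fcoeff u 0 = 0"
proof -
  have "(LINT x|torus. u x $ j) = 0" for j
    using integral_component[OF assms(1), of j] assms(2) by simp
  then show ?thesis by (simp add: fcoeff_def fourier_def vec_eq_iff)
qed

lemma solenoidal_fields_coeff:
  assumes "\<phi> \<in> solenoidal_fields" "k \<in> freq"
  shows "solenoidal_coeff k (fcoeff \<phi> k)"
proof -
  have "fourier (\<lambda>x. of_real (divergence \<phi> x)) k = 0"
    using assms by (simp add: solenoidal_fields_def fourier_0)
  then show ?thesis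
    using fcoeff_divergence[of \<phi> k] fcoeff_0_eq_0[of \<phi>] assms
    by (auto simp: solenoidal_coeff_def solenoidal_fields_def test_integrable)
qed

lemma divergence_field_sum:
  "divergence (field_sum F c) x = Re (\<Sum>k\<in>F. 2 * pi * \<i> * kdot k (c k) * wave k x)"
proof -
  have "divergence (field_sum F c) x = Re (\<Sum>i\<in>UNIV. \<Sum>k\<in>F. deriv_symbol (k $ i) * c k $ i * wave k x)"
    by (simp add: divergence_def partial_field_sum field_sum_nth trig_sum_def)
  also have "(\<Sum>i\<in>UNIV. \<Sum>k\<in>F. deriv_symbol (k $ i) * c k $ i * wave k x) =
     (\<Sum>k\<in>F. \<Sum>i\<in>UNIV. deriv_symbol (k $ i) * c k $ i * wave k x)"
    by (rule sum.swap)
  also have "\<dots> = (\<Sum>k\<in>F. 2 * pi * \<i> * kdot k (c k) * wave k x)"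
    by (simp add: kdot_def sum_distrib_left sum_distrib_right mult_ac)
  finally show ?thesis .
qed

lemma integral_field_sum:
  assumes "F \<subseteq> freq" "0 \<in> F \<Longrightarrow> c 0 = 0"
  shows "(LINT x|torus. field_sum F c x) = 0"
proof -
  have i: "integrable torus (field_sum F c)" by (intro L2_fields_integrable field_sum_L2)
  have "(LINT x|torus. field_sum F c x) $ j = 0" for j
  proof -
    have "(LINT x|torus. field_sum F c x) $ j = Re (LINT x|torus. trig_sum F (\<lambda>k. c k $ j) x)"
      unfolding integral_component[OF i] field_sum_nth
      by (rule integral_Re) (intro sq_integrable_integrable sq_integrable_trig_sum)
    also have "(LINT x|torus. trig_sum F (\<lambda>k. c k $ j) x) = (\<Sum>k\<in>F. c k $ j * (LINT x|torus. wave k x))"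
      unfolding trig_sum_def
      by (subst Bochner_Integration.integral_sum) (auto intro!: integrable_torus_continuous continuous_intros)
    also have "\<dots> = 0"
      using assms by (intro sum.neutral) (auto simp: integral_wave subset_iff)
    finally show ?thesis by simp
  qed
  then show ?thesis by (simp add: vec_eq_iff)
qed

lemma field_sum_solenoidal:
  assumes "F \<subseteq> freq" "\<And>k. k \<in> F \<Longrightarrow> solenoidal_coeff k (c k)"
  shows "field_sum F c \<in> solenoidal_fields"
  using assms integral_field_sum[of F c]
  by (auto simp: solenoidal_fields_def field_sum_test divergence_field_sum solenoidal_coeff_def)

text \<open>Taking a coefficient is a contraction from L^2 and the solenoidal condition is closed,
  so it survives the closure. Conversely the partial Fourier sums of such a field are themselves
  solenoidal fields converging to it.\<close>

lemma H_space_iff: "u \<in> H_space \<longleftrightarrow> u \<in> L2_fields \<and> (\<forall>k\<in>freq. solenoidal_coeff k (fcoeff u k))"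
proof (intro iffI conjI ballI)
  assume u: "u \<in> H_space"
  then show L: "u \<in> L2_fields" by (simp add: H_space_def)
  fix k assume k: "k \<in> freq"
  have approx: "\<exists>y. solenoidal_coeff k y \<and> norm (fcoeff u k - y) < e" if "e > 0" for e
  proof -
    obtain \<phi> where \<phi>: "\<phi> \<in> solenoidal_fields" "L2_norm (\<lambda>x. u x - \<phi> x) < e"
      using u \<open>e > 0\<close> by (auto simp: H_space_def)
    have L': "\<phi> \<in> L2_fields" using \<phi> by (auto simp: solenoidal_fields_def test_L2)
    have "norm (fcoeff u k - fcoeff \<phi> k) < e"
      using norm_fcoeff_le[OF L2_fields_diff[OF L L'] k] \<phi>(2)
      by (simp add: fcoeff_diff L2_fields_integrable L L')
    then show ?thesis using solenoidal_fields_coeff[OF \<phi>(1) k] by blast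
  qed
  have "cmod (kdot k (fcoeff u k)) \<le> e" if "e > 0" for e
  proof -
    have "e / (norm k + 1) > 0" using that by (simp add: add_nonneg_pos)
    then obtain y where y: "solenoidal_coeff k y" "norm (fcoeff u k - y) < e / (norm k + 1)"
      using approx by blast
    have "cmod (kdot k (fcoeff u k)) = cmod (kdot k (fcoeff u k - y))"
      using y by (simp add: kdot_diff solenoidal_coeff_def)
    also have "\<dots> \<le> norm k * norm (fcoeff u k - y)" by (rule norm_kdot_le)
    also have "\<dots> \<le> norm k * (e / (norm k + 1))" using y by (intro mult_left_mono) auto
    also have "\<dots> \<le> e"
    proof -
      have "norm k + 1 > 0" by (simp add: add_nonneg_pos)
      then show ?thesis using that by (simp add: field_simps)
    qed
    finally show ?thesis .
  qed
  then have "cmod (kdot k (fcoeff u k)) \<le> 0" by (intro field_le_epsilon[of _ 0]) (simp only: add_0)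
  moreover have "fcoeff u k = 0" if "k = 0"
  proof -
    have "norm (fcoeff u k) \<le> 0 + e" if "e > 0" for e
      using approx[OF that] \<open>k = 0\<close> by (auto simp: solenoidal_coeff_def)
    then have "norm (fcoeff u k) \<le> 0" by (rule field_le_epsilon)
    then show ?thesis by simp
  qed
  ultimately show "solenoidal_coeff k (fcoeff u k)" by (simp add: solenoidal_coeff_def)
next
  assume u: "u \<in> L2_fields \<and> (\<forall>k\<in>freq. solenoidal_coeff k (fcoeff u k))"
  have "\<exists>\<phi>\<in>solenoidal_fields. L2_norm (\<lambda>x. u x - \<phi> x) < e" if "e > 0" for e
  proof -
    have "eventually (\<lambda>n. L2_norm (\<lambda>x. u x - field_sum (freq_cube n) (fcoeff u) x) < e) sequentially"
      using u that by (intro order_tendstoD(2)[OF field_expansion]) auto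
    then obtain n where n: "L2_norm (\<lambda>x. u x - field_sum (freq_cube n) (fcoeff u) x) < e"
      using eventually_happens'[OF sequentially_bot] by blast
    have "field_sum (freq_cube n) (fcoeff u) \<in> solenoidal_fields"
      using u freq_cubeD by (intro field_sum_solenoidal) auto
    with n show ?thesis by blast
  qed
  then show "u \<in> H_space" using u by (simp add: H_space_def)
qed

lemma H_space_L2: "u \<in> H_space \<Longrightarrow> u \<in> L2_fields"
  by (simp add: H_space_iff)

lemma H_space_coeff: "u \<in> H_space \<Longrightarrow> k \<in> freq \<Longrightarrow> solenoidal_coeff k (fcoeff u k)"
  by (simp add: H_space_iff)

lemma wave_field_H:
  assumes "k \<in> freq" "solenoidal_coeff k z"
  shows "wave_field k z \<in> H_space"
proof -
  have "wave_field k z \<in> solenoidal_fields"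
    unfolding wave_field_eq_sum using assms by (intro field_sum_solenoidal) auto
  then show ?thesis
    unfolding H_space_iff using solenoidal_fields_coeff
    by (auto simp: solenoidal_fields_def intro: test_L2)
qed

lemma H_space_ex:
  assumes "(\<lambda>k. (norm (c k))\<^sup>2) summable_on freq"
    and "\<And>k. k \<in> freq \<Longrightarrow> c (- k) = vcnj (c k)"
    and "\<And>k. k \<in> freq \<Longrightarrow> solenoidal_coeff k (c k)"
  obtains u where "u \<in> H_space" "\<And>k. k \<in> freq \<Longrightarrow> fcoeff u k = c k"
proof -
  obtain u where u: "u \<in> L2_fields" "\<And>k. k \<in> freq \<Longrightarrow> fcoeff u k = c k"
    by (rule riesz_fischer_field[OF assms(1,2)]) auto
  then have "u \<in> H_space" using assms(3) by (simp add: H_space_iff)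
  with u(2) that show ?thesis by blast
qed

section \<open>The Stokes operator and its powers as Fourier multipliers\<close>

lemma fcoeff_wave_field:
  assumes "k \<in> freq" "k \<noteq> 0"
  shows "fcoeff (wave_field k z) k = (1/2) *s z"
proof -
  have ne: "k \<noteq> - k" using assms(2) by (simp add: vec_eq_iff)
  have eq: "complex_of_real (wave_field k z x $ j) = 1/2 * (z $ j * wave k x + cnj (z $ j) * wave (- k) x)" for x j
    by (simp add: wave_field_def complex_eq_iff flip: cnj_wave)
  have i: "integrable torus (\<lambda>x. a * wave m x)" for a m
    by (intro integrable_torus_continuous continuous_intros)
  show ?thesis
    unfolding fcoeff_def eq fourier_scale fourier_add[OF i i]
    unfolding vec_eq_iff using assms(1) ne by (simp add: fourier_wave)
qed

lemma sum_k_squares: "(\<Sum>i\<in>UNIV. deriv_symbol (k $ i) * deriv_symbol (k $ i))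
    = - complex_of_real (4 * pi\<^sup>2 * (norm (k::real^3))\<^sup>2)"
proof -
  have "deriv_symbol (k $ i) * deriv_symbol (k $ i) = complex_of_real (- (4 * pi\<^sup>2) * (k $ i)\<^sup>2)" for i
    by (simp add: complex_eq_iff power2_eq_square)
  then show ?thesis
    by (simp only: norm_power2_vec real_norm_def power2_abs sum_distrib_left of_real_sum[symmetric] of_real_minus[symmetric] sum_negf[symmetric] mult_minus_left)
qed

lemma laplacian_wave_field:
  "laplacian (wave_field k z) = wave_field k (- (4 * pi\<^sup>2 * (norm k)\<^sup>2) *\<^sub>R z)"
proof
  fix x
  have "laplacian (wave_field k z) x $ j = wave_field k (- (4 * pi\<^sup>2 * (norm k)\<^sup>2) *\<^sub>R z) x $ j" for j
  proof -
    have "laplacian (wave_field k z) x $ j = (\<Sum>i\<in>UNIV. Re (deriv_symbol (k $ i) * (deriv_symbol (k $ i) * z $ j) * wave k x))"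
      unfolding laplacian_def wave_field_eq_sum partial_field_sum by (simp add: field_sum_nth trig_sum_def algebra_simps)
    also have "\<dots> = Re ((\<Sum>i\<in>UNIV. deriv_symbol (k $ i) * deriv_symbol (k $ i)) * z $ j * wave k x)"
      unfolding sum_distrib_right Re_sum by (simp only: mult.assoc)
    finally show ?thesis
      unfolding sum_k_squares by (simp add: wave_field_def scaleR_conv_of_real[where 'a = complex])
  qed
  then show "laplacian (wave_field k z) x = wave_field k (- (4 * pi\<^sup>2 * (norm k)\<^sup>2) *\<^sub>R z) x"
    by (simp add: vec_eq_iff)
qed

lemma fcoeff_laplacian:
  assumes \<phi>: "\<phi> \<in> test_fields" and k: "k \<in> freq"
  shows "fcoeff (laplacian \<phi>) k = - (4 * pi\<^sup>2 * (norm k)\<^sup>2) *\<^sub>R fcoeff \<phi> k"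
proof -
  have "fcoeff (laplacian \<phi>) k = (\<Sum>i\<in>UNIV. fcoeff (partial i (partial i \<phi>)) k)"
    unfolding laplacian_def[abs_def] by (intro fcoeff_sum test_integrable partial_test \<phi>)
  also have "\<dots> = (\<Sum>i\<in>UNIV. (deriv_symbol (k $ i) * deriv_symbol (k $ i)) *s fcoeff \<phi> k)"
    by (simp add: fcoeff_partial partial_test \<phi> k vector_smult_assoc)
  also have "\<dots> = (\<Sum>i\<in>UNIV. deriv_symbol (k $ i) * deriv_symbol (k $ i)) *s fcoeff \<phi> k"
    by (simp only: vec_eq_iff vector_smult_component sum_component sum_distrib_right) simp
  finally show ?thesis unfolding sum_k_squares by (simp add: scaleR_vec_conv)
qed

lemma laplacian_integrable: "\<phi> \<in> test_fields \<Longrightarrow> integrable torus (laplacian \<phi>)"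
  unfolding laplacian_def[abs_def] by (intro Bochner_Integration.integrable_sum test_integrable partial_test)

lemma stokes_graph_coeff:
  assumes "stokes_graph u w" "k \<in> freq"
  shows "fcoeff w k = (4 * pi\<^sup>2 * (norm k)\<^sup>2) *\<^sub>R fcoeff u k"
proof -
  have i: "integrable torus u" "integrable torus w"
    using assms by (auto simp: stokes_graph_def intro: L2_fields_integrable H_space_L2)
  have "fcoeff w k \<bullet> z = ((4 * pi\<^sup>2 * (norm k)\<^sup>2) *\<^sub>R fcoeff u k) \<bullet> z" for z
  proof -
    have "L2_inner u (laplacian (wave_field k z)) = - L2_inner w (wave_field k z)"
      using assms wave_field_test unfolding stokes_graph_def by blast
    then show ?thesis by (simp add: laplacian_wave_field L2_inner_wave_field i)
  qed
  then show ?thesis by (metis vector_eq_rdot inner_commute)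
qed

text \<open>Provides enough eigenfields to read off every coefficient of a field in H by testing
  against eigenfields alone.\<close>

lemma stokes_eigen_wave_field:
  assumes k: "k \<in> freq" "k \<noteq> 0" and z: "solenoidal_coeff k z" "z \<noteq> 0"
  shows "stokes_eigen (4 * pi\<^sup>2 * (norm k)\<^sup>2) (wave_field k z)"
proof -
  let ?l = "4 * pi\<^sup>2 * (norm k)\<^sup>2"
  have sc: "(\<lambda>x. ?l *\<^sub>R wave_field k z x) = wave_field k (?l *\<^sub>R z)"
    by (simp add: fun_eq_iff wave_field_def vec_eq_iff algebra_simps)
  have "L2_inner (wave_field k z) (laplacian \<phi>) = - L2_inner (wave_field k (?l *\<^sub>R z)) \<phi>" if \<phi>: "\<phi> \<in> test_fields" for \<phi>
    unfolding L2_inner_commute[of "wave_field k _"]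
    by (simp add: L2_inner_wave_field laplacian_integrable test_integrable fcoeff_laplacian k \<phi>)
  moreover have "L2_norm (wave_field k z) \<noteq> 0"
  proof
    assume "L2_norm (wave_field k z) = 0"
    then have "norm (fcoeff (wave_field k z) k) \<le> 0"
      using norm_fcoeff_le[OF test_L2[OF wave_field_test[OF k(1)]] k(1)] by metis
    then show False using z(2) by (simp add: fcoeff_wave_field k vector_mul_eq_0)
  qed
  ultimately show ?thesis
    unfolding stokes_eigen_def stokes_graph_def sc
    using wave_field_H[OF k(1)] z(1) by (simp add: solenoidal_coeff_scaleR)
qed

text \<open>Forwards, the discrepancy \<open>?d\<close> of the coefficients is itself solenoidal,
  and testing with the eigenfield it defines gives \<open>?d \<bullet> ?d = 0\<close>. Backwards, an
  eigenfield to the eigenvalue l has coefficients only where the symbol of A equals l, so Parseval's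
  identity can be compared term by term.\<close>

lemma stokes_power_graph_iff:
  "stokes_power_graph \<beta> u w \<longleftrightarrow> u \<in> H_space \<and> w \<in> H_space \<and>
     (\<forall>k\<in>freq. fcoeff w k = stokes_symbol \<beta> k *\<^sub>R fcoeff u k)"
proof (intro iffI conjI ballI)
  assume g: "stokes_power_graph \<beta> u w"
  then show H: "u \<in> H_space" "w \<in> H_space" by (auto simp: stokes_power_graph_def)
  fix k assume k: "k \<in> freq"
  have i: "integrable torus u" "integrable torus w" using H by (auto intro: L2_fields_integrable H_space_L2)
  let ?d = "fcoeff w k - stokes_symbol \<beta> k *\<^sub>R fcoeff u k"
  have sd: "solenoidal_coeff k ?d"
    by (intro solenoidal_coeff_diff solenoidal_coeff_scaleR H_space_coeff H k)
  have "?d = 0"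
  proof (rule ccontr)
    assume d: "?d \<noteq> 0"
    then have "k \<noteq> 0" using sd by (auto simp: solenoidal_coeff_def)
    from stokes_eigen_wave_field[OF k this sd d] g
    have "L2_inner w (wave_field k ?d) = stokes_symbol \<beta> k * L2_inner u (wave_field k ?d)"
      unfolding stokes_power_graph_def stokes_symbol_def by blast
    then have "?d \<bullet> ?d = 0"
      unfolding L2_inner_wave_field[OF i(1)] L2_inner_wave_field[OF i(2)]
      by (simp only: inner_diff_left[of _ _ ?d] inner_scaleR_left diff_self)
    then show False using d by simp
  qed
  then show "fcoeff w k = stokes_symbol \<beta> k *\<^sub>R fcoeff u k" by simp
next
  assume *: "u \<in> H_space \<and> w \<in> H_space \<and> (\<forall>k\<in>freq. fcoeff w k = stokes_symbol \<beta> k *\<^sub>R fcoeff u k)"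
  have "L2_inner w e = l powr \<beta> * L2_inner u e" if e: "stokes_eigen l e" for l e
  proof -
    have L: "u \<in> L2_fields" "w \<in> L2_fields" "e \<in> L2_fields"
      using * e by (auto simp: H_space_L2 stokes_eigen_def stokes_graph_def)
    have "fcoeff w k \<bullet> fcoeff e k = l powr \<beta> * (fcoeff u k \<bullet> fcoeff e k)" if k: "k \<in> freq" for k
    proof (cases "fcoeff e k = 0")
      case False
      have "l *\<^sub>R fcoeff e k = (4 * pi\<^sup>2 * (norm k)\<^sup>2) *\<^sub>R fcoeff e k"
        using stokes_graph_coeff[of e _ k] e k unfolding stokes_eigen_def fcoeff_scale[symmetric] by blast
      then have "l = 4 * pi\<^sup>2 * (norm k)\<^sup>2" using False by (simp only: scaleR_cancel_right) simp
      then show ?thesis using * k by (simp add: stokes_symbol_def)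
    qed simp
    then have "(\<Sum>\<^sub>\<infinity>k\<in>freq. fcoeff w k \<bullet> fcoeff e k) = (\<Sum>\<^sub>\<infinity>k\<in>freq. l powr \<beta> * (fcoeff u k \<bullet> fcoeff e k))"
      by (intro infsum_cong)
    then show ?thesis
      by (simp add: L2_inner_eq_infsum L infsum_cmult_right')
  qed
  then show "stokes_power_graph \<beta> u w" using * by (simp add: stokes_power_graph_def)
qed

lemma stokes_symbol_nonneg [simp]: "stokes_symbol \<beta> k \<ge> 0"
  by (simp add: stokes_symbol_def)

lemma stokes_symbol_uminus [simp]: "stokes_symbol \<beta> (- k) = stokes_symbol \<beta> k"
  by (simp add: stokes_symbol_def)

lemma vcnj_scaleR: "vcnj (a *\<^sub>R z) = a *\<^sub>R vcnj z"
  by (simp add: vec_eq_iff)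

lemma stokes_dom_iff:
  "u \<in> stokes_dom \<beta> \<longleftrightarrow> u \<in> H_space \<and> (\<lambda>k. (stokes_symbol \<beta> k * norm (fcoeff u k))\<^sup>2) summable_on freq"
proof
  assume "u \<in> stokes_dom \<beta>"
  then obtain w where w: "u \<in> H_space" "w \<in> H_space" "\<forall>k\<in>freq. fcoeff w k = stokes_symbol \<beta> k *\<^sub>R fcoeff u k"
    by (auto simp: stokes_dom_def stokes_power_graph_iff)
  have "(\<lambda>k. (norm (fcoeff w k))\<^sup>2) summable_on freq" by (intro bessel_field H_space_L2 w)
  also have "?this \<longleftrightarrow> (\<lambda>k. (stokes_symbol \<beta> k * norm (fcoeff u k))\<^sup>2) summable_on freq"
    using w(3) by (intro summable_on_cong) simp
  finally show "u \<in> H_space \<and> (\<lambda>k. (stokes_symbol \<beta> k * norm (fcoeff u k))\<^sup>2) summable_on freq"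
    using w(1) by simp
next
  assume *: "u \<in> H_space \<and> (\<lambda>k. (stokes_symbol \<beta> k * norm (fcoeff u k))\<^sup>2) summable_on freq"
  then have u: "u \<in> H_space" by simp
  obtain w where "w \<in> H_space" "\<And>k. k \<in> freq \<Longrightarrow> fcoeff w k = stokes_symbol \<beta> k *\<^sub>R fcoeff u k"
  proof (rule H_space_ex[where c = "\<lambda>k. stokes_symbol \<beta> k *\<^sub>R fcoeff u k"])
    show "(\<lambda>k. (norm (stokes_symbol \<beta> k *\<^sub>R fcoeff u k))\<^sup>2) summable_on freq" using * by simp
    show "stokes_symbol \<beta> (- k) *\<^sub>R fcoeff u (- k) = vcnj (stokes_symbol \<beta> k *\<^sub>R fcoeff u k)" for k
      by (simp add: fcoeff_uminus vcnj_scaleR)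
    show "solenoidal_coeff k (stokes_symbol \<beta> k *\<^sub>R fcoeff u k)" if "k \<in> freq" for k
      by (intro solenoidal_coeff_scaleR H_space_coeff u that)
  qed auto
  then show "u \<in> stokes_dom \<beta>" using u by (auto simp: stokes_dom_def stokes_power_graph_iff)
qed

lemma stokes_norm_has_sum:
  assumes "u \<in> stokes_dom \<beta>"
  shows "((\<lambda>k. (stokes_symbol \<beta> k * norm (fcoeff u k))\<^sup>2) has_sum (stokes_norm \<beta> u)\<^sup>2) freq"
proof -
  have "\<exists>w. stokes_power_graph \<beta> u w" using assms by (simp add: stokes_dom_def)
  then have "stokes_power_graph \<beta> u (stokes_power \<beta> u)" unfolding stokes_power_def by (rule someI_ex)
  then have w: "stokes_power \<beta> u \<in> H_space" "\<forall>k\<in>freq. fcoeff (stokes_power \<beta> u) k = stokes_symbol \<beta> k *\<^sub>R fcoeff u k"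
    by (auto simp: stokes_power_graph_iff)
  have "((\<lambda>k. (norm (fcoeff (stokes_power \<beta> u) k))\<^sup>2) has_sum (stokes_norm \<beta> u)\<^sup>2) freq"
    unfolding stokes_norm_def by (intro parseval_norm H_space_L2 w)
  also have "?this \<longleftrightarrow> ?thesis" using w(2) by (intro has_sum_cong) simp
  finally show ?thesis .
qed

lemma stokes_norm_nonneg [simp]: "stokes_norm \<beta> u \<ge> 0"
  by (simp add: stokes_norm_def)

text \<open>Riesz-Fischer constructs one admissible projection, so the description is not empty.
  Whichever field it picks has the stated coefficients, because its discrepancy at k defines a wave
  field in H to which the remainder is orthogonal.\<close>

lemma leray_coeff:
  assumes f: "f \<in> L2_fields"
  shows "leray f \<in> H_space \<and> (\<forall>k\<in>freq. fcoeff (leray f) k = leray_symbol k (fcoeff f k))"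
proof -
  let ?P = "\<lambda>p. p \<in> H_space \<and> (\<forall>h\<in>H_space. L2_inner (\<lambda>x. f x - p x) h = 0)"
  obtain p where p: "p \<in> H_space" "\<And>k. k \<in> freq \<Longrightarrow> fcoeff p k = leray_symbol k (fcoeff f k)"
  proof (rule H_space_ex[where c = "\<lambda>k. leray_symbol k (fcoeff f k)"])
    show "(\<lambda>k. (norm (leray_symbol k (fcoeff f k)))\<^sup>2) summable_on freq"
      by (rule summable_on_comparison_test[OF bessel_field[OF f]])
         (auto intro!: power_mono norm_leray_symbol_le)
    show "leray_symbol (- k) (fcoeff f (- k)) = vcnj (leray_symbol k (fcoeff f k))" for k
      by (simp add: fcoeff_uminus leray_symbol_vcnj)
  qed (auto intro: solenoidal_leray_symbol)
  have "L2_inner (\<lambda>x. f x - p x) h = 0" if h: "h \<in> H_space" for h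
  proof -
    have "L2_inner (\<lambda>x. f x - p x) h = (\<Sum>\<^sub>\<infinity>k\<in>freq. fcoeff (\<lambda>x. f x - p x) k \<bullet> fcoeff h k)"
      by (intro L2_inner_eq_infsum L2_fields_diff f H_space_L2 p h)
    also have "\<dots> = (\<Sum>\<^sub>\<infinity>k\<in>freq. 0)"
    proof (rule infsum_cong)
      fix k assume k: "k \<in> freq"
      have "fcoeff (\<lambda>x. f x - p x) k = fcoeff f k - leray_symbol k (fcoeff f k)"
        using p k f by (simp add: fcoeff_diff L2_fields_integrable H_space_L2)
      then show "fcoeff (\<lambda>x. f x - p x) k \<bullet> fcoeff h k = 0"
        using leray_symbol_inner[OF H_space_coeff[OF h k]] by (simp add: inner_diff_left)
    qed
    finally show ?thesis by simp
  qed
  with p have "\<exists>p. ?P p" by blast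
  then have q: "?P (leray f)" unfolding leray_def by (rule someI_ex)
  have "fcoeff (leray f) k = leray_symbol k (fcoeff f k)" if k: "k \<in> freq" for k
  proof -
    let ?z = "leray_symbol k (fcoeff f k) - fcoeff (leray f) k"
    have z: "solenoidal_coeff k ?z"
      using q by (intro solenoidal_coeff_diff solenoidal_leray_symbol H_space_coeff k) auto
    have L: "leray f \<in> L2_fields" using q H_space_L2 by blast
    have i: "integrable torus (\<lambda>x. f x - leray f x)" by (intro L2_fields_integrable L2_fields_diff f L)
    have "L2_inner (\<lambda>x. f x - leray f x) (wave_field k ?z) = 0"
      using q wave_field_H[OF k z] by blast
    then have "(fcoeff f k - fcoeff (leray f) k) \<bullet> ?z = 0"
      unfolding L2_inner_wave_field[OF i] fcoeff_diff[OF L2_fields_integrable[OF f] L2_fields_integrable[OF L]] .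
    then have "?z \<bullet> ?z = 0"
      using leray_symbol_inner[OF z, of "fcoeff f k"] by (simp only: inner_diff_left[of _ _ ?z])
    then show ?thesis by simp
  qed
  with q show ?thesis by blast
qed

section \<open>Parseval's identity for a merely integrable field\<close>

lemma norm_wave_field_le: "norm (wave_field k z x) \<le> norm z"
proof -
  have "\<bar>Re (z $ j * wave k x)\<bar> \<le> cmod (z $ j)" for j
    using abs_Re_le_cmod[of "z $ j * wave k x"] by (simp add: norm_mult)
  then show ?thesis
    unfolding norm_vec_def wave_field_def by (intro L2_set_mono) auto
qed

lemma norm_inner_bounded_le:
  assumes "norm p \<le> M"
  shows "norm (g \<bullet> p) \<le> M * norm g"
proof -
  have "norm (g \<bullet> p) \<le> norm g * norm p" by (simp add: Cauchy_Schwarz_ineq2)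
  also have "\<dots> \<le> norm g * M" by (intro mult_left_mono assms) simp
  finally show ?thesis by (simp add: mult.commute)
qed

lemma L2_inner_field_sum:
  assumes "integrable torus g"
  shows "L2_inner g (field_sum F c) = (\<Sum>k\<in>F. fcoeff g k \<bullet> c k)"
proof -
  have i: "integrable torus (\<lambda>x. g x \<bullet> wave_field k z x)" for k z
  proof (rule Bochner_Integration.integrable_bound)
    show "integrable torus (\<lambda>x. norm z * norm (g x))" using assms by simp
    show "(\<lambda>x. g x \<bullet> wave_field k z x) \<in> borel_measurable torus"
      using assms by (intro borel_measurable_inner) (auto intro!: measurable_torusI borel_measurable_continuous_onI continuous_on_wave_field)
    show "AE x in torus. norm (g x \<bullet> wave_field k z x) \<le> norm (norm z * norm (g x))"
      by (simp add: abs_mult norm_inner_bounded_le[OF norm_wave_field_le, simplified])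
  qed
  have "L2_inner g (field_sum F c) = (\<Sum>k\<in>F. L2_inner g (wave_field k (c k)))"
    unfolding L2_inner_def field_sum_def inner_sum_right using i by (intro Bochner_Integration.integral_sum)
  then show ?thesis by (simp add: L2_inner_wave_field assms)
qed

text \<open>Summability of the coefficients of p bounds its partial sums uniformly by M, so the
  products with g are dominated by M |g| although g need not be square integrable.\<close>

lemma parseval_L1:
  assumes g: "integrable torus g" and p: "p \<in> L2_fields" and sp: "(\<lambda>k. norm (fcoeff p k)) summable_on freq"
  shows "((\<lambda>k. fcoeff g k \<bullet> fcoeff p k) has_sum L2_inner g p) freq"
proof -
  obtain r where r: "strict_mono r" "AE x in torus. (\<lambda>n. field_sum (freq_cube (r n)) (fcoeff p) x) \<longlonglongrightarrow> p x"
    by (rule field_expansion_AE[OF p])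
  define M where "M = (\<Sum>\<^sub>\<infinity>k\<in>freq. norm (fcoeff p k))"
  have bound: "norm (field_sum (freq_cube n) (fcoeff p) x) \<le> M" for n x
  proof -
    have "norm (field_sum (freq_cube n) (fcoeff p) x) \<le> (\<Sum>k\<in>freq_cube n. norm (fcoeff p k))"
      unfolding field_sum_def by (rule sum_norm_le) (rule norm_wave_field_le)
    also have "\<dots> \<le> M" unfolding M_def by (intro finite_sum_le_infsum sp) auto
    finally show ?thesis .
  qed
  have [measurable]: "g \<in> borel_measurable torus" "p \<in> borel_measurable torus" "field_sum F c \<in> borel_measurable torus" for F c
    using g p field_sum_L2[of F c] by (auto simp: L2_fields_def)
  have lim: "(\<lambda>n. L2_inner g (field_sum (freq_cube (r n)) (fcoeff p))) \<longlonglongrightarrow> L2_inner g p"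
    unfolding L2_inner_def
  proof (rule integral_dominated_convergence[where w = "\<lambda>x. M * norm (g x)"])
    show "integrable torus (\<lambda>x. M * norm (g x))" using g by simp
    show "AE x in torus. (\<lambda>n. g x \<bullet> field_sum (freq_cube (r n)) (fcoeff p) x) \<longlonglongrightarrow> g x \<bullet> p x"
      using r(2) by eventually_elim (intro tendsto_intros)
    show "AE x in torus. norm (g x \<bullet> field_sum (freq_cube (r n)) (fcoeff p) x) \<le> M * norm (g x)" for n
      by (intro AE_I2 norm_inner_bounded_le bound)
  qed measurable
  obtain C where C: "\<And>k. norm (fcoeff g k) \<le> C" using fcoeff_bounded[OF g] by blast
  have "(\<lambda>k. norm (fcoeff g k \<bullet> fcoeff p k)) summable_on freq"
  proof (rule Infinite_Sum.abs_summable_on_comparison_test')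
    show "(\<lambda>k. C * norm (fcoeff p k)) summable_on freq" by (intro summable_on_cmult_right sp)
    show "norm (fcoeff g k \<bullet> fcoeff p k) \<le> C * norm (fcoeff p k)" for k
      using Cauchy_Schwarz_ineq2[of "fcoeff g k" "fcoeff p k"] mult_right_mono[OF C[of k] norm_ge_zero[of "fcoeff p k"]] by simp
  qed
  then have sm: "(\<lambda>k. fcoeff g k \<bullet> fcoeff p k) summable_on freq" by (rule abs_summable_summable)
  have "(\<lambda>n. \<Sum>k\<in>freq_cube (r n). fcoeff g k \<bullet> fcoeff p k) \<longlonglongrightarrow> (\<Sum>\<^sub>\<infinity>k\<in>freq. fcoeff g k \<bullet> fcoeff p k)"
    using LIMSEQ_subseq_LIMSEQ[OF infsum_freq_cube[OF sm] r(1)] by (simp add: o_def)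
  with lim have "L2_inner g p = (\<Sum>\<^sub>\<infinity>k\<in>freq. fcoeff g k \<bullet> fcoeff p k)"
    unfolding L2_inner_field_sum[OF g] by (rule LIMSEQ_unique)
  then show ?thesis using has_sum_infsum[OF sm] by simp
qed

section \<open>Lattice sums\<close>

lemma norm_freq_ge_1: "k \<in> freq \<Longrightarrow> k \<noteq> 0 \<Longrightarrow> 1 \<le> norm k"
proof -
  assume k: "k \<in> freq" "k \<noteq> 0"
  then obtain i where "k $ i \<noteq> 0" by (auto simp: vec_eq_iff)
  then have "1 \<le> \<bar>k $ i\<bar>" using k(1) Ints_nonzero_abs_ge1 unfolding freq_def by blast
  also have "\<dots> \<le> norm k" by (rule component_le_norm_cart)
  finally show ?thesis .
qed

lemma sum_symmetric_interval:
  "(\<Sum>n\<in>{- int N..int N}. h \<bar>n\<bar>) = h 0 + 2 * (\<Sum>n<N. (h (int (Suc n)) :: real))"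
proof (induction N)
  case (Suc N)
  have "{- int (Suc N)..int (Suc N)} = insert (- int (Suc N)) (insert (int (Suc N)) {- int N..int N})"
    by auto
  then show ?case using Suc by (simp add: add.commute)
qed simp

text \<open>Comparison with the integral of x^(-\<tau>), carried out by the mean value theorem on
  each unit interval so that the right-hand sides telescope.\<close>

lemma sum_powr_le:
  assumes "0 \<le> \<tau>" "\<tau> < 1"
  shows "(\<Sum>n<N. real (Suc n) powr (- \<tau>)) \<le> real N powr (1 - \<tau>) / (1 - \<tau>)"
proof (induction N)
  case (Suc N)
  have "(1 - \<tau>) * real (Suc N) powr (- \<tau>) \<le> real (Suc N) powr (1 - \<tau>) - real N powr (1 - \<tau>)"
  proof (cases "N = 0")
    case False
    have "\<exists>z>real N. z < real (Suc N) \<and> real (Suc N) powr (1 - \<tau>) - real N powr (1 - \<tau>) = (real (Suc N) - real N) * ((1 - \<tau>) * z powr (1 - \<tau> - 1))"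
      using False by (intro MVT2 has_real_derivative_powr) auto
    then obtain z where z: "real N < z" "z < real (Suc N)"
      "real (Suc N) powr (1 - \<tau>) - real N powr (1 - \<tau>) = (1 - \<tau>) * z powr (- \<tau>)" by auto
    have "real (Suc N) powr (- \<tau>) \<le> z powr (- \<tau>)"
      using z assms by (intro powr_mono2') auto
    then show ?thesis unfolding z(3) using assms by (intro mult_left_mono) auto
  qed (use assms in auto)
  then have "real (Suc N) powr (- \<tau>) \<le> (real (Suc N) powr (1 - \<tau>) - real N powr (1 - \<tau>)) / (1 - \<tau>)"
    using assms by (simp add: field_simps)
  then show ?case using Suc by (simp add: diff_divide_distrib)
qed simp

lemma powr_squared: "(x powr a)\<^sup>2 = x powr (2 * a)" for x :: real
  by (simp add: power2_eq_square flip: powr_add)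

lemma powr_cubed: "(x powr a) ^ 3 = x powr (3 * a)" for x :: real
  by (simp add: power3_eq_cube flip: powr_add)

text \<open>The maximum with 1 gives a vanishing coordinate the weight 1; the power of 0 would be 0
  and would not bound anything from above.\<close>

definition axis_weight :: "real \<Rightarrow> int \<Rightarrow> real" where
  "axis_weight \<tau> n = real_of_int (max 1 \<bar>n\<bar>) powr (- \<tau>)"

lemma sum_axis_weight:
  "(\<Sum>n\<in>{- int N..int N}. axis_weight \<tau> n) = 1 + 2 * (\<Sum>n<N. real (Suc n) powr (- \<tau>))"
  using sum_symmetric_interval[of "\<lambda>n. real_of_int (max 1 n) powr (- \<tau>)" N]
  by (simp add: axis_weight_def)

text \<open>Each of the three factors |k|^(-t/3) is estimated by one coordinate: |k| \<ge> max 1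
  |k_i| for a nonzero integer point.\<close>

lemma norm_powr_le_prod:
  assumes k: "k = (\<chi> i. real_of_int (h i))" "k \<noteq> 0" and t: "0 \<le> t"
  shows "norm (k::real^3) powr (- t) \<le> (\<Prod>i\<in>UNIV. axis_weight (t / 3) (h i))"
proof -
  have kf: "k \<in> freq" using k by (simp add: freq_def)
  have "norm k powr (- t) = (\<Prod>i\<in>(UNIV::3 set). norm k powr (- (t / 3)))"
    by (simp add: powr_cubed)
  also have "\<dots> \<le> (\<Prod>i\<in>UNIV. axis_weight (t / 3) (h i))"
  proof (intro prod_mono conjI)
    fix i :: 3
    have "real_of_int \<bar>h i\<bar> \<le> norm k" using component_le_norm_cart[of k i] k(1) by simp
    then have "real_of_int (max 1 \<bar>h i\<bar>) \<le> norm k" using norm_freq_ge_1[OF kf k(2)] by simp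
    then show "norm k powr (- (t / 3)) \<le> axis_weight (t / 3) (h i)"
      unfolding axis_weight_def using t by (intro powr_mono2') auto
  qed simp
  finally show ?thesis .
qed

text \<open>A power of the norm is dominated by a product over the coordinates, which reduces the
  lattice sums to one-dimensional ones.\<close>

lemma sum_norm_powr_cube:
  assumes t: "0 \<le> t" and F: "F \<subseteq> freq_cube N" "0 \<notin> F"
  shows "(\<Sum>k\<in>F. norm k powr (- t)) \<le> (\<Sum>n\<in>{- int N..int N}. axis_weight (t / 3) n) ^ 3"
proof -
  let ?H = "PiE (UNIV::3 set) (\<lambda>_. {- int N..int N})"
  let ?v = "\<lambda>h. (\<chi> i. real_of_int (h i)) :: real^3"
  have inj: "inj_on ?v ?H" by (auto simp: inj_on_def vec_eq_iff fun_eq_iff)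
  have finH: "finite ?H" by (intro finite_PiE) auto
  define G where "G = {h \<in> ?H. ?v h \<in> F}"
  have FG: "F = ?v ` G" using F unfolding freq_cube_eq G_def by auto
  have "(\<Sum>k\<in>F. norm k powr (- t)) = (\<Sum>h\<in>G. norm (?v h) powr (- t))"
    unfolding FG using inj by (subst sum.reindex) (auto intro: inj_on_subset simp: G_def)
  also have "\<dots> \<le> (\<Sum>h\<in>G. \<Prod>i\<in>UNIV. axis_weight (t / 3) (h i))"
  proof (rule sum_mono)
    fix h assume "h \<in> G"
    then have "?v h \<noteq> 0" using F by (auto simp: G_def)
    then show "norm (?v h) powr (- t) \<le> (\<Prod>i\<in>UNIV. axis_weight (t / 3) (h i))"
      by (intro norm_powr_le_prod t) auto
  qed
  also have "\<dots> \<le> (\<Sum>h\<in>?H. \<Prod>i\<in>UNIV. axis_weight (t / 3) (h i))"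
    using finH by (intro sum_mono2) (auto simp: G_def axis_weight_def intro!: prod_nonneg)
  also have "\<dots> = (\<Prod>i\<in>(UNIV::3 set). \<Sum>n\<in>{- int N..int N}. axis_weight (t / 3) n)"
    by (rule prod_sum_PiE[symmetric]) auto
  finally show ?thesis by simp
qed

text \<open>Each coordinate contributes a sum with exponent t/3 > 1, which converges.\<close>

lemma lattice_sum_bounded:
  assumes t: "3 < t"
  shows "\<exists>C. \<forall>F. finite F \<and> F \<subseteq> freq - {0} \<longrightarrow> (\<Sum>k\<in>F. norm k powr (- t)) \<le> C"
proof (intro exI allI impI)
  fix F :: "(real^3) set" assume F: "finite F \<and> F \<subseteq> freq - {0}"
  let ?S = "\<Sum>n. real (Suc n) powr (- (t / 3))"
  have "summable (\<lambda>n. real n powr (- (t / 3)))" using t by (simp add: summable_real_powr_iff)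
  then have s: "summable (\<lambda>n. real (Suc n) powr (- (t / 3)))" by (subst summable_Suc_iff)
  obtain N where "F \<subseteq> freq_cube N" using F finite_subset_freq_cube[of F] by (meson Diff_subset order_refl order_trans)
  then have "(\<Sum>k\<in>F. norm k powr (- t)) \<le> (\<Sum>n\<in>{- int N..int N}. axis_weight (t / 3) n) ^ 3"
    using F t by (intro sum_norm_powr_cube) auto
  also have "\<dots> \<le> (1 + 2 * ?S) ^ 3"
    unfolding sum_axis_weight using sum_le_suminf[OF s, of "{..<N}"]
    by (intro power_mono) (auto intro!: add_nonneg_nonneg sum_nonneg)
  finally show "(\<Sum>k\<in>F. norm k powr (- t)) \<le> (1 + 2 * ?S) ^ 3" .
qed

lemma freq_ball_subset_cube:
  assumes "F \<subseteq> freq" "\<And>k. k \<in> F \<Longrightarrow> norm k \<le> R" "R \<le> real N"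
  shows "F \<subseteq> freq_cube N"
proof
  fix k assume k: "k \<in> F"
  have "\<bar>k $ i\<bar> \<le> real N" for i
    using component_le_norm_cart[of k i] assms(2)[OF k] assms(3) by linarith
  then show "k \<in> freq_cube N" using assms(1) k by (auto simp: freq_cube_def)
qed

text \<open>The growth exponent e is separate from s, so that the growing sums (s < 3, e = 3 - s),
  the convergent ones (s > 3) and the borderline s = 3 with some e > 0 fit the same
  hypothesis.\<close>

definition lattice_bound :: "real \<Rightarrow> real \<Rightarrow> bool" where
  "lattice_bound s e \<longleftrightarrow> (\<exists>C\<ge>0. \<forall>R\<ge>1. \<forall>F. finite F \<and> F \<subseteq> freq - {0} \<and> (\<forall>k\<in>F. norm k \<le> R) \<longrightarrow>
    (\<Sum>k\<in>F. norm k powr (- s)) \<le> C * R powr e)"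

lemma lattice_boundI:
  assumes "0 \<le> C" "\<And>R F. 1 \<le> R \<Longrightarrow> finite F \<Longrightarrow> F \<subseteq> freq - {0} \<Longrightarrow> \<forall>k\<in>F. norm k \<le> R \<Longrightarrow>
    (\<Sum>k\<in>F. norm k powr (- s)) \<le> C * R powr e"
  shows "lattice_bound s e"
  unfolding lattice_bound_def using assms by (intro exI[of _ C]) simp

lemma lattice_boundE:
  assumes "lattice_bound s e"
  obtains C where "0 \<le> C" "\<And>R F. 1 \<le> R \<Longrightarrow> finite F \<Longrightarrow> F \<subseteq> freq - {0} \<Longrightarrow> \<forall>k\<in>F. norm k \<le> R \<Longrightarrow>
    (\<Sum>k\<in>F. norm k powr (- s)) \<le> C * R powr e"
  using assms unfolding lattice_bound_def by (elim exE conjE) simp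

lemma lattice_bound_nonneg:
  assumes t: "0 \<le> t" "t < 3"
  shows "lattice_bound t (3 - t)"
proof -
  let ?\<tau> = "t / 3"
  \<comment> \<open>The summand 1 comes from the zero coordinate and is absorbed by N^(1 - \<tau>)
    \<ge> 1; the fraction is twice the constant of \<open>sum_powr_le\<close>, for the two
    signs.\<close>
  let ?c = "1 + 2 / (1 - ?\<tau>)"
  have c: "?c \<ge> 0" using t by simp
  show ?thesis
  proof (rule lattice_boundI)
    show "0 \<le> ?c ^ 3 * 2 powr (3 - t)" using c by simp
    fix R :: real and F :: "(real^3) set" assume R: "1 \<le> R" and F: "finite F" "F \<subseteq> freq - {0}" "\<forall>k\<in>F. norm k \<le> R"
    define N where "N = nat \<lceil>R\<rceil>"
    \<comment> \<open>Rounding R up to an integer at most doubles it, since R \<ge> 1; this is the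
      factor 2^(3-t) in the constant.\<close>
    have N: "R \<le> real N" "real N \<le> 2 * R" "1 \<le> real N"
      using R by (auto simp: N_def) linarith+
    have "F \<subseteq> freq_cube N" using F N by (intro freq_ball_subset_cube[of F R]) auto
    then have "(\<Sum>k\<in>F. norm k powr (- t)) \<le> (\<Sum>n\<in>{- int N..int N}. axis_weight ?\<tau> n) ^ 3"
      using F t by (intro sum_norm_powr_cube) auto
    also have "\<dots> \<le> (?c * real N powr (1 - ?\<tau>)) ^ 3"
    proof (rule power_mono)
      have "1 \<le> real N powr (1 - ?\<tau>)" using N t by (intro ge_one_powr_ge_zero) auto
      then show "(\<Sum>n\<in>{- int N..int N}. axis_weight ?\<tau> n) \<le> ?c * real N powr (1 - ?\<tau>)"
        using sum_powr_le[of ?\<tau> N] t unfolding sum_axis_weight by (simp add: algebra_simps)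
      show "0 \<le> (\<Sum>n\<in>{- int N..int N}. axis_weight ?\<tau> n)" by (intro sum_nonneg) (simp add: axis_weight_def)
    qed
    also have "\<dots> = ?c ^ 3 * real N powr (3 - t)"
      by (simp add: power_mult_distrib powr_cubed right_diff_distrib)
    also have "\<dots> \<le> ?c ^ 3 * (2 * R) powr (3 - t)"
      using N t c by (intro mult_left_mono powr_mono2) auto
    also have "\<dots> = (?c ^ 3 * 2 powr (3 - t)) * R powr (3 - t)" using R by (simp add: powr_mult)
    finally show "(\<Sum>k\<in>F. norm k powr (- t)) \<le> (?c ^ 3 * 2 powr (3 - t)) * R powr (3 - t)" .
  qed
qed

text \<open>For negative t the summand is largest at the boundary, so counting the points (the case
  of exponent 0) and multiplying by R^(-t) suffices.\<close>

lemma lattice_bound_lt_3: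
  assumes "t < 3"
  shows "lattice_bound t (3 - t)"
proof (cases "0 \<le> t")
  case False
  obtain C where C: "0 \<le> C" "\<And>R F. 1 \<le> R \<Longrightarrow> finite F \<Longrightarrow> F \<subseteq> freq - {0} \<Longrightarrow> \<forall>k\<in>F. norm k \<le> R \<Longrightarrow>
    (\<Sum>k\<in>F. norm k powr (- 0)) \<le> C * R powr (3 - 0)"
    by (rule lattice_boundE[OF lattice_bound_nonneg[of 0]]; (simp | rule that; (assumption | blast)))
  show ?thesis
  proof (rule lattice_boundI[OF C(1)])
    fix R :: real and F :: "(real^3) set" assume R: "1 \<le> R" and F: "finite F" "F \<subseteq> freq - {0}" "\<forall>k\<in>F. norm k \<le> R"
    have "(\<Sum>k\<in>F. norm k powr (- t)) \<le> (\<Sum>k\<in>F. norm k powr (- 0) * R powr (- t))"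
    proof (rule sum_mono)
      fix k assume "k \<in> F"
      then have "1 \<le> norm k" "norm k \<le> R" using F by (auto intro: norm_freq_ge_1)
      then show "norm k powr (- t) \<le> norm k powr (- 0) * R powr (- t)"
        using False by (auto intro!: powr_mono2)
    qed
    also have "\<dots> = (\<Sum>k\<in>F. norm k powr (- 0)) * R powr (- t)" by (simp only: sum_distrib_right)
    also have "\<dots> \<le> C * R powr (3 - 0) * R powr (- t)" by (intro mult_right_mono C(2) R F) auto
    also have "\<dots> = C * R powr (3 - t)" by (simp only: mult.assoc powr_add[symmetric]) simp
    finally show "(\<Sum>k\<in>F. norm k powr (- t)) \<le> C * R powr (3 - t)" .
  qed
qed (use lattice_bound_nonneg assms in blast)

text \<open>Both exponents may be relaxed because |k| \<ge> 1 and R \<ge> 1. Choosing t slightly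
  below 3 covers s = 3, where the logarithm is paid for by a positive e.\<close>

lemma lattice_bound_mono:
  assumes "t < 3" "t \<le> s" "3 - t \<le> e"
  shows "lattice_bound s e"
proof -
  obtain C where C: "0 \<le> C" "\<And>R F. 1 \<le> R \<Longrightarrow> finite F \<Longrightarrow> F \<subseteq> freq - {0} \<Longrightarrow> \<forall>k\<in>F. norm k \<le> R \<Longrightarrow>
    (\<Sum>k\<in>F. norm k powr (- t)) \<le> C * R powr (3 - t)"
    by (rule lattice_boundE[OF lattice_bound_lt_3[OF assms(1)]]) (rule that; (assumption | blast))
  show ?thesis
  proof (rule lattice_boundI[OF C(1)])
    fix R :: real and F :: "(real^3) set" assume R: "1 \<le> R" and F: "finite F" "F \<subseteq> freq - {0}" "\<forall>k\<in>F. norm k \<le> R"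
    have "(\<Sum>k\<in>F. norm k powr (- s)) \<le> (\<Sum>k\<in>F. norm k powr (- t))"
      using F(2) assms norm_freq_ge_1 by (intro sum_mono powr_mono) auto
    also have "\<dots> \<le> C * R powr (3 - t)" by (rule C(2)[OF R F])
    also have "\<dots> \<le> C * R powr e" using R assms C(1) by (intro mult_left_mono powr_mono) auto
    finally show "(\<Sum>k\<in>F. norm k powr (- s)) \<le> C * R powr e" .
  qed
qed

lemma lattice_bound_gt_3:
  assumes "3 < s" "0 \<le> e"
  shows "lattice_bound s e"
proof -
  obtain C where C: "\<forall>F. finite F \<and> F \<subseteq> freq - {0} \<longrightarrow> (\<Sum>k\<in>F. norm k powr (- s)) \<le> C"
    using lattice_sum_bounded[OF assms(1)] by (elim exE)
  have C0: "C \<ge> 0" using C[rule_format, of "{}"] by simp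
  then show ?thesis
  proof (rule lattice_boundI)
    fix R :: real and F :: "(real^3) set" assume R: "1 \<le> R" and F: "finite F" "F \<subseteq> freq - {0}"
    have "(\<Sum>k\<in>F. norm k powr (- s)) \<le> C * 1" using C F by simp
    also have "\<dots> \<le> C * R powr e" using C0 R assms by (intro mult_left_mono ge_one_powr_ge_zero) auto
    finally show "(\<Sum>k\<in>F. norm k powr (- s)) \<le> C * R powr e" .
  qed
qed

text \<open>The bound A is for the square of the norm. Quantifying over finite partial sums includes
  square summability in the statement and makes rearrangements finite.\<close>

definition l2_bound :: "(real^3 \<Rightarrow> real) \<Rightarrow> real \<Rightarrow> bool" where
  "l2_bound a A \<longleftrightarrow> (\<forall>F. finite F \<and> F \<subseteq> freq \<longrightarrow> (\<Sum>k\<in>F. (a k)\<^sup>2) \<le> A)"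

lemma l2_boundI:
  "(\<And>F. finite F \<Longrightarrow> F \<subseteq> freq \<Longrightarrow> (\<Sum>k\<in>F. (a k)\<^sup>2) \<le> A) \<Longrightarrow> l2_bound a A"
  by (simp add: l2_bound_def)

lemma l2_boundD: "l2_bound a A \<Longrightarrow> finite F \<Longrightarrow> F \<subseteq> freq \<Longrightarrow> (\<Sum>k\<in>F. (a k)\<^sup>2) \<le> A"
  by (simp add: l2_bound_def)

lemma l2_bound_nonneg: "l2_bound a A \<Longrightarrow> 0 \<le> A"
  using l2_boundD[of a A "{}"] by simp

lemma l2_bound_mono:
  assumes "l2_bound b B" "\<And>k. k \<in> freq \<Longrightarrow> \<bar>a k\<bar> \<le> \<bar>b k\<bar>" "B \<le> A"
  shows "l2_bound a A"
proof (rule l2_boundI)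
  fix F :: "(real^3) set" assume F: "finite F" "F \<subseteq> freq"
  have "(\<Sum>k\<in>F. (a k)\<^sup>2) \<le> (\<Sum>k\<in>F. (b k)\<^sup>2)"
    using F assms(2) by (intro sum_mono) (auto simp: abs_le_square_iff[symmetric])
  also have "\<dots> \<le> A" using l2_boundD[OF assms(1) F] assms(3) by linarith
  finally show "(\<Sum>k\<in>F. (a k)\<^sup>2) \<le> A" .
qed

lemma l2_bound_add:
  assumes "l2_bound a A" "l2_bound b B"
  shows "l2_bound (\<lambda>k. a k + b k) (2 * A + 2 * B)"
proof (rule l2_boundI)
  fix F :: "(real^3) set" assume F: "finite F" "F \<subseteq> freq"
  have sq: "(x + y)\<^sup>2 \<le> 2 * x\<^sup>2 + 2 * y\<^sup>2" for x y :: real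
    using sum_squares_bound[of x y] by (simp add: power2_sum)
  have "(\<Sum>k\<in>F. (a k + b k)\<^sup>2) \<le> 2 * (\<Sum>k\<in>F. (a k)\<^sup>2) + 2 * (\<Sum>k\<in>F. (b k)\<^sup>2)"
    unfolding sum_distrib_left sum.distrib[symmetric] by (intro sum_mono sq)
  also have "\<dots> \<le> 2 * A + 2 * B"
    by (intro add_mono mult_left_mono l2_boundD[OF assms(1) F] l2_boundD[OF assms(2) F]) auto
  finally show "(\<Sum>k\<in>F. (a k + b k)\<^sup>2) \<le> 2 * A + 2 * B" .
qed

text \<open>The kernel m with \<sigma> = 2s, g = 2\<gamma> and k = p + q. It vanishes on the modes p
  = 0, q = 0 and k = 0, which are absent for fields of zero mean and a projected output.\<close>

definition B_multiplier :: "real \<Rightarrow> real \<Rightarrow> real^3 \<Rightarrow> real^3 \<Rightarrow> real" where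
  "B_multiplier \<sigma> g p q =
     (if p = 0 \<or> q = 0 \<or> p + q = 0 then 0
      else norm p powr (- \<sigma>) * norm q powr (- \<sigma>) * norm (p + q) powr g * min (norm q) (norm (p + q)))"

lemma B_multiplier_nonneg [simp]: "B_multiplier \<sigma> g p q \<ge> 0"
  by (simp add: B_multiplier_def)

lemma powr_comparable:
  fixes x y g :: real
  assumes "0 < x" "0 < y" "x \<le> 2 * y" "y \<le> 2 * x"
  shows "x powr g \<le> 2 powr \<bar>g\<bar> * y powr g"
proof (cases "0 \<le> g")
  case True
  then have "x powr g \<le> (2 * y) powr g" using assms by (intro powr_mono2) auto
  then show ?thesis using True assms by (simp add: powr_mult)
next
  case False
  then have "x powr g \<le> (y / 2) powr g" using assms by (intro powr_mono2') auto
  also have "\<dots> = 2 powr (- g) * y powr g" using assms by (simp add: powr_divide powr_minus field_simps)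
  finally show ?thesis using False by simp
qed

text \<open>From r \<le> x and y \<le> r + x follows y \<le> 2x, so the factor in x can be traded
  for one in y at the cost of 2^\<sigma>.\<close>

lemma low_output_term_le:
  fixes x y r \<sigma> g :: real
  assumes pqr: "0 < x" "0 < y" "0 < r" "y \<le> r + x" "0 < \<sigma>" "r \<le> x"
  shows "x powr (- \<sigma>) * y powr (- \<sigma>) * r powr g * r \<le> 2 powr \<sigma> * y powr (- (2 * \<sigma>)) * r powr (g + 1)"
proof -
  have "x powr (- \<sigma>) \<le> (y / 2) powr (- \<sigma>)" using pqr by (intro powr_mono2') auto
  also have "\<dots> = 2 powr \<sigma> * y powr (- \<sigma>)" using pqr by (simp add: powr_divide powr_minus field_simps)
  finally have "x powr (- \<sigma>) * y powr (- \<sigma>) \<le> 2 powr \<sigma> * y powr (- \<sigma>) * y powr (- \<sigma>)"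
    by (intro mult_right_mono) auto
  also have "\<dots> = 2 powr \<sigma> * y powr (- (2 * \<sigma>))" by (simp add: mult.assoc flip: powr_add)
  finally have "x powr (- \<sigma>) * y powr (- \<sigma>) * (r powr g * r) \<le> 2 powr \<sigma> * y powr (- (2 * \<sigma>)) * (r powr g * r)"
    using pqr by (intro mult_right_mono) auto
  then show ?thesis using pqr by (simp add: powr_add mult.assoc)
qed

text \<open>In the variable k = x + y the square sum is |y|^(-4\<sigma>) times the sum of |k|^(2g+2)
  over |k| \<le> |y|. The condition -5/2 < g makes the latter grow like |y|^(2g+5), and 5 + 2g \<le>
  4\<sigma> says that the product is bounded.\<close>

lemma l2_bound_small_output:
  assumes H3: "5 + 2 * g \<le> 4 * \<sigma>" "- 5 / 2 < g"
  shows "\<exists>C. \<forall>y\<in>freq - {0}. l2_bound (\<lambda>x. if x + y \<noteq> 0 \<and> norm (x + y) \<le> norm y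
    then 2 powr \<sigma> * norm y powr (- (2 * \<sigma>)) * norm (x + y) powr (g + 1) else 0) C"
proof -
  let ?t = "- (2 * g + 2)"
  have t: "?t < 3" using H3 by simp
  obtain C where C: "0 \<le> C" "\<And>R F. 1 \<le> R \<Longrightarrow> finite F \<Longrightarrow> F \<subseteq> freq - {0} \<Longrightarrow> \<forall>k\<in>F. norm k \<le> R \<Longrightarrow>
    (\<Sum>k\<in>F. norm k powr (- ?t)) \<le> C * R powr (3 - ?t)"
    by (rule lattice_boundE[OF lattice_bound_lt_3[OF t]]) (rule that; (assumption | blast))
  have "l2_bound (\<lambda>x. if x + y \<noteq> 0 \<and> norm (x + y) \<le> norm y
    then 2 powr \<sigma> * norm y powr (- (2 * \<sigma>)) * norm (x + y) powr (g + 1) else 0) (2 powr (2 * \<sigma>) * C)"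
    (is "l2_bound ?f _") if y: "y \<in> freq - {0}" for y
  proof (rule l2_boundI)
    fix F :: "(real^3) set" assume F: "finite F" "F \<subseteq> freq"
    have y1: "1 \<le> norm y" using y norm_freq_ge_1 by auto
    define G where "G = {x \<in> F. x + y \<noteq> 0 \<and> norm (x + y) \<le> norm y}"
    have "(\<Sum>x\<in>F. (?f x)\<^sup>2) = (\<Sum>x\<in>G. (?f x)\<^sup>2)"
      using F(1) by (intro sum.mono_neutral_right) (auto simp: G_def)
    also have "\<dots> = 2 powr (2 * \<sigma>) * norm y powr (- (4 * \<sigma>)) * (\<Sum>x\<in>G. norm (x + y) powr (- ?t))"
      unfolding sum_distrib_left
      by (intro sum.cong refl) (simp add: G_def power_mult_distrib powr_squared ring_distribs add.commute)
    also have "(\<Sum>x\<in>G. norm (x + y) powr (- ?t)) = (\<Sum>k\<in>(\<lambda>x. x + y) ` G. norm k powr (- ?t))"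
      by (subst sum.reindex) (auto simp: inj_on_def)
    also have "2 powr (2 * \<sigma>) * norm y powr (- (4 * \<sigma>)) * \<dots>
       \<le> 2 powr (2 * \<sigma>) * norm y powr (- (4 * \<sigma>)) * (C * norm y powr (3 - ?t))"
      using y F y1 by (intro mult_left_mono C(2)) (auto simp: G_def intro!: freq_add)
    also have "\<dots> = 2 powr (2 * \<sigma>) * C * (norm y powr (- (4 * \<sigma>)) * norm y powr (3 - ?t))"
      by (simp only: mult_ac)
    also have "\<dots> = 2 powr (2 * \<sigma>) * C * norm y powr (5 + 2 * g - 4 * \<sigma>)"
      by (simp add: powr_add[symmetric])
    also have "\<dots> \<le> 2 powr (2 * \<sigma>) * C * norm y powr 0"
      using C(1) y1 H3 by (intro mult_left_mono powr_mono) auto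
    finally show "(\<Sum>x\<in>F. (?f x)\<^sup>2) \<le> 2 powr (2 * \<sigma>) * C" using y by simp
  qed
  then show ?thesis by blast
qed

text \<open>The hypothesis is used at radius R = |y|, where the growth |y|^(2b) cancels the squared
  weight |y|^(-2b).\<close>

lemma l2_bound_comparable_output:
  assumes H: "lattice_bound (2 * a) (2 * b)"
  shows "\<exists>C. \<forall>y\<in>freq - {0}. l2_bound (\<lambda>x. if x \<noteq> 0 \<and> norm x \<le> norm y
    then D * norm x powr (- a) * norm y powr (- b) else 0) C"
proof -
  obtain C where C: "0 \<le> C" "\<And>R F. 1 \<le> R \<Longrightarrow> finite F \<Longrightarrow> F \<subseteq> freq - {0} \<Longrightarrow> \<forall>k\<in>F. norm k \<le> R \<Longrightarrow>
    (\<Sum>k\<in>F. norm k powr (- (2 * a))) \<le> C * R powr (2 * b)"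
    by (rule lattice_boundE[OF H]) (rule that; (assumption | blast))
  have "l2_bound (\<lambda>x. if x \<noteq> 0 \<and> norm x \<le> norm y then D * norm x powr (- a) * norm y powr (- b) else 0) (D\<^sup>2 * C)"
    (is "l2_bound ?f _") if y: "y \<in> freq - {0}" for y
  proof (rule l2_boundI)
    fix F :: "(real^3) set" assume F: "finite F" "F \<subseteq> freq"
    have y1: "1 \<le> norm y" using y norm_freq_ge_1 by auto
    define G where "G = {x \<in> F. x \<noteq> 0 \<and> norm x \<le> norm y}"
    have "(\<Sum>x\<in>F. (?f x)\<^sup>2) = (\<Sum>x\<in>G. (?f x)\<^sup>2)"
      using F(1) by (intro sum.mono_neutral_right) (auto simp: G_def)
    also have "\<dots> = D\<^sup>2 * norm y powr (- (2 * b)) * (\<Sum>x\<in>G. norm x powr (- (2 * a)))"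
      unfolding sum_distrib_left
      by (intro sum.cong refl) (simp add: G_def power_mult_distrib powr_squared)
    also have "\<dots> \<le> D\<^sup>2 * norm y powr (- (2 * b)) * (C * norm y powr (2 * b))"
      using F y1 by (intro mult_left_mono C(2)) (auto simp: G_def)
    also have "\<dots> = D\<^sup>2 * C * (norm y powr (- (2 * b)) * norm y powr (2 * b))"
      by (simp only: mult_ac)
    also have "\<dots> = D\<^sup>2 * C" using y by (simp add: powr_add[symmetric])
    finally show "(\<Sum>x\<in>F. (?f x)\<^sup>2) \<le> D\<^sup>2 * C" .
  qed
  then show ?thesis by blast
qed

section \<open>The bilinear multiplier\<close>

lemma norm_sum_triangles:
  fixes p q :: "'a::real_normed_vector"
  shows "norm (p + q) \<le> norm p + norm q" "norm p \<le> norm (p + q) + norm q" "norm q \<le> norm (p + q) + norm p"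
  using norm_triangle_ineq[of p q] norm_triangle_ineq4[of "p + q" q] norm_triangle_ineq4[of "p + q" p] by auto

lemma B_multiplier_le:
  "B_multiplier \<sigma> g p q \<le> norm p powr (- \<sigma>) * norm q powr (- \<sigma>) * norm (p + q) powr g * norm q"
  "B_multiplier \<sigma> g p q \<le> norm p powr (- \<sigma>) * norm q powr (- \<sigma>) * norm (p + q) powr g * norm (p + q)"
  by (auto simp: B_multiplier_def intro!: mult_left_mono)

text \<open>The variable \<open>x\<close> is the smaller of the two inputs. The kernel is estimated separately for
  \<open>|x| \<le> |x + y|\<close>, when \<open>|x + y|\<close> and \<open>|y|\<close> are comparable, and for \<open>|x + y| < |x|\<close>, when \<open>|x|\<close> and
  \<open>|y|\<close> are.\<close>

lemma l2_bound_small_input: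
  assumes \<sigma>: "0 < \<sigma>" and H3: "5 + 2 * g \<le> 4 * \<sigma>" "- 5 / 2 < g"
    and H: "lattice_bound (2 * a) (2 * b)"
    and M0: "\<And>x y. 0 \<le> M x y" "\<And>x y. x = 0 \<or> y = 0 \<or> x + y = 0 \<Longrightarrow> M x y = 0"
    and M1: "\<And>x y. x \<noteq> 0 \<Longrightarrow> y \<noteq> 0 \<Longrightarrow>
      M x y \<le> norm x powr (- a) * norm y powr (- (b + g)) * norm (x + y) powr g"
    and M2: "\<And>x y. M x y \<le> norm x powr (- \<sigma>) * norm y powr (- \<sigma>) * norm (x + y) powr g * norm (x + y)"
  shows "\<exists>C. \<forall>y\<in>freq. l2_bound (\<lambda>x. if norm x \<le> norm y then M x y else 0) C"
proof -
  let ?f = "\<lambda>y x. if x \<noteq> 0 \<and> norm x \<le> norm y then 2 powr \<bar>g\<bar> * norm x powr (- a) * norm y powr (- b) else 0"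
  let ?h = "\<lambda>y x. if x + y \<noteq> 0 \<and> norm (x + y) \<le> norm y
    then 2 powr \<sigma> * norm y powr (- (2 * \<sigma>)) * norm (x + y) powr (g + 1) else 0"
  obtain C1 where C1: "\<forall>y\<in>freq - {0}. l2_bound (?f y) C1"
    using l2_bound_comparable_output[OF H, of "2 powr \<bar>g\<bar>"] by (elim exE)
  obtain C2 where C2: "\<forall>y\<in>freq - {0}. l2_bound (?h y) C2"
    using l2_bound_small_output[OF H3] by (elim exE)
  have le: "M x y \<le> ?f y x + ?h y x" if xy: "norm x \<le> norm y" "x \<noteq> 0" "y \<noteq> 0" "x + y \<noteq> 0" for x y
  proof (cases "norm x \<le> norm (x + y)")
    case True
    \<comment> \<open>With |x| \<le> |x + y| and |x| \<le> |y| the triangle inequality gives |x + y|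
      \<le> 2 |y| and |y| \<le> 2 |x + y|.\<close>
    have "norm (x + y) powr g \<le> 2 powr \<bar>g\<bar> * norm y powr g"
      using True xy norm_sum_triangles[where p = x and q = y] by (intro powr_comparable) auto
    then have "norm x powr (- a) * norm y powr (- (b + g)) * norm (x + y) powr g
       \<le> norm x powr (- a) * norm y powr (- (b + g)) * (2 powr \<bar>g\<bar> * norm y powr g)"
      by (intro mult_left_mono) auto
    also have "\<dots> = 2 powr \<bar>g\<bar> * norm x powr (- a) * (norm y powr (- (b + g)) * norm y powr g)"
      by (simp only: mult_ac)
    also have "\<dots> = ?f y x" using xy by (simp add: powr_add[symmetric])
    finally have "M x y \<le> ?f y x" using M1[OF xy(2,3)] by linarith
    moreover have "0 \<le> ?h y x" by simp
    ultimately show ?thesis by linarith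
  next
    case False
    have "norm x powr (- \<sigma>) * norm y powr (- \<sigma>) * norm (x + y) powr g * norm (x + y) \<le> ?h y x"
      using False xy \<sigma> norm_sum_triangles[where p = x and q = y] low_output_term_le[of "norm x" "norm y" "norm (x + y)" \<sigma> g]
      by auto
    moreover have "0 \<le> ?f y x" by simp
    ultimately show ?thesis using M2[of x y] by linarith
  qed
  \<comment> \<open>The bounds C1 and C2 are known only for nonzero y. At y = 0 the kernel vanishes,
    and the maximum with 0 keeps the common constant valid there.\<close>
  have "l2_bound (\<lambda>x. if norm x \<le> norm y then M x y else 0) (max 0 (2 * C1 + 2 * C2))" if y: "y \<in> freq" for y
  proof (cases "y = 0")
    case True
    then show ?thesis using M0(2) by (intro l2_boundI) (simp cong: if_cong)
  next
    case False
    have "l2_bound (\<lambda>x. ?f y x + ?h y x) (2 * C1 + 2 * C2)"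
      using C1 C2 y False by (intro l2_bound_add) blast+
    then show ?thesis
    proof (rule l2_bound_mono)
      fix x
      have "0 \<le> ?f y x + ?h y x" by simp
      then show "\<bar>if norm x \<le> norm y then M x y else 0\<bar> \<le> \<bar>?f y x + ?h y x\<bar>"
        using le[of x y] M0[of x y] False by (cases "x = 0 \<or> x + y = 0"; cases "norm x \<le> norm y") (simp_all del: if_split_asm)
    qed simp
  qed
  then show ?thesis by blast
qed

text \<open>The derivative |q| acts on the larger input, so the small input keeps its full weight: a
  = \<sigma> and b = \<sigma> - 1 - g.\<close>

lemma B_multiplier_small_first:
  assumes "0 < \<sigma>" "5 + 2 * g \<le> 4 * \<sigma>" "- 5 / 2 < g" "lattice_bound (2 * \<sigma>) (2 * (\<sigma> - 1 - g))"
  shows "\<exists>C. \<forall>q\<in>freq. l2_bound (\<lambda>p. if norm p \<le> norm q then B_multiplier \<sigma> g p q else 0) C"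
proof (rule l2_bound_small_input[OF assms])
  fix p q :: "real^3" assume "p \<noteq> 0" "q \<noteq> 0"
  then have eq: "norm q powr (- (\<sigma> - 1 - g + g)) = norm q powr (- \<sigma>) * norm q"
    by (simp add: powr_add powr_diff powr_minus field_simps)
  show "B_multiplier \<sigma> g p q \<le> norm p powr (- \<sigma>) * norm q powr (- (\<sigma> - 1 - g + g)) * norm (p + q) powr g"
    unfolding eq using B_multiplier_le(1)[of \<sigma> g p q] by (simp only: mult_ac)
qed (simp_all add: B_multiplier_le(2), simp add: B_multiplier_def)

text \<open>Now the derivative |q| acts on the smaller input and lowers its weight by one power: a =
  \<sigma> - 1 and b = \<sigma> - g.\<close>

lemma B_multiplier_small_second:
  assumes "0 < \<sigma>" "5 + 2 * g \<le> 4 * \<sigma>" "- 5 / 2 < g" "lattice_bound (2 * (\<sigma> - 1)) (2 * (\<sigma> - g))"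
  shows "\<exists>C. \<forall>p\<in>freq. l2_bound (\<lambda>q. if norm q \<le> norm p then B_multiplier \<sigma> g p q else 0) C"
proof (rule l2_bound_small_input[OF assms])
  fix q p :: "real^3" assume q: "q \<noteq> 0" "p \<noteq> 0"
  have "norm q powr (- (\<sigma> - 1)) = norm q powr (- \<sigma>) * norm q"
    using q by (simp add: powr_diff powr_minus field_simps)
  moreover have "\<sigma> - g + g = \<sigma>" by simp
  ultimately show "B_multiplier \<sigma> g p q \<le> norm q powr (- (\<sigma> - 1)) * norm p powr (- (\<sigma> - g + g)) * norm (q + p) powr g"
    using B_multiplier_le(1)[of \<sigma> g p q] by (simp only: mult_ac add.commute[of q p])
next
  fix q p :: "real^3"
  show "B_multiplier \<sigma> g p q \<le> norm q powr (- \<sigma>) * norm p powr (- \<sigma>) * norm (q + p) powr g * norm (q + p)"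
    using B_multiplier_le(2)[of \<sigma> g p q] by (simp only: mult_ac add.commute[of q p])
  show "B_multiplier \<sigma> g p q = 0" if "q = 0 \<or> p = 0 \<or> q + p = 0"
    using that by (auto simp: B_multiplier_def add.commute)
qed simp

text \<open>Cauchy--Schwarz in \<open>p\<close> followed by exchanging the sums: a kernel that is square summable in
  one input, uniformly in the other one, acts boundedly.\<close>

lemma kernel_bound_first:
  fixes a b :: "real^3 \<Rightarrow> real" and M :: "real^3 \<Rightarrow> real^3 \<Rightarrow> real"
  assumes M: "\<And>q. q \<in> freq \<Longrightarrow> l2_bound (\<lambda>p. M p q) C"
    and a: "l2_bound a A" and b: "l2_bound b B" and P: "finite P" "P \<subseteq> freq"
  shows "l2_bound (\<lambda>k. \<Sum>p\<in>P. a p * b (k - p) * M p (k - p)) (C * A * B)"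
proof (rule l2_boundI)
  fix K :: "(real^3) set" assume K: "finite K" "K \<subseteq> freq"
  have A: "0 \<le> A" and C: "0 \<le> C"
    using l2_bound_nonneg[OF a] l2_bound_nonneg[OF M[OF freq_zero]] by auto
  \<comment> \<open>Exchanging the sums uses the injective substitution of q = k - p for k; its
    image lies in the rectangle of Q and P, to which the nonnegative sum is extended.\<close>
  define Q where "Q = (\<lambda>(k, p). k - p) ` (K \<times> P)"
  have Q: "finite Q" "Q \<subseteq> freq" using K P by (auto simp: Q_def subset_iff)
  have "(\<Sum>k\<in>K. (\<Sum>p\<in>P. a p * b (k - p) * M p (k - p))\<^sup>2) \<le> (\<Sum>k\<in>K. A * (\<Sum>p\<in>P. (b (k - p) * M p (k - p))\<^sup>2))"
  proof (rule sum_mono)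
    fix k
    have "(\<Sum>p\<in>P. a p * (b (k - p) * M p (k - p)))\<^sup>2 \<le> (\<Sum>p\<in>P. (a p)\<^sup>2) * (\<Sum>p\<in>P. (b (k - p) * M p (k - p))\<^sup>2)"
      by (rule Cauchy_Schwarz_ineq_sum)
    also have "\<dots> \<le> A * (\<Sum>p\<in>P. (b (k - p) * M p (k - p))\<^sup>2)"
      by (intro mult_right_mono l2_boundD[OF a P] sum_nonneg) auto
    finally show "(\<Sum>p\<in>P. a p * b (k - p) * M p (k - p))\<^sup>2 \<le> A * (\<Sum>p\<in>P. (b (k - p) * M p (k - p))\<^sup>2)"
      by (simp only: mult.assoc)
  qed
  also have "\<dots> = A * (\<Sum>(k, p)\<in>K \<times> P. (b (k - p) * M p (k - p))\<^sup>2)"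
    by (simp add: sum_distrib_left sum.cartesian_product split_def)
  also have "\<dots> \<le> A * (B * C)"
  proof (rule mult_left_mono[OF _ A])
    have "(\<Sum>(k, p)\<in>K \<times> P. (b (k - p) * M p (k - p))\<^sup>2) = (\<Sum>(q, p)\<in>(\<lambda>(k, p). (k - p, p)) ` (K \<times> P). (b q * M p q)\<^sup>2)"
      by (subst sum.reindex) (auto simp: inj_on_def split_def)
    also have "\<dots> \<le> (\<Sum>(q, p)\<in>Q \<times> P. (b q * M p q)\<^sup>2)"
      using Q(1) P(1) by (intro sum_mono2) (auto simp: Q_def)
    also have "\<dots> = (\<Sum>q\<in>Q. (b q)\<^sup>2 * (\<Sum>p\<in>P. (M p q)\<^sup>2))"
      by (simp add: sum.cartesian_product[symmetric] power_mult_distrib sum_distrib_left)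
    also have "\<dots> \<le> (\<Sum>q\<in>Q. (b q)\<^sup>2 * C)"
      using Q(2) by (intro sum_mono mult_left_mono l2_boundD[OF M P]) auto
    also have "\<dots> \<le> B * C"
      unfolding sum_distrib_right[symmetric] by (intro mult_right_mono l2_boundD[OF b Q] C)
    finally show "(\<Sum>(k, p)\<in>K \<times> P. (b (k - p) * M p (k - p))\<^sup>2) \<le> B * C" .
  qed
  finally show "(\<Sum>k\<in>K. (\<Sum>p\<in>P. a p * b (k - p) * M p (k - p))\<^sup>2) \<le> C * A * B" by (simp add: mult_ac)
qed

text \<open>Here Cauchy-Schwarz separates the factor b instead of a: for fixed k the points k - p
  are distinct, so its square sum is at most B. The sum over k is then performed first, for fixed
  p.\<close>

lemma kernel_bound_second:
  fixes a b :: "real^3 \<Rightarrow> real" and M :: "real^3 \<Rightarrow> real^3 \<Rightarrow> real"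
  assumes M: "\<And>p. p \<in> freq \<Longrightarrow> l2_bound (M p) C"
    and a: "l2_bound a A" and b: "l2_bound b B" and P: "finite P" "P \<subseteq> freq"
  shows "l2_bound (\<lambda>k. \<Sum>p\<in>P. a p * b (k - p) * M p (k - p)) (C * A * B)"
proof (rule l2_boundI)
  fix K :: "(real^3) set" assume K: "finite K" "K \<subseteq> freq"
  have B: "0 \<le> B" and C: "0 \<le> C"
    using l2_bound_nonneg[OF b] l2_bound_nonneg[OF M[OF freq_zero]] by auto
  have "(\<Sum>k\<in>K. (\<Sum>p\<in>P. a p * b (k - p) * M p (k - p))\<^sup>2) \<le> (\<Sum>k\<in>K. B * (\<Sum>p\<in>P. (a p * M p (k - p))\<^sup>2))"
  proof (rule sum_mono)
    fix k assume k: "k \<in> K"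
    have "(\<Sum>p\<in>P. (b (k - p))\<^sup>2) = (\<Sum>q\<in>(\<lambda>p. k - p) ` P. (b q)\<^sup>2)"
      by (subst sum.reindex) (auto simp: inj_on_def)
    also have "\<dots> \<le> B" using P K k by (intro l2_boundD[OF b]) (auto intro!: freq_diff)
    finally have b': "(\<Sum>p\<in>P. (b (k - p))\<^sup>2) \<le> B" .
    have "(\<Sum>p\<in>P. b (k - p) * (a p * M p (k - p)))\<^sup>2 \<le> (\<Sum>p\<in>P. (b (k - p))\<^sup>2) * (\<Sum>p\<in>P. (a p * M p (k - p))\<^sup>2)"
      by (rule Cauchy_Schwarz_ineq_sum)
    also have "\<dots> \<le> B * (\<Sum>p\<in>P. (a p * M p (k - p))\<^sup>2)"
      by (intro mult_right_mono b' sum_nonneg) auto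
    finally show "(\<Sum>p\<in>P. a p * b (k - p) * M p (k - p))\<^sup>2 \<le> B * (\<Sum>p\<in>P. (a p * M p (k - p))\<^sup>2)"
      by (simp only: mult_ac)
  qed
  also have "\<dots> = B * (\<Sum>p\<in>P. (a p)\<^sup>2 * (\<Sum>k\<in>K. (M p (k - p))\<^sup>2))"
    unfolding sum_distrib_left by (subst sum.swap) (simp add: power_mult_distrib)
  also have "\<dots> \<le> B * (\<Sum>p\<in>P. (a p)\<^sup>2 * C)"
  proof (intro mult_left_mono sum_mono B)
    fix p assume p: "p \<in> P"
    then have pf: "p \<in> freq" using P by blast
    have "(\<Sum>k\<in>K. (M p (k - p))\<^sup>2) = (\<Sum>q\<in>(\<lambda>k. k - p) ` K. (M p q)\<^sup>2)"
      by (subst sum.reindex) (auto simp: inj_on_def)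
    also have "\<dots> \<le> C" using K pf by (intro l2_boundD[OF M[OF pf]]) (auto intro!: freq_diff)
    finally show "(\<Sum>k\<in>K. (M p (k - p))\<^sup>2) \<le> C" .
  qed auto
  also have "\<dots> \<le> B * (A * C)"
    unfolding sum_distrib_right[symmetric] by (intro mult_left_mono mult_right_mono l2_boundD[OF a P] C B)
  finally show "(\<Sum>k\<in>K. (\<Sum>p\<in>P. a p * b (k - p) * M p (k - p))\<^sup>2) \<le> C * A * B" by (simp add: mult_ac)
qed

text \<open>The constant is uniform over finite sets P of input frequencies, so that the full
  convolution can be reached as a limit. Since A and B bound squares, C is the square of an operator
  bound.\<close>

definition bilinear_bounded :: "real \<Rightarrow> real \<Rightarrow> bool" where
  "bilinear_bounded \<sigma> g \<longleftrightarrow> (\<exists>C\<ge>0. \<forall>a b A B P.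
     (\<forall>p\<in>freq. 0 \<le> a p \<and> 0 \<le> b p) \<longrightarrow> l2_bound a A \<longrightarrow> l2_bound b B \<longrightarrow> finite P \<and> P \<subseteq> freq \<longrightarrow>
     l2_bound (\<lambda>k. \<Sum>p\<in>P. a p * b (k - p) * B_multiplier \<sigma> g p (k - p)) (C * A * B))"

lemma bilinear_boundedI:
  assumes \<sigma>: "0 < \<sigma>" and H3: "5 + 2 * g \<le> 4 * \<sigma>" "- 5 / 2 < g"
    and H1: "lattice_bound (2 * \<sigma>) (2 * (\<sigma> - 1 - g))"
    and H2: "lattice_bound (2 * (\<sigma> - 1)) (2 * (\<sigma> - g))"
  shows "bilinear_bounded \<sigma> g"
proof -
  let ?M1 = "\<lambda>p q. if norm p \<le> norm q then B_multiplier \<sigma> g p q else 0"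
  \<comment> \<open>The strict complement, so that pairs with |p| = |q| are counted once in the
    splitting.\<close>
  let ?M2 = "\<lambda>p q. if norm p \<le> norm q then 0 else B_multiplier \<sigma> g p q"
  obtain C1 where C1: "\<forall>q\<in>freq. l2_bound (\<lambda>p. ?M1 p q) C1"
    using B_multiplier_small_first[OF \<sigma> H3 H1] by (elim exE)
  obtain C2 where C2: "\<forall>p\<in>freq. l2_bound (\<lambda>q. if norm q \<le> norm p then B_multiplier \<sigma> g p q else 0) C2"
    using B_multiplier_small_second[OF \<sigma> H3 H2] by (elim exE)
  have C2': "l2_bound (?M2 p) C2" if "p \<in> freq" for p
    by (rule l2_bound_mono[OF C2[rule_format, OF that]]) auto
  have C0: "C1 \<ge> 0" "C2 \<ge> 0" using C1 C2' l2_bound_nonneg freq_zero by blast+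
  have "l2_bound (\<lambda>k. \<Sum>p\<in>P. a p * b (k - p) * B_multiplier \<sigma> g p (k - p)) ((2 * C1 + 2 * C2) * A * B)"
    if a: "l2_bound a A" and b: "l2_bound b B" and P: "finite P" "P \<subseteq> freq" for a b A B P
  proof (rule l2_bound_mono)
    show "l2_bound (\<lambda>k. (\<Sum>p\<in>P. a p * b (k - p) * ?M1 p (k - p)) + (\<Sum>p\<in>P. a p * b (k - p) * ?M2 p (k - p)))
        (2 * (C1 * A * B) + 2 * (C2 * A * B))"
      using C1 by (intro l2_bound_add kernel_bound_first[where M = ?M1] kernel_bound_second[where M = ?M2] C2' a b P) auto
    fix k
    have "(\<Sum>p\<in>P. a p * b (k - p) * B_multiplier \<sigma> g p (k - p)) =
        (\<Sum>p\<in>P. a p * b (k - p) * ?M1 p (k - p)) + (\<Sum>p\<in>P. a p * b (k - p) * ?M2 p (k - p))"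
      unfolding sum.distrib[symmetric] by (intro sum.cong) auto
    then show "\<bar>\<Sum>p\<in>P. a p * b (k - p) * B_multiplier \<sigma> g p (k - p)\<bar> \<le>
      \<bar>(\<Sum>p\<in>P. a p * b (k - p) * ?M1 p (k - p)) + (\<Sum>p\<in>P. a p * b (k - p) * ?M2 p (k - p))\<bar>"
      by (simp only: order_refl)
  qed (simp add: ring_distribs mult.assoc)
  then show ?thesis
    unfolding bilinear_bounded_def using C0 by (intro exI[of _ "2 * C1 + 2 * C2"]) auto
qed

section \<open>Admissible exponents\<close>

lemma B_multiplier_mono:
  assumes "p \<in> freq" "q \<in> freq" "g \<le> g'"
  shows "B_multiplier \<sigma> g p q \<le> B_multiplier \<sigma> g' p q"
proof (cases "p = 0 \<or> q = 0 \<or> p + q = 0")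
  case False
  then have "norm (p + q) powr g \<le> norm (p + q) powr g'"
    using assms norm_freq_ge_1[of "p + q"] by (intro powr_mono) auto
  then show ?thesis using False by (auto simp: B_multiplier_def intro!: mult_right_mono mult_left_mono)
qed (auto simp: B_multiplier_def)

lemma bilinear_bounded_mono:
  assumes "bilinear_bounded \<sigma> g'" "g \<le> g'"
  shows "bilinear_bounded \<sigma> g"
proof -
  obtain C where C: "C \<ge> 0" and CC: "\<forall>a b A B P.
     (\<forall>p\<in>freq. 0 \<le> a p \<and> 0 \<le> b p) \<longrightarrow> l2_bound a A \<longrightarrow> l2_bound b B \<longrightarrow> finite P \<and> P \<subseteq> freq \<longrightarrow>
     l2_bound (\<lambda>k. \<Sum>p\<in>P. a p * b (k - p) * B_multiplier \<sigma> g' p (k - p)) (C * A * B)"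
    using assms(1) unfolding bilinear_bounded_def by (elim exE conjE)
  have "l2_bound (\<lambda>k. \<Sum>p\<in>P. a p * b (k - p) * B_multiplier \<sigma> g p (k - p)) (C * A * B)"
    if pos: "\<forall>p\<in>freq. 0 \<le> a p \<and> 0 \<le> b p" and ab: "l2_bound a A" "l2_bound b B"
      and P: "finite P \<and> P \<subseteq> freq" for a b A B P
  proof (rule l2_bound_mono[OF CC[rule_format, OF _ ab]])
    fix k assume k: "k \<in> freq"
    have pos': "0 \<le> a p" "0 \<le> b p" if "p \<in> freq" for p using pos that by auto
    have "0 \<le> (\<Sum>p\<in>P. a p * b (k - p) * B_multiplier \<sigma> g p (k - p))"
      using P k by (intro sum_nonneg mult_nonneg_nonneg) (auto intro!: freq_diff pos')
    moreover have "(\<Sum>p\<in>P. a p * b (k - p) * B_multiplier \<sigma> g p (k - p))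
        \<le> (\<Sum>p\<in>P. a p * b (k - p) * B_multiplier \<sigma> g' p (k - p))"
      using P k assms(2)
      by (intro sum_mono mult_left_mono mult_nonneg_nonneg B_multiplier_mono) (auto intro!: freq_diff pos')
    ultimately show "\<bar>\<Sum>p\<in>P. a p * b (k - p) * B_multiplier \<sigma> g p (k - p)\<bar>
        \<le> \<bar>\<Sum>p\<in>P. a p * b (k - p) * B_multiplier \<sigma> g' p (k - p)\<bar>"
      by linarith
  qed (use pos P in auto)
  then show ?thesis unfolding bilinear_bounded_def using C by (intro exI[of _ C]) auto
qed

text \<open>Scaling criticality: 5 + 2g = 4\<sigma>, and both lattice bounds are used with growth
  exactly 3 - t, for t = 2 + 2\<alpha> and t = 2\<alpha>.\<close>

lemma bilinear_bounded_subcritical: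
  assumes "0 < \<alpha>" "\<alpha> < 1/2"
  shows "bilinear_bounded (1 + \<alpha>) (2 * \<alpha> - 1/2)"
  using assms
  by (intro bilinear_boundedI lattice_bound_mono[of "2 + 2 * \<alpha>"] lattice_bound_mono[of "2 * \<alpha>"]) (auto simp: field_simps)

text \<open>The growth exponent 2(\<sigma> - 1 - g) is 0, which is affordable because 2\<sigma> = 1
  + 4\<alpha> > 3. In the second bound the growth exponent is 2 = 3 - 1, and 2(\<sigma> - 1) =
  4\<alpha> - 1 is at least 1.\<close>

lemma bilinear_bounded_supercritical:
  assumes "1/2 < \<alpha>"
  shows "bilinear_bounded (1/2 + 2 * \<alpha>) (2 * \<alpha> - 1/2)"
  using assms
  by (intro bilinear_boundedI lattice_bound_gt_3 lattice_bound_mono[of 1]) (auto simp: field_simps)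

text \<open>With 2\<sigma> = 3 the first lattice sum is logarithmic; g < 1/2 leaves the growth
  exponent 1 - 2g > 0, which is met with t = 2 + 2g < 3.\<close>

lemma bilinear_bounded_critical:
  assumes "0 < \<epsilon>"
  shows "bilinear_bounded (3/2) (1/2 - 2 * \<epsilon>)"
proof -
  \<comment> \<open>A large \<epsilon> would violate g > -5/2. The truncated exponent always
    satisfies it, and monotonicity in g restores the original one.\<close>
  define g where "g = max 0 (1/2 - 2 * \<epsilon>)"
  have g: "0 \<le> g" "g < 1/2" "1/2 - 2 * \<epsilon> \<le> g" using assms by (auto simp: g_def max_def field_simps)
  have "bilinear_bounded (3/2) g"
    using g(1,2)
    by (intro bilinear_boundedI lattice_bound_mono[of "2 + 2 * g"] lattice_bound_mono[of 1]) (auto simp: field_simps)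
  then show ?thesis using g(3) by (rule bilinear_bounded_mono)
qed

section \<open>The Navier--Stokes nonlinearity\<close>

lemma stokes_symbol_eq: "stokes_symbol \<beta> k = (4 * pi\<^sup>2) powr \<beta> * norm k powr (2 * \<beta>)"
proof (cases "k = 0")
  case False
  have "((norm k)\<^sup>2) powr \<beta> = norm k powr (2 * \<beta>)"
    using False by (simp add: powr_powr flip: powr_numeral)
  then show ?thesis unfolding stokes_symbol_def by (simp add: powr_mult)
qed (simp add: stokes_symbol_def)

lemma stokes_symbol_ge:
  assumes "0 \<le> s"
  shows "norm k powr (2 * s) \<le> stokes_symbol s k"
proof -
  have "1 * 1 \<le> pi * pi" using pi_ge_two by (intro mult_mono) auto
  then have "1 \<le> 4 * pi\<^sup>2" by (simp add: power2_eq_square)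
  then have "1 \<le> (4 * pi\<^sup>2) powr s" using assms by (intro ge_one_powr_ge_zero) auto
  then show ?thesis unfolding stokes_symbol_eq using mult_right_mono[of 1 _ "norm k powr (2 * s)"] by simp
qed

lemma stokes_symbol_ge_1:
  assumes "0 \<le> s" "k \<in> freq" "k \<noteq> 0"
  shows "1 \<le> stokes_symbol s k"
proof -
  have "1 \<le> norm k powr (2 * s)" using assms by (intro ge_one_powr_ge_zero norm_freq_ge_1) auto
  then show ?thesis using stokes_symbol_ge[OF assms(1), of k] by linarith
qed

lemma stokes_symbol_minus: "k \<noteq> 0 \<Longrightarrow> stokes_symbol \<beta> k * stokes_symbol (- \<beta>) k = 1"
  unfolding stokes_symbol_def powr_add[symmetric] by simp

lemma fcoeff_0_H: "u \<in> H_space \<Longrightarrow> fcoeff u 0 = 0"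
  using H_space_coeff[of u 0] by (simp add: solenoidal_coeff_def)

text \<open>Symbols of first derivatives are purely imaginary; on the Fourier side this sign is that
  of integration by parts.\<close>

lemma inner_imaginary_multiple:
  assumes "cnj a = - a"
  shows "z \<bullet> (a *s w) = - ((a *s z) \<bullet> (w::complex^3))"
proof -
  have "Re (z $ j * cnj (a * w $ j)) = - Re (a * z $ j * cnj (w $ j))" for j
    using assms by simp (simp add: algebra_simps)
  then show ?thesis unfolding inner_complex_vec by (simp only: vector_smult_component sum_negf)
qed

lemma weak_partial_coeff:
  assumes w: "weak_partial_graph i v w" and k: "k \<in> freq"
  shows "fcoeff w k = deriv_symbol (k $ i) *s fcoeff v k"
proof -
  have iv: "integrable torus v" "integrable torus w" using w by (auto simp: weak_partial_graph_def)
  have "fcoeff w k \<bullet> z = (deriv_symbol (k $ i) *s fcoeff v k) \<bullet> z" for z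
  proof -
    have "L2_inner v (partial i (wave_field k z)) = - L2_inner w (wave_field k z)"
      using w wave_field_test[OF k] by (auto simp: weak_partial_graph_def)
    moreover have "partial i (wave_field k z) = wave_field k (deriv_symbol (k $ i) *s z)"
      unfolding wave_field_eq_sum partial_field_sum by (simp add: field_sum_def fun_eq_iff)
    ultimately show ?thesis by (simp add: L2_inner_wave_field iv inner_imaginary_multiple)
  qed
  then show ?thesis by (metis vector_eq_rdot inner_commute)
qed

text \<open>Riesz-Fischer builds the derivative from its intended coefficients, and Parseval's
  identity reduces the defining relation to the skew symmetry of
  \<open>deriv_symbol\<close>.\<close>

lemma weak_partial_ex:
  assumes v: "v \<in> L2_fields" and s: "(\<lambda>k. (norm k * norm (fcoeff v k))\<^sup>2) summable_on freq"
  shows "\<exists>w\<in>L2_fields. weak_partial_graph i v w"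
proof -
  obtain w where w: "w \<in> L2_fields" "\<And>k. k \<in> freq \<Longrightarrow> fcoeff w k = deriv_symbol (k $ i) *s fcoeff v k"
  proof (rule riesz_fischer_field[where c = "\<lambda>k. deriv_symbol (k $ i) *s fcoeff v k"])
    show "(\<lambda>k. (norm (deriv_symbol (k $ i) *s fcoeff v k))\<^sup>2) summable_on freq"
    proof (rule summable_on_comparison_test)
      show "(\<lambda>k. (2 * pi)\<^sup>2 * (norm k * norm (fcoeff v k))\<^sup>2) summable_on freq"
        by (intro summable_on_cmult_right s)
      fix k
      have "norm (deriv_symbol (k $ i) *s fcoeff v k) = 2 * pi * (\<bar>k $ i\<bar> * norm (fcoeff v k))"
        by (simp add: norm_vector_scalar_mult norm_mult)
      also have "\<dots> \<le> 2 * pi * (norm k * norm (fcoeff v k))"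
        by (intro mult_left_mono mult_right_mono component_le_norm_cart) auto
      finally have "norm (deriv_symbol (k $ i) *s fcoeff v k) \<le> 2 * pi * (norm k * norm (fcoeff v k))" .
      from power_mono[OF this norm_ge_zero, of 2]
      show "(norm (deriv_symbol (k $ i) *s fcoeff v k))\<^sup>2 \<le> (2 * pi)\<^sup>2 * (norm k * norm (fcoeff v k))\<^sup>2"
        by (simp only: power_mult_distrib)
    qed auto
    show "deriv_symbol ((- k) $ i) *s fcoeff v (- k) = vcnj (deriv_symbol (k $ i) *s fcoeff v k)" for k
      by (simp add: fcoeff_uminus vec_eq_iff)
  qed auto
  have "L2_inner v (partial i \<phi>) = - L2_inner w \<phi>" if \<phi>: "\<phi> \<in> test_fields" for \<phi>
  proof -
    have "L2_inner v (partial i \<phi>) = (\<Sum>\<^sub>\<infinity>k\<in>freq. fcoeff v k \<bullet> fcoeff (partial i \<phi>) k)"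
      by (intro L2_inner_eq_infsum v test_L2 partial_test \<phi>)
    also have "\<dots> = (\<Sum>\<^sub>\<infinity>k\<in>freq. - (fcoeff w k \<bullet> fcoeff \<phi> k))"
      by (intro infsum_cong) (simp add: fcoeff_partial \<phi> w inner_imaginary_multiple)
    also have "\<dots> = - L2_inner w \<phi>"
      by (simp add: infsum_uminus L2_inner_eq_infsum w test_L2 \<phi>)
    finally show ?thesis .
  qed
  then show ?thesis using w v by (auto simp: weak_partial_graph_def L2_fields_integrable)
qed

text \<open>The description yields a field that is only known to be integrable. It has the same
  coefficients as a square-integrable weak derivative, hence agrees with it almost
  everywhere.\<close>

lemma weak_partial_L2:
  assumes v: "v \<in> L2_fields" and s: "(\<lambda>k. (norm k * norm (fcoeff v k))\<^sup>2) summable_on freq"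
  shows "weak_partial_graph i v (weak_partial i v)" "weak_partial i v \<in> L2_fields"
proof -
  obtain w where w: "w \<in> L2_fields" "weak_partial_graph i v w" using weak_partial_ex[OF v s] by blast
  show g: "weak_partial_graph i v (weak_partial i v)"
    unfolding weak_partial_def by (rule someI[of _ w]) (rule w)
  then have i: "integrable torus (weak_partial i v)" by (simp add: weak_partial_graph_def)
  have ae: "AE x in torus. w x = weak_partial i v x"
    by (rule fcoeff_unique) (simp_all add: i w L2_fields_integrable weak_partial_coeff[OF g] weak_partial_coeff[OF w(2)])
  have [measurable]: "weak_partial i v \<in> borel_measurable torus" "w \<in> borel_measurable torus"
    using i w by auto
  have "integrable torus (\<lambda>x. (norm (weak_partial i v x))\<^sup>2) \<longleftrightarrow> integrable torus (\<lambda>x. (norm (w x))\<^sup>2)"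
    using ae by (intro integrable_cong_AE) (auto elim!: eventually_mono)
  then show "weak_partial i v \<in> L2_fields" using w i by (auto simp: L2_fields_def)
qed

text \<open>Each component is a sum of products of square-integrable functions, so its coefficients
  are convolutions. They are stated as limits over cubes because the multiplier estimate is
  available for finite sets of input frequencies.\<close>

lemma convective_coeff:
  assumes u: "u \<in> L2_fields" and v: "v \<in> L2_fields"
    and s: "(\<lambda>k. (norm k * norm (fcoeff v k))\<^sup>2) summable_on freq"
  shows "integrable torus (convective u v)"
    and "k \<in> freq \<Longrightarrow> (\<lambda>n. \<Sum>p\<in>freq_cube n. (2 * pi * \<i> * kdot (k - p) (fcoeff u p)) *s fcoeff v (k - p))
          \<longlonglongrightarrow> fcoeff (convective u v) k"
proof -
  let ?w = "\<lambda>i. weak_partial i v"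
  note w = weak_partial_L2[OF v s]
  have sq: "sq_integrable (\<lambda>x. of_real (u x $ j))" "sq_integrable (\<lambda>x. of_real (?w i x $ j))" for i j
    using u w(2) by (simp_all add: L2_fields_iff)
  have eq: "complex_of_real (convective u v x $ j) = (\<Sum>i\<in>UNIV. of_real (u x $ i) * of_real (?w i x $ j))" for x j
    by (simp add: convective_def)
  have i: "integrable torus (\<lambda>x. complex_of_real (u x $ i) * of_real (?w i x $ j))" for i j
    by (intro sq_integrable_mult sq)
  have "integrable torus (\<lambda>x. Re (complex_of_real (convective u v x $ j)))" for j
    unfolding eq by (intro integrable_Re Bochner_Integration.integrable_sum i)
  then show int: "integrable torus (convective u v)"
    by (intro integrable_fieldI) simp
  assume k: "k \<in> freq"
  show "(\<lambda>n. \<Sum>p\<in>freq_cube n. (2 * pi * \<i> * kdot (k - p) (fcoeff u p)) *s fcoeff v (k - p))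
          \<longlonglongrightarrow> fcoeff (convective u v) k"
  proof (rule vec_tendstoI)
    fix j
    have "fcoeff (convective u v) k $ j = (\<Sum>i\<in>UNIV. fourier (\<lambda>x. of_real (u x $ i) * of_real (?w i x $ j)) k)"
      unfolding fcoeff_def vec_lambda_beta eq by (intro fourier_sum i)
    moreover have "(\<lambda>n. \<Sum>p\<in>freq_cube n. \<Sum>i\<in>UNIV. fcoeff u p $ i * fcoeff (?w i) (k - p) $ j) \<longlonglongrightarrow>
        (\<Sum>i\<in>UNIV. fourier (\<lambda>x. of_real (u x $ i) * of_real (?w i x $ j)) k)"
      unfolding fcoeff_def vec_lambda_beta by (intro has_sum_freq_cube has_sum_sum fourier_mult sq)
    ultimately have "(\<lambda>n. \<Sum>p\<in>freq_cube n. \<Sum>i\<in>UNIV. fcoeff u p $ i * fcoeff (?w i) (k - p) $ j)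
        \<longlonglongrightarrow> fcoeff (convective u v) k $ j"
      by simp
    moreover have "(\<Sum>i\<in>UNIV. fcoeff u p $ i * fcoeff (?w i) (k - p) $ j) =
        ((2 * pi * \<i> * kdot (k - p) (fcoeff u p)) *s fcoeff v (k - p)) $ j" if "p \<in> freq_cube n" for p n
      using weak_partial_coeff[OF w(1) freq_diff[OF k freq_cubeD[OF that]]]
      by (simp add: kdot_def sum_distrib_left sum_distrib_right mult_ac)
    ultimately show "(\<lambda>n. (\<Sum>p\<in>freq_cube n. (2 * pi * \<i> * kdot (k - p) (fcoeff u p)) *s fcoeff v (k - p)) $ j)
          \<longlonglongrightarrow> fcoeff (convective u v) k $ j"
      by (simp cong: sum.cong del: vector_smult_component)
  qed
qed

lemma stokes_dom_gradient:
  assumes s: "1/2 \<le> s" and v: "v \<in> stokes_dom s"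
  shows "(\<lambda>k. (norm k * norm (fcoeff v k))\<^sup>2) summable_on freq"
proof (rule summable_on_comparison_test)
  show "(\<lambda>k. (stokes_symbol s k * norm (fcoeff v k))\<^sup>2) summable_on freq"
    using v by (simp add: stokes_dom_iff)
  fix k :: "real^3" assume k: "k \<in> freq"
  have "norm k \<le> stokes_symbol s k"
  proof (cases "k = 0")
    case False
    then have "norm k powr 1 \<le> norm k powr (2 * s)"
      using s k by (intro powr_mono norm_freq_ge_1) auto
    then show ?thesis using stokes_symbol_ge[of s k] s False by simp
  qed simp
  then show "(norm k * norm (fcoeff v k))\<^sup>2 \<le> (stokes_symbol s k * norm (fcoeff v k))\<^sup>2"
    by (intro power_mono mult_right_mono) auto
qed auto

lemma stokes_norm_l2_bound:
  assumes u: "u \<in> stokes_dom s"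
  shows "l2_bound (\<lambda>k. stokes_symbol s k * norm (fcoeff u k)) ((stokes_norm s u)\<^sup>2)"
proof (rule l2_boundI)
  fix F :: "(real^3) set" assume F: "finite F" "F \<subseteq> freq"
  have "(\<lambda>k. (stokes_symbol s k * norm (fcoeff u k))\<^sup>2) summable_on freq"
    using u by (simp add: stokes_dom_iff)
  from finite_sum_le_infsum[OF this F]
  show "(\<Sum>k\<in>F. (stokes_symbol s k * norm (fcoeff u k))\<^sup>2) \<le> (stokes_norm s u)\<^sup>2"
    using infsumI[OF stokes_norm_has_sum[OF u]] by simp
qed

text \<open>Since \<open>p \<cdot> u\<^sub>p = 0\<close>, the derivative falling on \<open>v\<close> can be replaced by the output frequency:
  \<open>(k - p) \<cdot> u\<^sub>p = k \<cdot> u\<^sub>p\<close>. This gives the minimum in the multiplier.\<close>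

lemma convective_term_le:
  assumes s: "0 \<le> s" and H: "u \<in> H_space" "v \<in> H_space"
    and k: "k \<in> freq" "k \<noteq> 0" and p: "p \<in> freq"
  shows "norm k powr g * norm ((2 * pi * \<i> * kdot (k - p) (fcoeff u p)) *s fcoeff v (k - p))
    \<le> 2 * pi * ((stokes_symbol s p * norm (fcoeff u p)) * (stokes_symbol s (k - p) * norm (fcoeff v (k - p)))
       * B_multiplier (2 * s) g p (k - p))"
proof (cases "p = 0 \<or> k - p = 0")
  case True
  then show ?thesis using fcoeff_0_H H by (auto simp: kdot_def[of _ 0])
next
  case False
  let ?q = "k - p"
  have q: "?q \<in> freq" using k p by simp
  have bd: "norm (fcoeff w m) \<le> norm m powr (- (2 * s)) * (stokes_symbol s m * norm (fcoeff w m))"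
    if "m \<noteq> 0" for w m
  proof -
    have "norm m powr (- (2 * s)) * norm m powr (2 * s) = 1" using that by (simp flip: powr_add)
    then have "1 \<le> norm m powr (- (2 * s)) * stokes_symbol s m"
      using mult_left_mono[OF stokes_symbol_ge[OF s, of m], of "norm m powr (- (2 * s))"] by simp
    from mult_right_mono[OF this norm_ge_zero] show ?thesis by (simp add: mult.assoc)
  qed
  have "kdot p (fcoeff u p) = 0" using H_space_coeff[OF H(1) p] by (simp add: solenoidal_coeff_def)
  then have "kdot ?q (fcoeff u p) = kdot k (fcoeff u p)" by (simp add: kdot_diff_left)
  then have "cmod (kdot ?q (fcoeff u p)) \<le> min (norm ?q) (norm k) * norm (fcoeff u p)"
    using norm_kdot_le[of k "fcoeff u p"] norm_kdot_le[of ?q "fcoeff u p"] by (simp add: min_def)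
  then have "norm ((2 * pi * \<i> * kdot ?q (fcoeff u p)) *s fcoeff v ?q)
      \<le> 2 * pi * (min (norm ?q) (norm k) * norm (fcoeff u p)) * norm (fcoeff v ?q)"
    by (simp add: norm_vector_scalar_mult norm_mult mult_left_mono mult_right_mono)
  also have "\<dots> = 2 * pi * min (norm ?q) (norm k) * (norm (fcoeff u p) * norm (fcoeff v ?q))"
    by simp
  also have "\<dots> \<le> 2 * pi * min (norm ?q) (norm k) *
     ((norm p powr (- (2 * s)) * (stokes_symbol s p * norm (fcoeff u p))) *
      (norm ?q powr (- (2 * s)) * (stokes_symbol s ?q * norm (fcoeff v ?q))))"
    using False by (intro mult_left_mono mult_mono bd) auto
  finally have "norm k powr g * norm ((2 * pi * \<i> * kdot ?q (fcoeff u p)) *s fcoeff v ?q)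
    \<le> norm k powr g * (2 * pi * min (norm ?q) (norm k) *
     ((norm p powr (- (2 * s)) * (stokes_symbol s p * norm (fcoeff u p))) *
      (norm ?q powr (- (2 * s)) * (stokes_symbol s ?q * norm (fcoeff v ?q)))))"
    by (rule mult_left_mono) simp
  also have "\<dots> = 2 * pi * ((stokes_symbol s p * norm (fcoeff u p)) * (stokes_symbol s ?q * norm (fcoeff v ?q))
       * B_multiplier (2 * s) g p ?q)"
    using False k by (simp add: B_multiplier_def mult_ac)
  finally show ?thesis .
qed

text \<open>The estimate is proved for finitely many outputs K and input frequencies in a cube, with
  a bound independent of both; only then does the cube grow.\<close>

lemma leray_convective_estimate:
  assumes s: "1/2 \<le> s" and bb: "bilinear_bounded (2 * s) (2 * \<gamma>)"
  shows "\<exists>C\<ge>0. \<forall>u\<in>stokes_dom s. \<forall>v\<in>stokes_dom s.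
    l2_bound (\<lambda>k. stokes_symbol \<gamma> k * norm (leray_symbol k (fcoeff (convective u v) k)))
      ((C * stokes_norm s u * stokes_norm s v)\<^sup>2)"
proof -
  obtain C where C: "C \<ge> 0" and CC: "\<forall>a b A B P.
     (\<forall>p\<in>freq. 0 \<le> a p \<and> 0 \<le> b p) \<longrightarrow> l2_bound a A \<longrightarrow> l2_bound b B \<longrightarrow> finite P \<and> P \<subseteq> freq \<longrightarrow>
     l2_bound (\<lambda>k. \<Sum>p\<in>P. a p * b (k - p) * B_multiplier (2 * s) (2 * \<gamma>) p (k - p)) (C * A * B)"
    using bb unfolding bilinear_bounded_def by (elim exE conjE)
  \<comment> \<open>One factor comes from the Stokes symbol, the other from the derivative. The
    square root of C appears because C bounds squares of norms.\<close>
  let ?c = "(4 * pi\<^sup>2) powr \<gamma> * (2 * pi)"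
  have "l2_bound (\<lambda>k. stokes_symbol \<gamma> k * norm (leray_symbol k (fcoeff (convective u v) k)))
      (((?c * sqrt C) * stokes_norm s u * stokes_norm s v)\<^sup>2)"
    if uv: "u \<in> stokes_dom s" "v \<in> stokes_dom s" for u v
  proof (rule l2_boundI)
    fix K :: "(real^3) set" assume K: "finite K" "K \<subseteq> freq"
    have H: "u \<in> H_space" "v \<in> H_space" using uv by (auto simp: stokes_dom_iff)
    let ?g = "fcoeff (convective u v)" and ?w = "\<lambda>k. norm k powr (2 * \<gamma>)"
    let ?t = "\<lambda>k p. (2 * pi * \<i> * kdot (k - p) (fcoeff u p)) *s fcoeff v (k - p)"
    let ?a = "\<lambda>p. stokes_symbol s p * norm (fcoeff u p)" and ?b = "\<lambda>p. stokes_symbol s p * norm (fcoeff v p)"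
    let ?T = "\<lambda>n k. \<Sum>p\<in>freq_cube n. ?a p * ?b (k - p) * B_multiplier (2 * s) (2 * \<gamma>) p (k - p)"
    let ?N = "C * (stokes_norm s u)\<^sup>2 * (stokes_norm s v)\<^sup>2"
    \<comment> \<open>The frequency 0 is left out: the pointwise estimate requires k \<noteq> 0, and
      the Leray symbol annihilates the zero mode of the output.\<close>
    have fin: "(\<Sum>k\<in>K - {0}. (?w k * norm (\<Sum>p\<in>freq_cube n. ?t k p))\<^sup>2) \<le> (2 * pi)\<^sup>2 * ?N" for n
    proof -
      have "?w k * norm (\<Sum>p\<in>freq_cube n. ?t k p) \<le> 2 * pi * ?T n k" if k: "k \<in> K - {0}" for k
      proof -
        have "?w k * norm (\<Sum>p\<in>freq_cube n. ?t k p) \<le> (\<Sum>p\<in>freq_cube n. ?w k * norm (?t k p))"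
          unfolding sum_distrib_left[symmetric] by (intro mult_left_mono norm_sum) simp
        also have "\<dots> \<le> 2 * pi * ?T n k"
          unfolding sum_distrib_left
          using s k K by (intro sum_mono convective_term_le H) (auto dest: freq_cubeD)
        finally show ?thesis .
      qed
      then have "(\<Sum>k\<in>K - {0}. (?w k * norm (\<Sum>p\<in>freq_cube n. ?t k p))\<^sup>2) \<le> (\<Sum>k\<in>K - {0}. (2 * pi * ?T n k)\<^sup>2)"
        by (intro sum_mono power_mono) auto
      also have "\<dots> = (2 * pi)\<^sup>2 * (\<Sum>k\<in>K - {0}. (?T n k)\<^sup>2)"
        unfolding power_mult_distrib[of "2 * pi"] by (rule sum_distrib_left[symmetric])
      also have "\<dots> \<le> (2 * pi)\<^sup>2 * ?N"
      proof (rule mult_left_mono)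
        have "l2_bound (?T n) ?N"
          by (rule CC[rule_format, OF _ stokes_norm_l2_bound[OF uv(1)] stokes_norm_l2_bound[OF uv(2)]]) auto
        then show "(\<Sum>k\<in>K - {0}. (?T n k)\<^sup>2) \<le> ?N" using K by (intro l2_boundD) auto
      qed simp
      finally show ?thesis .
    qed
    have "(\<lambda>n. \<Sum>k\<in>K - {0}. (?w k * norm (\<Sum>p\<in>freq_cube n. ?t k p))\<^sup>2) \<longlonglongrightarrow> (\<Sum>k\<in>K - {0}. (?w k * norm (?g k))\<^sup>2)"
      using K by (intro tendsto_intros convective_coeff(2) H_space_L2 H stokes_dom_gradient[OF s uv(2)]) auto
    then have lim: "(\<Sum>k\<in>K - {0}. (?w k * norm (?g k))\<^sup>2) \<le> (2 * pi)\<^sup>2 * ?N"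
      by (rule LIMSEQ_le_const2) (use fin in blast)
    let ?d = "(4 * pi\<^sup>2) powr \<gamma>"
    have "(\<Sum>k\<in>K. (stokes_symbol \<gamma> k * norm (leray_symbol k (?g k)))\<^sup>2)
       = (\<Sum>k\<in>K - {0}. (stokes_symbol \<gamma> k * norm (leray_symbol k (?g k)))\<^sup>2)"
      using K by (intro sum.mono_neutral_right) (auto simp: leray_symbol_def)
    also have "\<dots> \<le> (\<Sum>k\<in>K - {0}. ?d\<^sup>2 * (?w k * norm (?g k))\<^sup>2)"
    proof (rule sum_mono)
      fix k
      have "stokes_symbol \<gamma> k * norm (leray_symbol k (?g k)) \<le> stokes_symbol \<gamma> k * norm (?g k)"
        by (intro mult_left_mono norm_leray_symbol_le) simp
      then have "(stokes_symbol \<gamma> k * norm (leray_symbol k (?g k)))\<^sup>2 \<le> (stokes_symbol \<gamma> k * norm (?g k))\<^sup>2"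
        by (intro power_mono) auto
      then show "(stokes_symbol \<gamma> k * norm (leray_symbol k (?g k)))\<^sup>2 \<le> ?d\<^sup>2 * (?w k * norm (?g k))\<^sup>2"
        by (simp only: stokes_symbol_eq power_mult_distrib[symmetric] mult.assoc)
    qed
    also have "\<dots> \<le> ?d\<^sup>2 * ((2 * pi)\<^sup>2 * ?N)"
      unfolding sum_distrib_left[symmetric] by (intro mult_left_mono lim) auto
    also have "\<dots> = ((?c * sqrt C) * stokes_norm s u * stokes_norm s v)\<^sup>2"
      using C by (simp add: power_mult_distrib)
    finally show "(\<Sum>k\<in>K. (stokes_symbol \<gamma> k * norm (leray_symbol k (?g k)))\<^sup>2)
      \<le> ((?c * sqrt C) * stokes_norm s u * stokes_norm s v)\<^sup>2" .
  qed
  then show ?thesis using C by (intro exI[of _ "?c * sqrt C"]) auto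
qed

section \<open>The projected distribution on test fields\<close>

lemma summable_on_freq_decay:
  assumes t: "3 < t" and f: "\<And>k. k \<in> freq - {0} \<Longrightarrow> norm (f k) \<le> C * norm k powr (- t)"
  shows "(\<lambda>k. norm (f k)) summable_on freq"
proof -
  obtain D where D: "\<forall>F. finite F \<and> F \<subseteq> freq - {0} \<longrightarrow> (\<Sum>k\<in>F. norm k powr (- t)) \<le> D"
    using lattice_sum_bounded[OF t] by (elim exE)
  have "(\<lambda>k. norm k powr (- t)) summable_on (freq - {0})"
    by (rule summable_on_bounded(1)[where C = D]) (use D in auto)
  then have "(\<lambda>k. C * norm k powr (- t)) summable_on (freq - {0})" by (rule summable_on_cmult_right)
  then have "(\<lambda>k. norm (f k)) summable_on (freq - {0})"
    by (rule Infinite_Sum.abs_summable_on_comparison_test') (rule f)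
  then have "(\<lambda>k. norm (f k)) summable_on insert 0 (freq - {0})"
    by (subst summable_on_insert_iff)
  then show ?thesis by (simp add: insert_absorb)
qed

lemma test_coeff_summable:
  assumes \<phi>: "\<phi> \<in> test_fields"
  shows "(\<lambda>k. norm (fcoeff \<phi> k)) summable_on freq"
    and "(\<lambda>k. (stokes_symbol \<beta> k * norm (fcoeff \<phi> k))\<^sup>2) summable_on freq"
proof -
  have pw: "norm (fcoeff \<phi> k) \<le> C * norm k powr (- real N)"
    if "\<forall>k\<in>freq. norm k ^ N * norm (fcoeff \<phi> k) \<le> C" "k \<in> freq - {0}" for C N k
  proof -
    have "norm k ^ N * norm (fcoeff \<phi> k) \<le> C" using that by blast
    then have "norm k powr real N * norm (fcoeff \<phi> k) \<le> C" using that(2) by (simp add: powr_realpow)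
    then have "norm k powr (- real N) * (norm k powr real N * norm (fcoeff \<phi> k)) \<le> norm k powr (- real N) * C"
      by (rule mult_left_mono) simp
    then show ?thesis using that(2) by (simp add: mult.assoc[symmetric] powr_add[symmetric] mult.commute[of C])
  qed
  obtain C where "\<forall>k\<in>freq. norm k ^ 4 * norm (fcoeff \<phi> k) \<le> C" using fcoeff_decay[OF \<phi>] by blast
  then show "(\<lambda>k. norm (fcoeff \<phi> k)) summable_on freq"
    using pw[of 4 C] by (intro summable_on_freq_decay[of 4 _ C]) auto
  \<comment> \<open>Squared and weighted, the coefficients decay like |k|^(4\<beta> - 2N); this
    choice makes 2N - 4\<beta> at least 4, above the threshold 3.\<close>
  obtain N :: nat where N: "2 * \<beta> + 2 \<le> real N" using real_arch_simple by blast
  obtain C where C: "\<forall>k\<in>freq. norm k ^ N * norm (fcoeff \<phi> k) \<le> C" using fcoeff_decay[OF \<phi>] by blast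
  let ?c = "(4 * pi\<^sup>2) powr \<beta>"
  have "(\<lambda>k. norm ((stokes_symbol \<beta> k * norm (fcoeff \<phi> k))\<^sup>2)) summable_on freq"
  proof (rule summable_on_freq_decay)
    show "3 < 2 * real N - 4 * \<beta>" using N by simp
    fix k :: "real^3" assume k: "k \<in> freq - {0}"
    have "stokes_symbol \<beta> k * norm (fcoeff \<phi> k) \<le> stokes_symbol \<beta> k * (C * norm k powr (- real N))"
      by (intro mult_left_mono pw[OF C k]) simp
    also have "\<dots> = ?c * C * (norm k powr (2 * \<beta>) * norm k powr (- real N))"
      by (simp only: stokes_symbol_eq mult_ac)
    also have "\<dots> = ?c * C * norm k powr (2 * \<beta> - real N)"
      by (simp add: powr_add[symmetric])
    finally have "(stokes_symbol \<beta> k * norm (fcoeff \<phi> k))\<^sup>2 \<le> (?c * C * norm k powr (2 * \<beta> - real N))\<^sup>2"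
      by (intro power_mono) auto
    also have "\<dots> = (?c * C)\<^sup>2 * norm k powr (- (2 * real N - 4 * \<beta>))"
      by (simp add: power_mult_distrib powr_squared right_diff_distrib)
    finally show "norm ((stokes_symbol \<beta> k * norm (fcoeff \<phi> k))\<^sup>2) \<le> (?c * C)\<^sup>2 * norm k powr (- (2 * real N - 4 * \<beta>))"
      by simp
  qed
  then show "(\<lambda>k. (stokes_symbol \<beta> k * norm (fcoeff \<phi> k))\<^sup>2) summable_on freq" by simp
qed

text \<open>Ensures that \<open>stokes_norm\<close> of a projected test field is a genuine weighted
  sum of coefficients for every exponent, rather than an unspecified choice.\<close>

lemma leray_test_dom:
  assumes \<phi>: "\<phi> \<in> test_fields"
  shows "leray \<phi> \<in> stokes_dom \<beta>"
proof -
  note l = leray_coeff[OF test_L2[OF \<phi>]]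
  have "(\<lambda>k. (stokes_symbol \<beta> k * norm (fcoeff (leray \<phi>) k))\<^sup>2) summable_on freq"
  proof (rule summable_on_comparison_test[OF test_coeff_summable(2)[OF \<phi>, of \<beta>]])
    fix k assume "k \<in> freq"
    then show "(stokes_symbol \<beta> k * norm (fcoeff (leray \<phi>) k))\<^sup>2 \<le> (stokes_symbol \<beta> k * norm (fcoeff \<phi> k))\<^sup>2"
      using l by (intro power_mono mult_left_mono) (auto simp: norm_leray_symbol_le)
  qed auto
  then show ?thesis using l by (simp add: stokes_dom_iff)
qed

text \<open>The form with both arguments projected is the one to which the duality estimate applies.
  The other form is visibly linear in \<phi> and is compared with the pairing of a representing
  field.\<close>

lemma leray_dist_has_sum:
  assumes g: "integrable torus g" and \<phi>: "\<phi> \<in> test_fields"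
  shows "((\<lambda>k. leray_symbol k (fcoeff g k) \<bullet> leray_symbol k (fcoeff \<phi> k)) has_sum leray_dist g \<phi>) freq"
    and "((\<lambda>k. leray_symbol k (fcoeff g k) \<bullet> fcoeff \<phi> k) has_sum leray_dist g \<phi>) freq"
proof -
  note l = leray_coeff[OF test_L2[OF \<phi>]]
  have "(\<lambda>k. norm (fcoeff (leray \<phi>) k)) summable_on freq"
    by (rule Infinite_Sum.abs_summable_on_comparison_test'[OF test_coeff_summable(1)[OF \<phi>]])
       (use l norm_leray_symbol_le in auto)
  then have *: "((\<lambda>k. fcoeff g k \<bullet> fcoeff (leray \<phi>) k) has_sum leray_dist g \<phi>) freq"
    unfolding leray_dist_def using l by (intro parseval_L1 g H_space_L2) auto
  have eq: "leray_symbol k (fcoeff g k) \<bullet> leray_symbol k (fcoeff \<phi> k) = fcoeff g k \<bullet> fcoeff (leray \<phi>) k"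
    "leray_symbol k (fcoeff g k) \<bullet> fcoeff \<phi> k = fcoeff g k \<bullet> fcoeff (leray \<phi>) k" if "k \<in> freq" for k
    using that l by (auto simp: leray_symbol_inner[OF solenoidal_leray_symbol] leray_symbol_adjoint[of k _ "fcoeff \<phi> k"])
  show "((\<lambda>k. leray_symbol k (fcoeff g k) \<bullet> leray_symbol k (fcoeff \<phi> k)) has_sum leray_dist g \<phi>) freq"
    "((\<lambda>k. leray_symbol k (fcoeff g k) \<bullet> fcoeff \<phi> k) has_sum leray_dist g \<phi>) freq"
    using * by (simp_all only: eq cong: has_sum_cong)
qed

lemma leray_dist_linear:
  assumes g: "integrable torus g"
  shows "linear_on_tests (leray_dist g)"
  unfolding linear_on_tests_def
proof (intro ballI allI)
  fix \<phi> \<psi> a b assume t: "\<phi> \<in> test_fields" "\<psi> \<in> test_fields"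
  let ?f = "\<lambda>\<phi> k. leray_symbol k (fcoeff g k) \<bullet> fcoeff \<phi> k"
  have "fcoeff (\<lambda>x. a *\<^sub>R \<phi> x + b *\<^sub>R \<psi> x) k = a *\<^sub>R fcoeff \<phi> k + b *\<^sub>R fcoeff \<psi> k" for k
    using t by (subst fcoeff_add) (auto simp: fcoeff_scale test_integrable)
  then have "(?f (\<lambda>x. a *\<^sub>R \<phi> x + b *\<^sub>R \<psi> x) has_sum (a * leray_dist g \<phi> + b * leray_dist g \<psi>)) freq"
    using has_sum_add[OF has_sum_cmult_right[OF leray_dist_has_sum(2)[OF g t(1)], of a]
        has_sum_cmult_right[OF leray_dist_has_sum(2)[OF g t(2)], of b]]
    by (simp add: inner_add_right)
  from has_sum_unique[OF leray_dist_has_sum(2)[OF g test_lincomb[OF t]] this]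
  show "leray_dist g (\<lambda>x. a *\<^sub>R \<phi> x + b *\<^sub>R \<psi> x) = a * leray_dist g \<phi> + b * leray_dist g \<psi>" .
qed

text \<open>As the Stokes symbol is at least 1 off the origin, the bound makes the projected
  coefficients square summable, and Riesz-Fischer turns them into a field U representing the
  distribution.\<close>

lemma scale_space_nonneg:
  assumes \<gamma>: "0 \<le> \<gamma>" and g: "integrable torus g" and N: "0 \<le> N"
    and bound: "l2_bound (\<lambda>k. stokes_symbol \<gamma> k * norm (leray_symbol k (fcoeff g k))) (N\<^sup>2)"
  shows "leray_dist g \<in> scale_space \<gamma> \<and> scale_norm \<gamma> (leray_dist g) \<le> N"
proof -
  let ?c = "\<lambda>k. leray_symbol k (fcoeff g k)"
  have sm: "(\<lambda>k. (stokes_symbol \<gamma> k * norm (?c k))\<^sup>2) summable_on freq"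
    and le: "(\<Sum>\<^sub>\<infinity>k\<in>freq. (stokes_symbol \<gamma> k * norm (?c k))\<^sup>2) \<le> N\<^sup>2"
    by (rule summable_on_bounded[where C = "N\<^sup>2"]; use bound[THEN l2_boundD] in simp)+
  obtain U where U: "U \<in> H_space" "\<And>k. k \<in> freq \<Longrightarrow> fcoeff U k = ?c k"
  proof (rule H_space_ex[where c = ?c])
    show "(\<lambda>k. (norm (?c k))\<^sup>2) summable_on freq"
    proof (rule summable_on_comparison_test[OF sm])
      fix k :: "real^3" assume k: "k \<in> freq"
      have "norm (?c k) \<le> stokes_symbol \<gamma> k * norm (?c k)"
      proof (cases "k = 0")
        case False
        then show ?thesis using mult_right_mono[OF stokes_symbol_ge_1[OF \<gamma> k], of "norm (?c k)"] by simp
      qed (simp add: leray_symbol_def)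
      then show "(norm (?c k))\<^sup>2 \<le> (stokes_symbol \<gamma> k * norm (?c k))\<^sup>2" by (intro power_mono) auto
    qed auto
  qed (auto simp: fcoeff_uminus leray_symbol_vcnj solenoidal_leray_symbol)
  have "(\<lambda>k. (stokes_symbol \<gamma> k * norm (fcoeff U k))\<^sup>2) summable_on freq"
    using sm U(2) by (simp cong: summable_on_cong)
  then have Ud: "U \<in> stokes_dom \<gamma>" using U(1) by (simp add: stokes_dom_iff)
  have rep: "represents U (leray_dist g)"
    unfolding represents_def
  proof
    fix \<phi> assume \<phi>: "\<phi> \<in> test_fields"
    have "((\<lambda>k. fcoeff U k \<bullet> fcoeff \<phi> k) has_sum leray_dist g \<phi>) freq"
      using leray_dist_has_sum(2)[OF g \<phi>] U(2) by (simp cong: has_sum_cong)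
    from has_sum_unique[OF this parseval_field[OF H_space_L2[OF U(1)] test_L2[OF \<phi>]]]
    show "leray_dist g \<phi> = L2_inner U \<phi>" .
  qed
  \<comment> \<open>The norm is defined through a chosen representative; testing against wave fields
    shows that every choice has the coefficients of U, hence the same norm.\<close>
  define W where "W = (SOME u. u \<in> stokes_dom \<gamma> \<and> represents u (leray_dist g))"
  have W: "W \<in> stokes_dom \<gamma> \<and> represents W (leray_dist g)"
    unfolding W_def by (rule someI[of _ U]) (use Ud rep in blast)
  have WH: "W \<in> H_space" using W by (simp add: stokes_dom_iff)
  have WU: "fcoeff W k = ?c k" if k: "k \<in> freq" for k
  proof -
    have "L2_inner W (wave_field k z) = L2_inner U (wave_field k z)" for z
      using W rep wave_field_test[OF k] by (auto simp: represents_def)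
    then have "fcoeff W k = fcoeff U k"
      by (intro fcoeff_eqI L2_fields_integrable H_space_L2 WH U) auto
    then show ?thesis using U(2) k by simp
  qed
  have "((\<lambda>k. (stokes_symbol \<gamma> k * norm (?c k))\<^sup>2) has_sum (stokes_norm \<gamma> W)\<^sup>2) freq"
    using stokes_norm_has_sum[of W \<gamma>] W WU by (simp cong: has_sum_cong)
  from infsumI[OF this] have "(stokes_norm \<gamma> W)\<^sup>2 \<le> N\<^sup>2" using le by simp
  then have "stokes_norm \<gamma> W \<le> N" using N by (rule power2_le_imp_le)
  then show ?thesis
    using \<gamma> Ud rep by (auto simp: scale_space_def scale_norm_def W_def)
qed

text \<open>Duality: the weights with exponents \<gamma> and -\<gamma> multiply to 1 off the origin,
  so Cauchy-Schwarz bounds the pairing by N times the norm of the projected test field.\<close>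

lemma scale_space_neg:
  assumes \<gamma>: "\<gamma> < 0" and g: "integrable torus g" and N: "0 \<le> N"
    and bound: "l2_bound (\<lambda>k. stokes_symbol \<gamma> k * norm (leray_symbol k (fcoeff g k))) (N\<^sup>2)"
  shows "leray_dist g \<in> scale_space \<gamma> \<and> scale_norm \<gamma> (leray_dist g) \<le> N"
proof -
  have est: "\<bar>leray_dist g \<phi>\<bar> \<le> N * stokes_norm (- \<gamma>) (leray \<phi>)" if \<phi>: "\<phi> \<in> test_fields" for \<phi>
  proof -
    let ?c = "\<lambda>k. leray_symbol k (fcoeff g k)" and ?d = "\<lambda>k. leray_symbol k (fcoeff \<phi> k)"
    note l = leray_coeff[OF test_L2[OF \<phi>]]
    have fin: "\<bar>\<Sum>k\<in>freq_cube n. ?c k \<bullet> ?d k\<bar> \<le> N * stokes_norm (- \<gamma>) (leray \<phi>)" for n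
    proof -
      have "\<bar>\<Sum>k\<in>freq_cube n. ?c k \<bullet> ?d k\<bar> \<le> (\<Sum>k\<in>freq_cube n. \<bar>stokes_symbol \<gamma> k * norm (?c k)\<bar> * \<bar>stokes_symbol (- \<gamma>) k * norm (?d k)\<bar>)"
      proof (rule order_trans[OF sum_abs], rule sum_mono)
        fix k
        show "\<bar>?c k \<bullet> ?d k\<bar> \<le> \<bar>stokes_symbol \<gamma> k * norm (?c k)\<bar> * \<bar>stokes_symbol (- \<gamma>) k * norm (?d k)\<bar>"
        proof (cases "k = 0")
          case False
          have eq: "\<bar>stokes_symbol \<gamma> k * norm (?c k)\<bar> * \<bar>stokes_symbol (- \<gamma>) k * norm (?d k)\<bar>
             = (stokes_symbol \<gamma> k * stokes_symbol (- \<gamma>) k) * (norm (?c k) * norm (?d k))"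
            by (simp add: abs_mult)
          show ?thesis
            unfolding eq stokes_symbol_minus[OF False] mult_1 by (rule Cauchy_Schwarz_ineq2)
        qed (simp add: leray_symbol_def)
      qed
      also have "\<dots> \<le> L2_set (\<lambda>k. stokes_symbol \<gamma> k * norm (?c k)) (freq_cube n) * L2_set (\<lambda>k. stokes_symbol (- \<gamma>) k * norm (?d k)) (freq_cube n)"
        by (rule L2_set_mult_ineq)
      also have "\<dots> \<le> N * stokes_norm (- \<gamma>) (leray \<phi>)"
      proof (intro mult_mono N L2_set_nonneg)
        show "L2_set (\<lambda>k. stokes_symbol \<gamma> k * norm (?c k)) (freq_cube n) \<le> N"
          unfolding L2_set_def using l2_boundD[OF bound, of "freq_cube n"] N by (intro real_le_lsqrt) (auto intro!: sum_nonneg)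
        have "(\<Sum>k\<in>freq_cube n. (stokes_symbol (- \<gamma>) k * norm (?d k))\<^sup>2) =
           (\<Sum>k\<in>freq_cube n. (stokes_symbol (- \<gamma>) k * norm (fcoeff (leray \<phi>) k))\<^sup>2)"
          using l by (intro sum.cong) (auto dest: freq_cubeD)
        also have "\<dots> \<le> (stokes_norm (- \<gamma>) (leray \<phi>))\<^sup>2"
          by (intro l2_boundD[OF stokes_norm_l2_bound] leray_test_dom \<phi>) auto
        finally show "L2_set (\<lambda>k. stokes_symbol (- \<gamma>) k * norm (?d k)) (freq_cube n) \<le> stokes_norm (- \<gamma>) (leray \<phi>)"
          unfolding L2_set_def by (intro real_le_lsqrt) (auto intro!: sum_nonneg)
      qed
      finally show ?thesis .
    qed
    have "(\<lambda>n. \<bar>\<Sum>k\<in>freq_cube n. ?c k \<bullet> ?d k\<bar>) \<longlonglongrightarrow> \<bar>leray_dist g \<phi>\<bar>"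
      by (intro tendsto_rabs has_sum_freq_cube leray_dist_has_sum(1) g \<phi>)
    then show ?thesis by (rule LIMSEQ_le_const2) (use fin in blast)
  qed
  have "Sup {\<bar>leray_dist g \<phi>\<bar> | \<phi>. \<phi> \<in> test_fields \<and> stokes_norm (- \<gamma>) (leray \<phi>) \<le> 1} \<le> N"
  proof (rule cSup_least)
    \<comment> \<open>The zero field shows that the set under the supremum is not empty, without
      which its supremum would be unspecified.\<close>
    have zt: "field_sum {} (\<lambda>_. 0) \<in> test_fields" by (rule field_sum_test) simp
    have "fcoeff (field_sum {} (\<lambda>_. 0)) k = 0" for k
      by (simp add: fcoeff_def field_sum_def fourier_0 vec_eq_iff)
    then have "fcoeff (leray (field_sum {} (\<lambda>_. 0))) k = 0" if "k \<in> freq" for k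
      using that leray_coeff[OF test_L2[OF zt]] norm_leray_symbol_le[of k 0] by auto
    then have "((\<lambda>k. 0) has_sum (stokes_norm (- \<gamma>) (leray (field_sum {} (\<lambda>_. 0))))\<^sup>2) freq"
      using stokes_norm_has_sum[OF leray_test_dom[OF zt], of "- \<gamma>"] by (simp cong: has_sum_cong)
    then have "stokes_norm (- \<gamma>) (leray (field_sum {} (\<lambda>_. 0))) = 0"
      using has_sum_unique[OF _ has_sum_0] by fastforce
    then show "{\<bar>leray_dist g \<phi>\<bar> | \<phi>. \<phi> \<in> test_fields \<and> stokes_norm (- \<gamma>) (leray \<phi>) \<le> 1} \<noteq> {}"
      using zt by fastforce
    fix y assume "y \<in> {\<bar>leray_dist g \<phi>\<bar> | \<phi>. \<phi> \<in> test_fields \<and> stokes_norm (- \<gamma>) (leray \<phi>) \<le> 1}"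
    then obtain \<phi> where \<phi>: "y = \<bar>leray_dist g \<phi>\<bar>" "\<phi> \<in> test_fields" "stokes_norm (- \<gamma>) (leray \<phi>) \<le> 1" by blast
    have "y \<le> N * stokes_norm (- \<gamma>) (leray \<phi>)" using est \<phi> by simp
    also have "\<dots> \<le> N * 1" using \<phi>(3) N by (intro mult_left_mono) auto
    finally show "y \<le> N" by simp
  qed
  moreover have "\<exists>M. \<forall>\<phi>\<in>test_fields. \<bar>leray_dist g \<phi>\<bar> \<le> M * stokes_norm (- \<gamma>) (leray \<phi>)"
    using est by blast
  ultimately show ?thesis
    using \<gamma> leray_dist_linear[OF g] by (simp add: scale_space_def scale_norm_def)
qed

lemma B_maps_continuouslyI:
  assumes s: "1/2 \<le> s" and bb: "bilinear_bounded (2 * s) (2 * \<gamma>)"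
  shows "B_maps_continuously s \<gamma>"
proof -
  obtain C where C: "C \<ge> 0" and CC: "\<forall>u\<in>stokes_dom s. \<forall>v\<in>stokes_dom s.
    l2_bound (\<lambda>k. stokes_symbol \<gamma> k * norm (leray_symbol k (fcoeff (convective u v) k)))
      ((C * stokes_norm s u * stokes_norm s v)\<^sup>2)"
    using leray_convective_estimate[OF s bb] by (elim exE conjE)
  have "B_defined u v \<and> B_op u v \<in> scale_space \<gamma> \<and> scale_norm \<gamma> (B_op u v) \<le> C * stokes_norm s u * stokes_norm s v"
    if uv: "u \<in> stokes_dom s" "v \<in> stokes_dom s" for u v
  proof -
    have L: "u \<in> L2_fields" "v \<in> L2_fields" using uv by (auto simp: stokes_dom_iff H_space_L2)
    note grad = stokes_dom_gradient[OF s uv(2)]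
    have i: "integrable torus (convective u v)" by (rule convective_coeff(1)[OF L grad])
    have "\<forall>i. \<exists>w. weak_partial_graph i v w" using weak_partial_ex[OF L(2) grad] by blast
    then have "B_defined u v" using i by (simp add: B_defined_def)
    moreover have "B_op u v \<in> scale_space \<gamma> \<and> scale_norm \<gamma> (B_op u v) \<le> C * stokes_norm s u * stokes_norm s v"
    proof -
      have N: "0 \<le> C * stokes_norm s u * stokes_norm s v" using C by simp
      note b = CC[rule_format, OF uv]
      show ?thesis
        unfolding B_op_def
        using scale_space_nonneg[OF _ i N b] scale_space_neg[OF _ i N b] by (cases "0 \<le> \<gamma>") auto
    qed
    ultimately show ?thesis by blast
  qed
  then show ?thesis unfolding B_maps_continuously_def by blast
qed

theorem lemmaD2:
  shows "(\<forall>\<alpha>::real. \<alpha> > 0 \<and> \<alpha> \<noteq> 1/2 \<longrightarrow> B_maps_continuously (theta \<alpha>) (\<alpha> - 1/4)) \<and>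
         (\<forall>\<epsilon>::real. \<epsilon> > 0 \<longrightarrow> B_maps_continuously (3/4) (1/4 - \<epsilon>))"
proof (intro conjI allI impI)
  fix \<alpha> :: real assume \<alpha>: "\<alpha> > 0 \<and> \<alpha> \<noteq> 1/2"
  \<comment> \<open>A has order two, so A^\<beta> multiplies by a power 2\<beta> of |k|; hence the
    doubling of both exponents when passing to the multiplier.\<close>
  have eq: "2 * (\<alpha> - 1/4) = 2 * \<alpha> - 1/2" by simp
  show "B_maps_continuously (theta \<alpha>) (\<alpha> - 1/4)"
  proof (cases "\<alpha> < 1/2")
    case True
    then have "2 * theta \<alpha> = 1 + \<alpha>" "1/2 \<le> theta \<alpha>" using \<alpha> by (simp_all add: theta_def)
    moreover have "bilinear_bounded (1 + \<alpha>) (2 * \<alpha> - 1/2)"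
      using \<alpha> True by (intro bilinear_bounded_subcritical) auto
    ultimately show ?thesis by (intro B_maps_continuouslyI) (simp_all only: eq)
  next
    case False
    then have "2 * theta \<alpha> = 1/2 + 2 * \<alpha>" "1/2 \<le> theta \<alpha>" using \<alpha> by (simp_all add: theta_def)
    moreover have "bilinear_bounded (1/2 + 2 * \<alpha>) (2 * \<alpha> - 1/2)"
      using \<alpha> False by (intro bilinear_bounded_supercritical) auto
    ultimately show ?thesis by (intro B_maps_continuouslyI) (simp_all only: eq)
  qed
next
  fix \<epsilon> :: real assume "\<epsilon> > 0"
  then have "bilinear_bounded (3/2) (1/2 - 2 * \<epsilon>)" by (rule bilinear_bounded_critical)
  moreover have "2 * (3/4) = (3/2 :: real)" "2 * (1/4 - \<epsilon>) = 1/2 - 2 * \<epsilon>" by simp_all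
  ultimately show "B_maps_continuously (3/4) (1/4 - \<epsilon>)"
    by (intro B_maps_continuouslyI) simp_all
qed

end
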